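(* Let $n\geq 1$ be an integer and let $G$ be an $FC^n$-group. Then: (a) $L(G)=\overline{L}(G)=F(G)$, i.e. the set of left Engel elements and the set of bounded left Engel elements of $G$ both coincide with the Fitting subgroup of $G$; (b) $R(G)=\rho(G)=\overline{Z}(G)=Z_{\omega+(n-1)}(G)$, i.e. the set of right Engel elements of $G$ equals $\rho(G)$ and coincides with the hypercentre of $G$, which equals $Z_{\omega+(n-1)}(G)$; (c) $\overline{R}(G)=\overline{\rho}(G)$.
   Context: Commutators: $x^y=y^{-1}xy$, $[x,_1 y]=[x,y]=x^{-1}x^y$, and $[x,_m y]=[[x,_{m-1}y],y]$ for $m\geq 2$. Engel elements: for a group $G$, $L(G)$ is the set of left Engel elements, i.e. those $a\in G$ such that for every $g\in G$ there is $m=m(a,g)\geq 1$ with $[g,_m a]=1$. $\overline{L}(G)$ is the set of bounded left Engel elements, i.e. those $a\in G$ for which there is a single $m=m(a)\ge 1$ with $[g,_m a]=1$ for all $g\in G$. $R(G)$ is the set of right Engel elements, i.e. those $a\in G$ such that for every $g\in G$ there is $m=m(a,g)\geq 1$ with $[a,_m g]=1$. $\overline{R}(G)$ is the set of bounded right Engel elements, i.e. those $a\in G$ for which there is a single $m=m(a)\geq 1$ with $[a,_m g]=1$ for all $g\in G$. $FC^n$-groups: for $x\in G$, $x^G$ denotes the normal closure of $\langle x\rangle$ in $G$. $FC^0$ is the class of finite groups; for $n\geq 1$, a group $G$ is an $FC^n$-group if for every $x\in G$ the factor group $G/C_G(x^G)$ belongs to $FC^{n-1}$. The Fitting subgroup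 $F(G)$ is the subgroup generated by all nilpotent normal subgroups of $G$. $Z_\alpha(G)$ denotes the $\alpha$-th term of the (transfinite) upper central series: $Z_0(G)=1$, $Z_{\alpha+1}(G)/Z_\alpha(G)$ is the centre of $G/Z_\alpha(G)$, and $Z_\lambda(G)=\bigcup_{\alpha<\lambda}Z_\alpha(G)$ for limit ordinals $\lambda$; $\overline{Z}(G)$, the hypercentre, is the final (union of all) terms of this series. $\rho(G)$ is the set of all $a\in G$ such that $\langle x\rangle$ is ascendant in $\langle x,a^G\rangle$ for every $x\in G$ (a subgroup $H$ of $K$ is ascendant if there is a well-ordered ascending series from $H$ to $K$, each term normal in its successor, with unions at limit ordinals). $\overline{\rho}(G)$ is the set of all $a\in G$ for which there is an integer $k=k(a)$ such that, for every $x\in G$, $\langle x\rangle$ is subnormal in $\langle x,a^G\rangle$ of defect at most $k$. *)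

theory Defs
  imports "HOL-Algebra.Generated_Groups"
begin

section \<open>Commutators and Engel elements\<close>

definition conj_by :: "('a, 'm) monoid_scheme \<Rightarrow> 'a \<Rightarrow> 'a \<Rightarrow> 'a" where
  "conj_by G x y = inv\<^bsub>G\<^esub> y \<otimes>\<^bsub>G\<^esub> x \<otimes>\<^bsub>G\<^esub> y"

definition group_commutator :: "('a, 'm) monoid_scheme \<Rightarrow> 'a \<Rightarrow> 'a \<Rightarrow> 'a" where
  "group_commutator G x y = inv\<^bsub>G\<^esub> x \<otimes>\<^bsub>G\<^esub> conj_by G x y"

text \<open>The iterated commutator \<open>[x,\<^sub>m y]\<close>, which is meant for \<open>m \<ge> 1\<close>; starting from
  \<open>[x,\<^sub>0 y] = x\<close> gives \<open>[x,\<^sub>1 y] = [x,y]\<close>.\<close>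

primrec engel_commutator :: "('a, 'm) monoid_scheme \<Rightarrow> 'a \<Rightarrow> nat \<Rightarrow> 'a \<Rightarrow> 'a" where
  "engel_commutator G x 0 y = x"
| "engel_commutator G x (Suc m) y = group_commutator G (engel_commutator G x m y) y"

definition left_engel :: "('a, 'm) monoid_scheme \<Rightarrow> 'a set" where
  "left_engel G =
    {a \<in> carrier G. \<forall>g\<in>carrier G. \<exists>m\<ge>1. engel_commutator G g m a = \<one>\<^bsub>G\<^esub>}"

definition bounded_left_engel :: "('a, 'm) monoid_scheme \<Rightarrow> 'a set" where
  "bounded_left_engel G =
    {a \<in> carrier G. \<exists>m\<ge>1. \<forall>g\<in>carrier G. engel_commutator G g m a = \<one>\<^bsub>G\<^esub>}"

definition right_engel :: "('a, 'm) monoid_scheme \<Rightarrow> 'a set" where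
  "right_engel G =
    {a \<in> carrier G. \<forall>g\<in>carrier G. \<exists>m\<ge>1. engel_commutator G a m g = \<one>\<^bsub>G\<^esub>}"

definition bounded_right_engel :: "('a, 'm) monoid_scheme \<Rightarrow> 'a set" where
  "bounded_right_engel G =
    {a \<in> carrier G. \<exists>m\<ge>1. \<forall>g\<in>carrier G. engel_commutator G a m g = \<one>\<^bsub>G\<^esub>}"


section \<open>\<open>FC\<^sup>n\<close>-groups\<close>

definition normal_closure :: "('a, 'm) monoid_scheme \<Rightarrow> 'a \<Rightarrow> 'a set" where
  "normal_closure G x = \<Inter>{N. N \<lhd> G \<and> generate G {x} \<subseteq> N}"

definition centralizer :: "('a, 'm) monoid_scheme \<Rightarrow> 'a set \<Rightarrow> 'a set" where
  "centralizer G A = {g \<in> carrier G. \<forall>a\<in>A. g \<otimes>\<^bsub>G\<^esub> a = a \<otimes>\<^bsub>G\<^esub> g}"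

text \<open>A factor group of a group over \<open>'a\<close> lives over \<open>'a set\<close>, so that the recursion cannot
  be applied to it directly. It is applied to an isomorphic copy over \<open>'a\<close> instead; such a
  copy always exists, and its choice is irrelevant. The literal recursion on the factor groups
  themselves is proved below as \<open>fc_group_Suc_iff\<close>.\<close>

primrec fc_group :: "nat \<Rightarrow> 'a monoid \<Rightarrow> bool" where
  "fc_group 0 G \<longleftrightarrow> group G \<and> finite (carrier G)"
| "fc_group (Suc n) G \<longleftrightarrow> group G \<and>
    (\<forall>x\<in>carrier G. \<exists>H :: 'a monoid. H \<cong> G Mod centralizer G (normal_closure G x) \<and> fc_group n H)"

lemma fc_group_imp_group: "fc_group n G \<Longrightarrow> group G"
  by (cases n) auto

context group
begin

lemma normal_closure_normal:
  assumes x: "x \<in> carrier G"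
  shows "normal_closure G x \<lhd> G"
proof -
  let ?N = "{N. N \<lhd> G \<and> generate G {x} \<subseteq> N}"
  have car: "carrier G \<in> ?N"
    using x generate_incl[of "{x}"]
    by (auto simp: normal_inv_iff subgroup_self)
  have "subgroup (\<Inter>?N) G"
    using car by (intro subgroups_Inter) (auto simp: normal_imp_subgroup)
  moreover have "y \<otimes> h \<otimes> inv y \<in> \<Inter>?N" if "y \<in> carrier G" "h \<in> \<Inter>?N" for y h
    using that by (auto intro: normal.inv_op_closed2)
  ultimately show ?thesis
    by (auto simp: normal_closure_def normal_inv_iff)
qed

lemma normal_closure_subset: "x \<in> carrier G \<Longrightarrow> normal_closure G x \<subseteq> carrier G"
  using normal_closure_normal normal_imp_subgroup subgroup.subset by blast

lemma centralizer_normal: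
  assumes "N \<lhd> G"
  shows "centralizer G N \<lhd> G"
proof -
  interpret N: normal N G by fact
  have sub: "subgroup (centralizer G N) G"
  proof
    show "centralizer G N \<subseteq> carrier G" by (auto simp: centralizer_def)
    show "\<one> \<in> centralizer G N" using N.subset by (auto simp: centralizer_def)
    fix g assume g: "g \<in> centralizer G N"
    then have gc: "g \<in> carrier G" and ga: "\<And>a. a \<in> N \<Longrightarrow> g \<otimes> a = a \<otimes> g"
      by (auto simp: centralizer_def)
    show "g \<otimes> h \<in> centralizer G N" if h: "h \<in> centralizer G N" for h
    proof -
      have hc: "h \<in> carrier G" and ha: "\<And>a. a \<in> N \<Longrightarrow> h \<otimes> a = a \<otimes> h"
        using h by (auto simp: centralizer_def)
      have "g \<otimes> h \<otimes> a = a \<otimes> (g \<otimes> h)" if a: "a \<in> N" for a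
      proof -
        have ac: "a \<in> carrier G" using a by (rule N.mem_carrier)
        have "g \<otimes> h \<otimes> a = (g \<otimes> a) \<otimes> h" using gc hc ac a by (simp add: m_assoc ha)
        also have "\<dots> = a \<otimes> (g \<otimes> h)" using gc hc ac a by (simp add: m_assoc ga)
        finally show ?thesis .
      qed
      then show ?thesis using gc hc by (simp add: centralizer_def)
    qed
    have "inv g \<otimes> a = a \<otimes> inv g" if a: "a \<in> N" for a
    proof -
      have ac: "a \<in> carrier G" using a by (rule N.mem_carrier)
      have "inv g \<otimes> a = inv g \<otimes> (a \<otimes> g) \<otimes> inv g" using gc ac by (simp add: m_assoc)
      also have "\<dots> = inv g \<otimes> (g \<otimes> a) \<otimes> inv g" using a by (simp add: ga)
      also have "\<dots> = a \<otimes> inv g" using gc ac by (simp add: m_assoc[symmetric])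
      finally show ?thesis .
    qed
    then show "inv g \<in> centralizer G N" using g by (auto simp: centralizer_def)
  qed
  have "y \<otimes> g \<otimes> inv y \<in> centralizer G N"
    if y: "y \<in> carrier G" and g: "g \<in> centralizer G N" for y g
  proof -
    have gc: "g \<in> carrier G" using g by (simp add: centralizer_def)
    have "y \<otimes> g \<otimes> inv y \<otimes> a = a \<otimes> (y \<otimes> g \<otimes> inv y)" if a: "a \<in> N" for a
    proof -
      define b where "b = inv y \<otimes> a \<otimes> y"
      have b: "b \<in> N" unfolding b_def using y a by (rule N.inv_op_closed1)
      have bc: "b \<in> carrier G" using b by (rule N.mem_carrier)
      have ac: "a \<in> carrier G" using a by (rule N.mem_carrier)
      have c1: "y \<otimes> (inv y \<otimes> z) = z" if "z \<in> carrier G" for z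
        using that y by (simp add: m_assoc[symmetric])
      have c2: "inv y \<otimes> (y \<otimes> z) = z" if "z \<in> carrier G" for z
        using that y by (simp add: m_assoc[symmetric])
      have ab: "a = y \<otimes> b \<otimes> inv y"
        unfolding b_def using y ac by (simp add: m_assoc c1)
      have comm: "g \<otimes> b = b \<otimes> g" using g b by (simp add: centralizer_def)
      have "y \<otimes> g \<otimes> inv y \<otimes> a = y \<otimes> (g \<otimes> b) \<otimes> inv y"
        unfolding ab using y gc bc by (simp add: m_assoc c2)
      also have "\<dots> = a \<otimes> (y \<otimes> g \<otimes> inv y)"
        unfolding ab comm using y gc bc by (simp add: m_assoc c2)
      finally show ?thesis .
    qed
    then show ?thesis using y gc by (simp add: centralizer_def)
  qed
  with sub show ?thesis by (simp add: normal_inv_iff)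
qed

end

lemma iso_image_normal:
  assumes G: "group G" and H: "group H" and f: "f \<in> iso G H" and N: "N \<lhd> G"
  shows "f ` N \<lhd> H"
proof -
  interpret f: group_hom G H f
    using assms by (simp add: group_hom_def group_hom_axioms_def iso_def)
  interpret N: normal N G by fact
  have im: "f ` carrier G = carrier H" using f by (auto simp: iso_def bij_betw_def)
  have "subgroup (f ` N) H" by (rule f.subgroup_img_is_subgroup) (rule N.is_subgroup)
  moreover have "y \<otimes>\<^bsub>H\<^esub> h \<otimes>\<^bsub>H\<^esub> inv\<^bsub>H\<^esub> y \<in> f ` N"
    if y: "y \<in> carrier H" and h: "h \<in> f ` N" for y h
  proof -
    obtain u v where u: "u \<in> carrier G" "y = f u" and v: "v \<in> N" "h = f v"
      using y h im by blast
    have "y \<otimes>\<^bsub>H\<^esub> h \<otimes>\<^bsub>H\<^esub> inv\<^bsub>H\<^esub> y = f (u \<otimes>\<^bsub>G\<^esub> v \<otimes>\<^bsub>G\<^esub> inv\<^bsub>G\<^esub> u)"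
      using u v N.mem_carrier by simp
    moreover have "u \<otimes>\<^bsub>G\<^esub> v \<otimes>\<^bsub>G\<^esub> inv\<^bsub>G\<^esub> u \<in> N" using u v by (simp add: N.inv_op_closed2)
    ultimately show ?thesis by simp
  qed
  ultimately show ?thesis using H by (simp add: group.normal_inv_iff)
qed

lemma iso_image_normal_closure_subset:
  assumes G: "group G" and H: "group H" and f: "f \<in> iso G H" and x: "x \<in> carrier G"
  shows "normal_closure H (f x) \<subseteq> f ` normal_closure G x"
proof -
  have nc: "normal_closure G x \<lhd> G" using G x by (rule group.normal_closure_normal)
  have im: "f ` normal_closure G x \<lhd> H" using G H f nc by (rule iso_image_normal)
  have "x \<in> normal_closure G x"
    unfolding normal_closure_def by (auto intro: generate.incl)
  then have "generate H {f x} \<subseteq> f ` normal_closure G x"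
    using im normal_imp_subgroup[OF im] by (intro group.generate_subgroup_incl[OF H]) auto
  with im show ?thesis by (auto simp: normal_closure_def[of H])
qed

lemma iso_image_normal_closure:
  assumes G: "group G" and H: "group H" and f: "f \<in> iso G H" and x: "x \<in> carrier G"
  shows "f ` normal_closure G x = normal_closure H (f x)"
proof
  show "normal_closure H (f x) \<subseteq> f ` normal_closure G x"
    using assms by (rule iso_image_normal_closure_subset)
  let ?g = "inv_into (carrier G) f"
  have inj: "inj_on f (carrier G)" and im: "f ` carrier G = carrier H"
    using f by (auto simp: iso_def bij_betw_def)
  have fx: "f x \<in> carrier H" and gfx: "?g (f x) = x"
    using x im inj by auto
  have "normal_closure G x \<subseteq> ?g ` normal_closure H (f x)"
    using iso_image_normal_closure_subset[OF H G group.iso_set_sym[OF G f] fx] gfx by simp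
  then have "f ` normal_closure G x \<subseteq> f ` ?g ` normal_closure H (f x)" by blast
  also have "\<dots> = normal_closure H (f x)"
    using group.normal_closure_subset[OF H fx] im
    by (force simp: image_image f_inv_into_f subset_iff image_iff)
  finally show "f ` normal_closure G x \<subseteq> normal_closure H (f x)" .
qed

lemma iso_image_centralizer:
  assumes G: "group G" and H: "group H" and f: "f \<in> iso G H" and A: "A \<subseteq> carrier G"
  shows "f ` centralizer G A = centralizer H (f ` A)"
proof -
  have inj: "inj_on f (carrier G)" and im: "f ` carrier G = carrier H" and hom: "f \<in> hom G H"
    using f by (auto simp: iso_def bij_betw_def)
  have "f g \<otimes>\<^bsub>H\<^esub> f a = f a \<otimes>\<^bsub>H\<^esub> f g \<longleftrightarrow> g \<otimes>\<^bsub>G\<^esub> a = a \<otimes>\<^bsub>G\<^esub> g"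
    if "g \<in> carrier G" "a \<in> A" for g a
  proof -
    have a: "a \<in> carrier G" using that A by blast
    have "f g \<otimes>\<^bsub>H\<^esub> f a = f (g \<otimes>\<^bsub>G\<^esub> a)" "f a \<otimes>\<^bsub>H\<^esub> f g = f (a \<otimes>\<^bsub>G\<^esub> g)"
      using hom_mult[OF hom] that a by auto
    moreover have "f (g \<otimes>\<^bsub>G\<^esub> a) = f (a \<otimes>\<^bsub>G\<^esub> g) \<longleftrightarrow> g \<otimes>\<^bsub>G\<^esub> a = a \<otimes>\<^bsub>G\<^esub> g"
      using that a group.is_monoid[OF G] by (intro inj_on_eq_iff[OF inj]) (auto intro: monoid.m_closed)
    ultimately show ?thesis by simp
  qed
  then show ?thesis
    unfolding centralizer_def im[symmetric] by auto
qed

lemma iso_FactGroup: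
  assumes G: "group G" and H: "group H" and f: "f \<in> iso G H" and N: "N \<lhd> G"
  shows "G Mod N \<cong> H Mod (f ` N)"
proof -
  interpret G: group G by fact
  interpret H: group H by fact
  interpret N: normal N G by fact
  have fN: "f ` N \<lhd> H" using G H f N by (rule iso_image_normal)
  interpret fN: normal "f ` N" H by fact
  have inj: "inj_on f (carrier G)" and im: "f ` carrier G = carrier H" and hom: "f \<in> hom G H"
    using f by (auto simp: iso_def bij_betw_def)
  define h where "h = (\<lambda>x. f ` N #>\<^bsub>H\<^esub> x) \<circ> f"
  have hh: "h \<in> hom G (H Mod f ` N)"
    unfolding h_def using hom fN.r_coset_hom_Mod by (rule Group.hom_compose)
  interpret h: group_hom G "H Mod f ` N" h
    using hh fN.factorgroup_is_group G by (simp add: group_hom_def group_hom_axioms_def)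
  have "kernel G (H Mod f ` N) h = N"
  proof -
    have "h x = f ` N \<longleftrightarrow> x \<in> N" if x: "x \<in> carrier G" for x
    proof -
      have fx: "f x \<in> carrier H" using x im by blast
      have "h x = f ` N \<longleftrightarrow> f x \<in> f ` N"
        unfolding h_def o_def using fx fN.is_subgroup
        by (metis H.coset_join1 H.coset_join2 fN.subset)
      also have "\<dots> \<longleftrightarrow> x \<in> N" using inj x N.subset by (meson inj_on_image_mem_iff)
      finally show ?thesis .
    qed
    then show ?thesis using N.subset by (auto simp: kernel_def)
  qed
  moreover have "h ` carrier G = carrier (H Mod f ` N)"
    unfolding h_def carrier_FactGroup by (simp add: im[symmetric] image_image)
  ultimately show ?thesis using h.FactGroup_iso by simp
qed

lemma group_copy:
  fixes K :: "('c, 'm) monoid_scheme" and r :: "'c \<Rightarrow> 'd"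
  assumes K: "group K" and r: "inj_on r (carrier K)"
  shows "\<exists>L :: 'd monoid. group L \<and> K \<cong> L \<and> L \<cong> K"
proof -
  interpret K: group K by fact
  define g where "g = inv_into (carrier K) r"
  have g: "g (r x) = x" if "x \<in> carrier K" for x
    using that r by (simp add: g_def)
  define L where "L = \<lparr>carrier = r ` carrier K, mult = (\<lambda>a b. r (g a \<otimes>\<^bsub>K\<^esub> g b)), one = r \<one>\<^bsub>K\<^esub>\<rparr>"
  have "monoid L"
    by unfold_locales (auto simp: L_def g K.m_assoc)
  moreover have "r \<in> iso K L"
    using r by (auto simp: L_def iso_def hom_def bij_betw_def g)
  ultimately show ?thesis
    using K.iso_imp_group K.iso_sym is_isoI by blast
qed

lemma group_copy_FactGroup:
  fixes H :: "('b, 'm) monoid_scheme"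
  assumes H: "group H" and N: "N \<lhd> H"
  shows "\<exists>L :: 'b monoid. group L \<and> H Mod N \<cong> L \<and> L \<cong> H Mod N"
proof (rule group_copy)
  interpret group H by fact
  interpret N: normal N H by fact
  show "group (H Mod N)" by (rule N.factorgroup_is_group)
  have "(SOME z. z \<in> X) \<in> X" if "X \<in> rcosets\<^bsub>H\<^esub> N" for X
    using that N.rcosets_non_empty by (metis ex_in_conv someI_ex)
  then show "inj_on (\<lambda>X. SOME z. z \<in> X) (carrier (H Mod N))"
    using rcos_disjoint[OF N.is_subgroup]
    by (auto simp: inj_on_def FactGroup_def pairwise_def disjnt_def) (metis IntI empty_iff)+
qed

lemma fc_group_iso:
  fixes G :: "'a monoid" and H :: "'b monoid"
  assumes "group G" "group H" "G \<cong> H" "fc_group n G"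
  shows "fc_group n H"
  using assms
proof (induction n arbitrary: G H)
  case 0
  then show ?case
    by (auto simp: is_iso_def iso_def dest: bij_betw_finite)
next
  case (Suc n)
  note G = Suc.prems(1) and H = Suc.prems(2)
  obtain f where f: "f \<in> iso G H" using Suc.prems(3) by (auto simp: is_iso_def)
  have inj: "inj_on f (carrier G)" and im: "f ` carrier G = carrier H"
    using f by (auto simp: iso_def bij_betw_def)
  have "\<exists>L :: 'b monoid. L \<cong> H Mod centralizer H (normal_closure H y) \<and> fc_group n L"
    if y: "y \<in> carrier H" for y
  proof -
    obtain x where x: "x \<in> carrier G" "y = f x" using y im by blast
    let ?C = "centralizer G (normal_closure G x)"
    have C: "?C \<lhd> G"
      using G x by (intro group.centralizer_normal group.normal_closure_normal)
    have fC: "f ` ?C = centralizer H (normal_closure H y)"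
      using G H f x by (simp add: iso_image_centralizer iso_image_normal_closure
          group.normal_closure_subset)
    obtain K :: "'a monoid" where K: "K \<cong> G Mod ?C" "fc_group n K"
      using Suc.prems(4) x by auto
    have gK: "group K" using K by (simp add: fc_group_imp_group)
    have Q: "K \<cong> H Mod centralizer H (normal_closure H y)"
      using K(1) iso_FactGroup[OF G H f C] fC by (metis iso_trans)
    obtain L :: "'b monoid" where L: "group L" "H Mod (f ` ?C) \<cong> L" "L \<cong> H Mod (f ` ?C)"
      using group_copy_FactGroup[OF H iso_image_normal[OF G H f C]] by blast
    have "K \<cong> L" using Q L(2) fC by (metis iso_trans)
    then have "fc_group n L" using Suc.IH[OF gK L(1)] K(2) by simp
    with L(3) fC show ?thesis by auto
  qed
  with H show ?case by simp
qed

theorem fc_group_Suc_iff: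
  fixes G :: "'a monoid"
  assumes G: "group G"
  shows "fc_group (Suc n) G \<longleftrightarrow>
    (\<forall>x\<in>carrier G. fc_group n (G Mod centralizer G (normal_closure G x)))"
proof -
  have "(\<exists>H :: 'a monoid. H \<cong> G Mod centralizer G (normal_closure G x) \<and> fc_group n H) \<longleftrightarrow>
      fc_group n (G Mod centralizer G (normal_closure G x))" if x: "x \<in> carrier G" for x
  proof -
    let ?C = "centralizer G (normal_closure G x)"
    have C: "?C \<lhd> G"
      using G x by (intro group.centralizer_normal group.normal_closure_normal)
    have Q: "group (G Mod ?C)" using C by (rule normal.factorgroup_is_group)
    show ?thesis
      using fc_group_iso fc_group_imp_group Q group_copy_FactGroup[OF G C] by metis
  qed
  with G show ?thesis by simp
qed


section \<open>Ordinal positions\<close>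

text \<open>Ordinals are represented by positions in a well-order \<open>r\<close>: an element \<open>i\<close> of \<open>Field r\<close>
  stands for the order type of its set \<open>underS r i\<close> of strict predecessors.\<close>

definition zero_pos :: "'i rel \<Rightarrow> 'i \<Rightarrow> bool" where
  "zero_pos r i \<longleftrightarrow> underS r i = {}"

text \<open>\<open>i\<close> is the immediate successor of \<open>j\<close>\<close>

definition succ_pos :: "'i rel \<Rightarrow> 'i \<Rightarrow> 'i \<Rightarrow> bool" where
  "succ_pos r j i \<longleftrightarrow> j \<in> Field r \<and> underS r i = under r j"

definition lim_pos :: "'i rel \<Rightarrow> 'i \<Rightarrow> bool" where
  "lim_pos r i \<longleftrightarrow> \<not> zero_pos r i \<and> (\<nexists>j. succ_pos r j i)"


section \<open>The upper central series, hypercentre and Fitting subgroup\<close>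

definition center :: "('a, 'm) monoid_scheme \<Rightarrow> 'a set" where
  "center G = centralizer G (carrier G)"

text \<open>The full preimage in \<open>G\<close> of the centre of \<open>G/H\<close>\<close>

definition center_mod :: "('a, 'm) monoid_scheme \<Rightarrow> 'a set \<Rightarrow> 'a set" where
  "center_mod G H = {g \<in> carrier G. H #>\<^bsub>G\<^esub> g \<in> center (G Mod H)}"

definition upper_central :: "'i rel \<Rightarrow> ('a, 'm) monoid_scheme \<Rightarrow> 'i \<Rightarrow> 'a set" where
  "upper_central r G = wfrec (r - Id) (\<lambda>Z i.
     if zero_pos r i then {\<one>\<^bsub>G\<^esub>}
     else if \<exists>j. succ_pos r j i then center_mod G (Z (THE j. succ_pos r j i))
     else \<Union>(Z ` underS r i))"

text \<open>The terms of the upper central series with an index in \<open>\<omega> + \<omega>\<close>: the position \<open>(0, k)\<close>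
  in the lexicographic order on \<open>nat \<times> nat\<close> stands for \<open>k\<close> and \<open>(1, k)\<close> for \<open>\<omega> + k\<close>.\<close>

definition lex_nat2 :: "(nat \<times> nat) rel" where
  "lex_nat2 = {((a, b), (c, d)). a < c \<or> a = c \<and> b \<le> d}"

definition upper_central_fin :: "('a, 'm) monoid_scheme \<Rightarrow> nat \<Rightarrow> 'a set" where
  "upper_central_fin G k = upper_central lex_nat2 G (0, k)"

definition upper_central_omega_plus :: "('a, 'm) monoid_scheme \<Rightarrow> nat \<Rightarrow> 'a set" where
  "upper_central_omega_plus G k = upper_central lex_nat2 G (1, k)"

text \<open>The union of all terms of the upper central series. It suffices to consider well-orders
  on \<open>'a set\<close>, see \<open>upper_central_subset_hypercenter\<close>.\<close>

definition hypercenter :: "('a, 'm) monoid_scheme \<Rightarrow> 'a set" where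
  "hypercenter G = \<Union>{upper_central r G i |(r :: 'a set rel) i. Well_order r \<and> i \<in> Field r}"

definition nilpotent_group :: "('a, 'm) monoid_scheme \<Rightarrow> bool" where
  "nilpotent_group G \<longleftrightarrow> group G \<and> (\<exists>c. upper_central_fin G c = carrier G)"

definition fitting_subgroup :: "('a, 'm) monoid_scheme \<Rightarrow> 'a set" where
  "fitting_subgroup G =
    generate G (\<Union>{N. N \<lhd> G \<and> nilpotent_group (G\<lparr>carrier := N\<rparr>)})"

lemma lex_nat2_well_order: "Well_order lex_nat2" and Field_lex_nat2: "Field lex_nat2 = UNIV"
proof -
  show F: "Field lex_nat2 = UNIV"
    by (auto simp: Field_def lex_nat2_def)
  have "lex_nat2 - Id \<subseteq> less_than <*lex*> less_than"
    by (auto simp: lex_nat2_def)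
  then have "wf (lex_nat2 - Id)"
    by (rule wf_subset[rotated]) auto
  then show "Well_order lex_nat2"
    unfolding F
    by (auto simp: well_order_on_def linear_order_on_def partial_order_on_def preorder_on_def
        refl_on_def trans_def antisym_def total_on_def lex_nat2_def)
qed

lemma
  assumes r: "Well_order r"
  shows under_mono: "(i, j) \<in> r \<Longrightarrow> under r i \<subseteq> under r j"
    and underS_trans: "k \<in> underS r j \<Longrightarrow> j \<in> underS r i \<Longrightarrow> k \<in> underS r i"
    and underS_wf: "(\<And>i. (\<And>j. j \<in> underS r i \<Longrightarrow> P j) \<Longrightarrow> P i) \<Longrightarrow> P i"
    and underS_cases: "i \<in> Field r \<Longrightarrow> j \<in> Field r \<Longrightarrow> i \<in> underS r j \<or> i = j \<or> j \<in> underS r i"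
    and under_underS: "j \<in> Field r \<Longrightarrow> under r j = insert j (underS r j)"
    and underS_irrefl: "i \<in> underS r j \<Longrightarrow> j \<in> underS r i \<Longrightarrow> False"
    and underS_Field: "j \<in> underS r i \<Longrightarrow> j \<in> Field r" "j \<in> underS r i \<Longrightarrow> i \<in> Field r"
proof -
  have R: "refl_on (Field r) r" "trans r" "antisym r" "total_on (Field r) r" "wf (r - Id)"
    using r by (auto simp: order_on_defs well_order_on_def)
  show "(i, j) \<in> r \<Longrightarrow> under r i \<subseteq> under r j"
    using R(2) by (auto simp: under_def trans_def)
  show "k \<in> underS r j \<Longrightarrow> j \<in> underS r i \<Longrightarrow> k \<in> underS r i"
    using R(2,3) by (auto simp: underS_def trans_def antisym_def)
  show "(\<And>i. (\<And>j. j \<in> underS r i \<Longrightarrow> P j) \<Longrightarrow> P i) \<Longrightarrow> P i"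
    using R(5) by (rule wf_induct_rule) (auto simp: underS_def)
  show "i \<in> Field r \<Longrightarrow> j \<in> Field r \<Longrightarrow> i \<in> underS r j \<or> i = j \<or> j \<in> underS r i"
    using R(4) by (auto simp: underS_def total_on_def)
  show "j \<in> Field r \<Longrightarrow> under r j = insert j (underS r j)"
    using R(1) by (auto simp: under_def underS_def refl_on_def)
  show "i \<in> underS r j \<Longrightarrow> j \<in> underS r i \<Longrightarrow> False"
    using R(3) by (auto simp: underS_def antisym_def)
  show "j \<in> underS r i \<Longrightarrow> j \<in> Field r" "j \<in> underS r i \<Longrightarrow> i \<in> Field r"
    by (auto simp: underS_def Field_def)
qed

lemma succ_pos_unique:
  assumes r: "Well_order r" and "succ_pos r j i" "succ_pos r k i"
  shows "j = k"
proof -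
  have "j \<in> Field r" "k \<in> Field r" "under r j = under r k"
    using assms by (auto simp: succ_pos_def)
  then show ?thesis
    using under_underS[OF r] underS_irrefl[OF r] by (metis insert_iff)
qed

lemma succ_pos_underS: "Well_order r \<Longrightarrow> succ_pos r j i \<Longrightarrow> j \<in> underS r i"
  using under_underS by (fastforce simp: succ_pos_def)

lemma pos_cases:
  obtains "zero_pos r i" | j where "succ_pos r j i" | "lim_pos r i"
  by (auto simp: lim_pos_def)

lemma lim_pos_between:
  assumes r: "Well_order r" and i: "lim_pos r i" and j: "j \<in> underS r i"
  obtains k where "succ_pos r j k" "k \<in> underS r i"
proof -
  have jF: "j \<in> Field r" using j underS_Field[OF r] by blast
  have "underS r i \<noteq> under r j" using i jF by (auto simp: lim_pos_def succ_pos_def)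
  moreover have "under r j \<subseteq> underS r i"
    using under_underS[OF r jF] j underS_trans[OF r] by auto
  ultimately obtain l where "l \<in> underS r i" "l \<notin> under r j" by blast
  then have l: "l \<in> underS r i \<and> j \<in> underS r l"
    using underS_cases[OF r jF] under_underS[OF r jF] underS_Field[OF r] by blast
  have "\<exists>k. (k \<in> underS r i \<and> j \<in> underS r k) \<and>
      (\<forall>m\<in>underS r k. \<not> (m \<in> underS r i \<and> j \<in> underS r m))"
    using l
  proof (induction l rule: underS_wf[OF r])
    case (1 l)
    then show ?case by blast
  qed
  then obtain k where k: "k \<in> underS r i" "j \<in> underS r k"
    and least: "\<And>m. m \<in> underS r k \<Longrightarrow> m \<in> underS r i \<Longrightarrow> j \<notin> underS r m" by blast
  have "underS r k \<subseteq> under r j"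
    using least k underS_trans[OF r] underS_cases[OF r jF] under_underS[OF r jF] underS_Field[OF r]
    by blast
  moreover have "under r j \<subseteq> underS r k"
    using k underS_trans[OF r] under_underS[OF r jF] by auto
  ultimately have "succ_pos r j k" using jF by (auto simp: succ_pos_def)
  with k show ?thesis using that by blast
qed

lemma
  assumes r: "Well_order r"
  shows upper_central_zero: "zero_pos r i \<Longrightarrow> upper_central r G i = {\<one>\<^bsub>G\<^esub>}"
    and upper_central_succ:
      "succ_pos r j i \<Longrightarrow> upper_central r G i = center_mod G (upper_central r G j)"
    and upper_central_lim:
      "lim_pos r i \<Longrightarrow> upper_central r G i = (\<Union>j\<in>underS r i. upper_central r G j)"
proof -
  let ?F = "\<lambda>Z i. if zero_pos r i then {\<one>\<^bsub>G\<^esub>}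
     else if \<exists>j. succ_pos r j i then center_mod G (Z (THE j. succ_pos r j i))
     else \<Union>(Z ` underS r i)"
  have wf: "wf (r - Id)" using r by (simp add: well_order_on_def)
  have rec: "upper_central r G i = ?F (cut (upper_central r G) (r - Id) i) i"
    unfolding upper_central_def by (subst wfrec[OF wf]) simp
  have cut: "cut (upper_central r G) (r - Id) i j = upper_central r G j" if "j \<in> underS r i" for j
    using that by (auto simp: cut_def underS_def)
  show "zero_pos r i \<Longrightarrow> upper_central r G i = {\<one>\<^bsub>G\<^esub>}"
    by (subst rec) simp
  show "upper_central r G i = center_mod G (upper_central r G j)" if j: "succ_pos r j i"
  proof -
    have "(THE j. succ_pos r j i) = j" using j succ_pos_unique[OF r] by blast
    moreover have "\<not> zero_pos r i" using succ_pos_underS[OF r j] by (auto simp: zero_pos_def)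
    ultimately show ?thesis using j cut[OF succ_pos_underS[OF r j]] by (subst rec) auto
  qed
  show "lim_pos r i \<Longrightarrow> upper_central r G i = (\<Union>j\<in>underS r i. upper_central r G j)"
    using cut by (subst rec) (auto simp: lim_pos_def)
qed

lemma lex_nat2_pos:
  "zero_pos lex_nat2 (0, 0)" "succ_pos lex_nat2 (a, b) (a, Suc b)" "lim_pos lex_nat2 (1, 0)"
proof -
  show "zero_pos lex_nat2 (0, 0)" by (auto simp: zero_pos_def underS_def lex_nat2_def)
  show "succ_pos lex_nat2 (a, b) (a, Suc b)"
    unfolding succ_pos_def Field_lex_nat2 by (auto simp: underS_def under_def lex_nat2_def)
  have U: "underS lex_nat2 (1, 0) = {0} \<times> UNIV" by (auto simp: underS_def lex_nat2_def)
  have "under lex_nat2 j \<noteq> {0} \<times> UNIV" for j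
  proof
    assume a: "under lex_nat2 j = {0} \<times> UNIV"
    have "j \<in> under lex_nat2 j" by (cases j) (auto simp: under_def lex_nat2_def)
    then obtain b where "j = (0, b)" using a by auto
    moreover have "(0, Suc b) \<in> under lex_nat2 j" using a by auto
    ultimately show False by (auto simp: under_def lex_nat2_def)
  qed
  then have "{0} \<times> UNIV \<noteq> under lex_nat2 j" for j by metis
  moreover have "({0} :: nat set) \<times> (UNIV :: nat set) \<noteq> {}" by blast
  ultimately show "lim_pos lex_nat2 (1, 0)"
    unfolding lim_pos_def zero_pos_def succ_pos_def U by blast
qed

theorem
  shows upper_central_fin_0: "upper_central_fin G 0 = {\<one>\<^bsub>G\<^esub>}"
    and upper_central_fin_Suc: "upper_central_fin G (Suc k) = center_mod G (upper_central_fin G k)"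
    and upper_central_omega: "upper_central_omega_plus G 0 = (\<Union>k. upper_central_fin G k)"
    and upper_central_omega_plus_Suc:
      "upper_central_omega_plus G (Suc k) = center_mod G (upper_central_omega_plus G k)"
proof -
  note r = lex_nat2_well_order
  show "upper_central_fin G 0 = {\<one>\<^bsub>G\<^esub>}"
    unfolding upper_central_fin_def by (rule upper_central_zero[OF r lex_nat2_pos(1)])
  show "upper_central_fin G (Suc k) = center_mod G (upper_central_fin G k)"
    unfolding upper_central_fin_def by (rule upper_central_succ[OF r lex_nat2_pos(2)])
  show "upper_central_omega_plus G (Suc k) = center_mod G (upper_central_omega_plus G k)"
    unfolding upper_central_omega_plus_def by (rule upper_central_succ[OF r lex_nat2_pos(2)])
  have "underS lex_nat2 (1, 0) = range (Pair 0)" by (auto simp: underS_def lex_nat2_def)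
  then show "upper_central_omega_plus G 0 = (\<Union>k. upper_central_fin G k)"
    unfolding upper_central_fin_def upper_central_omega_plus_def
    by (simp add: upper_central_lim[OF r lex_nat2_pos(3)] del: One_nat_def)
qed

context group
begin

lemma center_mod_eq:
  assumes "N \<lhd> G"
  shows "center_mod G N = {g \<in> carrier G. \<forall>x\<in>carrier G. N #> (g \<otimes> x) = N #> (x \<otimes> g)}"
  using normal.rcos_sum[OF assms]
  by (auto simp: center_mod_def center_def centralizer_def carrier_FactGroup)

lemma center_mod_mono:
  assumes N: "N \<lhd> G" and M: "M \<lhd> G" and "N \<subseteq> M"
  shows "center_mod G N \<subseteq> center_mod G M"
proof -
  have sub: "subgroup N G" "subgroup M G" using N M by (simp_all add: normal_imp_subgroup)
  have "M #> a = M #> b" if "N #> a = N #> b" "a \<in> carrier G" "b \<in> carrier G" for a b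
  proof -
    have "a \<in> N #> b" using that sub(1) rcos_self by metis
    then have "a \<in> M #> b" using \<open>N \<subseteq> M\<close> by (auto simp: r_coset_def)
    then show ?thesis using repr_independence that sub(2) by metis
  qed
  then show ?thesis by (auto simp: center_mod_eq[OF N] center_mod_eq[OF M])
qed

lemma center_mod_normal:
  assumes N: "N \<lhd> G"
  shows "center_mod G N \<lhd> G" and "N \<subseteq> center_mod G N"
proof -
  interpret N: normal N G by fact
  interpret Q: group "G Mod N" by (rule N.factorgroup_is_group)
  interpret h: group_hom G "G Mod N" "\<lambda>x. N #> x"
    by unfold_locales (rule N.r_coset_hom_Mod)
  have "carrier (G Mod N) \<lhd> G Mod N"
    unfolding Q.normal_inv_iff using Q.subgroup_self by (auto simp del: mult_FactGroup)
  then have "center (G Mod N) \<lhd> G Mod N"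
    unfolding center_def by (rule Q.centralizer_normal)
  then interpret Z: normal "center (G Mod N)" "G Mod N" .
  have "subgroup (center_mod G N) G"
    using Z.m_closed Z.one_closed Z.m_inv_closed
    by unfold_locales (auto simp: center_mod_def h.hom_mult simp del: mult_FactGroup one_FactGroup)
  moreover have "y \<otimes> z \<otimes> inv y \<in> center_mod G N" if "y \<in> carrier G" "z \<in> center_mod G N" for y z
    using that Z.inv_op_closed2 by (auto simp: center_mod_def)
  ultimately show "center_mod G N \<lhd> G" by (simp add: normal_inv_iff)
  have "N #> g = \<one>\<^bsub>G Mod N\<^esub>" if "g \<in> N" for g
    using that N.subset coset_join2 N.is_subgroup by auto
  then show "N \<subseteq> center_mod G N"
    using N.subset Z.one_closed by (auto simp: center_mod_def)
qed

lemma upper_central_normal_mono: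
  fixes r :: "'i rel"
  assumes r: "Well_order r"
  shows "upper_central r G i \<lhd> G \<and> (\<forall>j\<in>underS r i. center_mod G (upper_central r G j) \<subseteq> upper_central r G i)"
proof (induction i rule: underS_wf[OF r])
  case (1 i)
  let ?Z = "upper_central r G"
  consider "zero_pos r i" | j where "succ_pos r j i" | "lim_pos r i" by (rule pos_cases)
  then show ?case
  proof cases
    case 1
    then show ?thesis by (simp add: upper_central_zero[OF r] zero_pos_def one_is_normal)
  next
    case (2 j)
    have j: "j \<in> underS r i" using r 2 by (rule succ_pos_underS)
    have "center_mod G (?Z k) \<subseteq> center_mod G (?Z j)" if "k \<in> underS r i" for k
    proof (cases "k = j")
      case False
      then have "k \<in> underS r j"
        using that 2 under_underS[OF r] by (auto simp: succ_pos_def)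
      then show ?thesis using 1[OF j] center_mod_normal(2) by blast
    qed simp
    then show ?thesis
      using 1[OF j] center_mod_normal(1) by (simp add: upper_central_succ[OF r 2])
  next
    case 3
    have Z: "?Z i = (\<Union>j\<in>underS r i. ?Z j)" using 3 by (rule upper_central_lim[OF r])
    have chain: "?Z j \<subseteq> ?Z k" if "j \<in> underS r k" "k \<in> underS r i" for j k
      using 1[OF that(2)] 1[OF underS_trans[OF r that]] that center_mod_normal(2) by blast
    have nonempty: "underS r i \<noteq> {}" using 3 by (simp add: lim_pos_def zero_pos_def)
    have sub: "subgroup (?Z j) G" if "j \<in> underS r i" for j
      using 1[OF that] normal_imp_subgroup by blast
    have "subgroup (?Z i) G"
    proof (rule subgroupI)
      show "?Z i \<subseteq> carrier G" using sub subgroup.subset by (auto simp: Z)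
      show "?Z i \<noteq> {}" using nonempty sub subgroup.one_closed by (fastforce simp: Z)
      show "inv a \<in> ?Z i" if "a \<in> ?Z i" for a
        using that sub subgroup.m_inv_closed by (fastforce simp: Z)
      show "a \<otimes> b \<in> ?Z i" if ab: "a \<in> ?Z i" "b \<in> ?Z i" for a b
      proof -
        obtain j k where jk: "j \<in> underS r i" "a \<in> ?Z j" "k \<in> underS r i" "b \<in> ?Z k"
          using ab unfolding Z by blast
        then have "\<exists>l\<in>underS r i. a \<in> ?Z l \<and> b \<in> ?Z l"
          using underS_cases[OF r, of j k] underS_Field[OF r] chain by blast
        then show ?thesis using sub subgroup.m_closed by (fastforce simp: Z)
      qed
    qed
    moreover have "y \<otimes> h \<otimes> inv y \<in> ?Z i" if "y \<in> carrier G" "h \<in> ?Z i" for y h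
      using that 1 normal.inv_op_closed2 by (fastforce simp: Z)
    moreover have "center_mod G (?Z j) \<subseteq> ?Z i" if j: "j \<in> underS r i" for j
    proof -
      obtain k where k: "succ_pos r j k" "k \<in> underS r i"
        using lim_pos_between[OF r 3 j] .
      then show ?thesis unfolding Z upper_central_succ[OF r k(1), symmetric] by blast
    qed
    ultimately show ?thesis by (simp add: normal_inv_iff)
  qed
qed

theorem upper_central_subset_hypercenter:
  fixes r :: "'i rel"
  assumes r: "Well_order r"
  shows "upper_central r G i \<subseteq> hypercenter G"
proof -
  obtain w :: "'a set rel" where w: "Well_order w" "Field w = UNIV"
    using well_ordering by (metis well_order_on_Well_order)
  let ?W = "upper_central w G"
  note W = upper_central_normal_mono[OF w(1)]
  have "\<exists>l. center_mod G (?W l) \<subseteq> ?W l"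
  proof (rule ccontr)
    assume "\<nexists>l. center_mod G (?W l) \<subseteq> ?W l"
    then have "\<forall>l. \<exists>x. x \<in> center_mod G (?W l) - ?W l" by blast
    then obtain f where f: "\<And>l. f l \<in> center_mod G (?W l) - ?W l" by metis
    have ne: "f j \<noteq> f l" if "j \<in> underS w l" for j l
    proof -
      have "f j \<in> ?W l" using that f[of j] W[of l] by auto
      then show ?thesis using f[of l] by auto
    qed
    have "inj f"
    proof (rule injI)
      fix j l assume "f j = f l"
      then show "j = l"
        using ne[of j l] ne[of l j] underS_cases[OF w(1), of j l] w(2) by auto
    qed
    then have "range (inv_into UNIV f) = Pow UNIV"
      using inj_imp_surj_inv by auto
    then show False using Cantors_theorem by blast
  qed
  then obtain l where l: "center_mod G (?W l) \<subseteq> ?W l" by blast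
  have "upper_central r G i \<subseteq> ?W l"
  proof (induction i rule: underS_wf[OF r])
    case (1 i)
    consider "zero_pos r i" | j where "succ_pos r j i" | "lim_pos r i" by (rule pos_cases)
    then show ?case
    proof cases
      case 1
      have "subgroup (?W l) G" using W normal_imp_subgroup by blast
      then show ?thesis by (simp add: upper_central_zero[OF r 1] subgroup.one_closed)
    next
      case (2 j)
      have "center_mod G (upper_central r G j) \<subseteq> center_mod G (?W l)"
        using 1[OF succ_pos_underS[OF r 2]] upper_central_normal_mono[OF r] W
        by (intro center_mod_mono) auto
      then show ?thesis using l by (simp add: upper_central_succ[OF r 2])
    next
      case 3
      then show ?thesis using 1 by (auto simp: upper_central_lim[OF r])
    qed
  qed
  moreover have "?W l \<subseteq> hypercenter G"
    unfolding hypercenter_def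
    by (rule Union_upper, rule CollectI, intro exI[of _ w] exI[of _ l]) (use w in auto)
  ultimately show ?thesis by blast
qed

end


section \<open>Ascendant and subnormal subgroups\<close>

definition ascending_series ::
  "'i rel \<Rightarrow> ('i \<Rightarrow> 'a set) \<Rightarrow> 'a set \<Rightarrow> ('a, 'm) monoid_scheme \<Rightarrow> bool" where
  "ascending_series r S H K \<longleftrightarrow> Well_order r \<and>
     (\<forall>i\<in>Field r. subgroup (S i) K) \<and>
     (\<exists>z\<in>Field r. zero_pos r z \<and> S z = H) \<and>
     (\<exists>t\<in>Field r. (\<forall>i\<in>Field r. (i, t) \<in> r) \<and> S t = carrier K) \<and>
     (\<forall>i\<in>Field r. \<forall>j\<in>Field r. succ_pos r i j \<longrightarrow> S i \<lhd> K\<lparr>carrier := S j\<rparr>) \<and>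
     (\<forall>i\<in>Field r. lim_pos r i \<longrightarrow> S i = (\<Union>j\<in>underS r i. S j))"

text \<open>Well-orders on \<open>'a set\<close> suffice for indexing ascending series, see
  \<open>ascending_series_imp_ascendant\<close>.\<close>

definition ascendant :: "'a set \<Rightarrow> ('a, 'm) monoid_scheme \<Rightarrow> bool" where
  "ascendant H K \<longleftrightarrow> (\<exists>(r :: 'a set rel) S. ascending_series r S H K)"

definition subnormal_defect_le :: "nat \<Rightarrow> 'a set \<Rightarrow> ('a, 'm) monoid_scheme \<Rightarrow> bool" where
  "subnormal_defect_le k H K \<longleftrightarrow> (\<exists>d\<le>k. \<exists>S :: nat \<Rightarrow> 'a set.
     (\<forall>i\<le>d. subgroup (S i) K) \<and> S 0 = H \<and> S d = carrier K \<and>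
     (\<forall>i<d. S i \<lhd> K\<lparr>carrier := S (Suc i)\<rparr>))"

text \<open>The subgroup \<open>\<langle>x, a\<^sup>G\<rangle>\<close>, as a group\<close>

definition join_normal_closure :: "('a, 'm) monoid_scheme \<Rightarrow> 'a \<Rightarrow> 'a \<Rightarrow> ('a, 'm) monoid_scheme" where
  "join_normal_closure G x a = G\<lparr>carrier := generate G ({x} \<union> normal_closure G a)\<rparr>"

definition rho :: "('a, 'm) monoid_scheme \<Rightarrow> 'a set" where
  "rho G = {a \<in> carrier G. \<forall>x\<in>carrier G.
     ascendant (generate G {x}) (join_normal_closure G x a)}"

definition bounded_rho :: "('a, 'm) monoid_scheme \<Rightarrow> 'a set" where
  "bounded_rho G = {a \<in> carrier G. \<exists>k. \<forall>x\<in>carrier G.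
     subnormal_defect_le k (generate G {x}) (join_normal_closure G x a)}"

lemma ascending_series_mono:
  assumes S: "ascending_series r S H K" and i: "i \<in> underS r j"
  shows "S i \<subseteq> S j"
proof -
  have r: "Well_order r" using S by (simp add: ascending_series_def)
  have "\<forall>i\<in>underS r j. S i \<subseteq> S j"
  proof (induction j rule: underS_wf[OF r])
    case (1 j)
    consider "zero_pos r j" | k where "succ_pos r k j" | "lim_pos r j" by (rule pos_cases)
    then show ?case
    proof cases
      case 1
      then show ?thesis by (simp add: zero_pos_def)
    next
      case (2 k)
      have k: "k \<in> underS r j" using r 2 by (rule succ_pos_underS)
      then have "S k \<lhd> K\<lparr>carrier := S j\<rparr>"
        using S 2 underS_Field[OF r k] by (auto simp: ascending_series_def)
      then have "S k \<subseteq> S j"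
        using normal_imp_subgroup subgroup.subset by force
      moreover have "underS r j = insert k (underS r k)"
        using 2 under_underS[OF r] by (auto simp: succ_pos_def)
      ultimately show ?thesis using 1[OF k] by auto
    next
      case 3
      then have "S j = (\<Union>i\<in>underS r j. S i)" if "j \<in> Field r"
        using S that by (auto simp: ascending_series_def)
      then show ?thesis using underS_Field[OF r] by blast
    qed
  qed
  with i show ?thesis by blast
qed

theorem ascending_series_imp_ascendant:
  fixes r :: "'i rel"
  assumes S: "ascending_series r S H K"
  shows "ascendant H K"
proof -
  have r: "Well_order r" and sub: "\<And>i. i \<in> Field r \<Longrightarrow> subgroup (S i) K"
    and normal: "\<And>i j. j \<in> Field r \<Longrightarrow> succ_pos r i j \<Longrightarrow> S i \<lhd> K\<lparr>carrier := S j\<rparr>"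
    and lim: "\<And>i. i \<in> Field r \<Longrightarrow> lim_pos r i \<Longrightarrow> S i = (\<Union>j\<in>underS r i. S j)"
    using S by (auto simp: ascending_series_def succ_pos_def)
  obtain z where z: "z \<in> Field r" "zero_pos r z" "S z = H"
    using S by (auto simp: ascending_series_def)
  obtain t where t: "t \<in> Field r" "S t = carrier K"
    using S by (auto simp: ascending_series_def)
  note mono = ascending_series_mono[OF S]
  let ?T = "S ` Field r"
  define q where "q = {(A, B). A \<in> ?T \<and> B \<in> ?T \<and> A \<subseteq> B}"
  have F: "Field q = ?T" by (auto simp: Field_def q_def)
  have uS: "underS q B = {A \<in> ?T. A \<subset> B}" if "B \<in> ?T" for B
    using that by (auto simp: underS_def q_def)
  have u: "under q B = {A \<in> ?T. A \<subseteq> B}" if "B \<in> ?T" for B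
    using that by (auto simp: under_def q_def)
  have least: "\<exists>i\<in>Field r. S i = A \<and> (\<forall>j\<in>underS r i. S j \<noteq> A)" if A: "A \<in> ?T" for A
  proof -
    obtain i where "i \<in> Field r \<and> S i = A" using A by blast
    then show ?thesis
    proof (induction i rule: underS_wf[OF r])
      case (1 i)
      then show ?case using underS_Field(1)[OF r] by blast
    qed
  qed
  then obtain p where p: "\<And>A. A \<in> ?T \<Longrightarrow> p A \<in> Field r" "\<And>A. A \<in> ?T \<Longrightarrow> S (p A) = A"
    "\<And>A j. A \<in> ?T \<Longrightarrow> j \<in> underS r (p A) \<Longrightarrow> S j \<noteq> A" by metis
  have p_less: "i \<in> underS r (p B)" if "B \<in> ?T" "i \<in> Field r" "S i \<subset> B" for i B
    using underS_cases[OF r that(2) p(1)[OF that(1)]] mono p(2)[OF that(1)] that(3) by blast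
  have q: "Well_order q"
  proof -
    have "q - Id \<subseteq> inv_image (r - Id) p"
    proof
      fix X assume "X \<in> q - Id"
      then obtain A B where X: "X = (A, B)" and A: "A \<in> ?T" and B: "B \<in> ?T" and AB: "A \<subset> B"
        by (auto simp: q_def)
      have "p A \<in> underS r (p B)" using p_less[OF B p(1)[OF A]] p(2)[OF A] AB by simp
      then show "X \<in> inv_image (r - Id) p" by (simp add: X underS_def)
    qed
    moreover have "wf (inv_image (r - Id) p)"
      using r by (simp add: well_order_on_def)
    ultimately have "wf (q - Id)" by (rule wf_subset[rotated])
    moreover have "total_on ?T q"
      using underS_cases[OF r] mono by (fastforce simp: total_on_def q_def)
    ultimately show ?thesis
      unfolding F
      by (auto simp: well_order_on_def linear_order_on_def partial_order_on_def preorder_on_def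
          refl_on_def trans_def antisym_def q_def)
  qed
  have below: "z = i \<or> z \<in> underS r i" if "i \<in> Field r" for i
    using underS_cases[OF r z(1) that] z(2) by (auto simp: zero_pos_def)
  have H: "H \<in> ?T" "\<And>A. A \<in> ?T \<Longrightarrow> H \<subseteq> A"
    using z below mono by blast+
  have "zero_pos q H"
    using H by (auto simp: zero_pos_def uS)
  moreover have "(A, carrier K) \<in> q" if "A \<in> ?T" for A
    using that t sub subgroup.subset by (fastforce simp: q_def)
  moreover have "A \<lhd> K\<lparr>carrier := B\<rparr>" if A: "A \<in> ?T" and B: "B \<in> ?T" and AB: "succ_pos q A B" for A B
  proof -
    have AB': "\<And>C. C \<in> ?T \<Longrightarrow> C \<subset> B \<longleftrightarrow> C \<subseteq> A"
      using AB A B by (auto simp: succ_pos_def u uS)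
    then have sAB: "A \<subset> B" using A by blast
    consider "zero_pos r (p B)" | k where "succ_pos r k (p B)" | "lim_pos r (p B)" by (rule pos_cases)
    then show ?thesis
    proof cases
      case 1
      then have "p A \<notin> underS r (p B)" by (simp add: zero_pos_def)
      then show ?thesis using p_less[OF B p(1)[OF A]] p(2)[OF A] sAB by blast
    next
      case (2 k)
      have k: "k \<in> underS r (p B)" using r 2 by (rule succ_pos_underS)
      have kF: "k \<in> Field r" using underS_Field[OF r k] by blast
      have "S k \<subset> B" using mono[OF k] p(2,3)[OF B] k by blast
      then have "S k \<subseteq> A" using AB' kF by blast
      moreover have "p A = k \<or> p A \<in> underS r k"
        using p_less[OF B p(1)[OF A]] p(2)[OF A] sAB 2 under_underS[OF r kF]
        by (auto simp: succ_pos_def)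
      then have "A \<subseteq> S k" using mono p(2)[OF A] by blast
      ultimately have "S k = A" by blast
      then show ?thesis using normal[OF p(1)[OF B] 2] p(2)[OF B] by simp
    next
      case 3
      have "S j \<subseteq> A" if j: "j \<in> underS r (p B)" for j
      proof -
        have "S j \<subset> B" using mono[OF j] p(2,3)[OF B] j by blast
        then show ?thesis using AB' underS_Field(1)[OF r j] by blast
      qed
      then have "B \<subseteq> A" using lim[OF p(1)[OF B] 3] p(2)[OF B] by blast
      then show ?thesis using sAB by blast
    qed
  qed
  moreover have "B = (\<Union>A\<in>underS q B. A)" if B: "B \<in> ?T" and BL: "lim_pos q B" for B
  proof -
    have lower: "S j \<in> underS q B" if j: "j \<in> underS r (p B)" for j
      using mono[OF j] p(2,3)[OF B] j underS_Field(1)[OF r j] by (auto simp: uS[OF B])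
    consider "zero_pos r (p B)" | k where "succ_pos r k (p B)" | "lim_pos r (p B)" by (rule pos_cases)
    then show ?thesis
    proof cases
      case 1
      then have "p B = z" using below[OF p(1)[OF B]] by (auto simp: zero_pos_def)
      then have "B = H" using p(2)[OF B] z by simp
      then show ?thesis using BL \<open>zero_pos q H\<close> by (simp add: lim_pos_def)
    next
      case (2 k)
      have k: "k \<in> underS r (p B)" using r 2 by (rule succ_pos_underS)
      have kF: "k \<in> Field r" using underS_Field[OF r k] by blast
      have "A \<subseteq> S k" if A: "A \<in> underS q B" for A
      proof -
        have A': "A \<in> ?T" "A \<subset> B" using A by (auto simp: uS[OF B])
        have "p A = k \<or> p A \<in> underS r k"
          using p_less[OF B p(1)[OF A'(1)]] p(2)[OF A'(1)] A'(2) 2 under_underS[OF r kF]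
          by (auto simp: succ_pos_def)
        then show ?thesis using mono p(2)[OF A'(1)] by blast
      qed
      then have "underS q B = under q (S k)"
        using lower[OF k] kF by (auto simp: u uS[OF B])
      then have "succ_pos q (S k) B" using kF F by (simp add: succ_pos_def)
      then show ?thesis using BL by (auto simp: lim_pos_def)
    next
      case 3
      have "B \<subseteq> (\<Union>A\<in>underS q B. A)"
        using lim[OF p(1)[OF B] 3] p(2)[OF B] lower by blast
      then show ?thesis by (auto simp: uS[OF B])
    qed
  qed
  moreover have "carrier K \<in> ?T" using t by blast
  ultimately have "ascending_series q (\<lambda>A. A) H K"
    using q H(1) sub unfolding ascending_series_def F
    by (intro conjI ballI impI bexI[of _ H] bexI[of _ "carrier K"]) auto
  then show ?thesis unfolding ascendant_def by blast
qed

end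

theory Submission
  imports Defs "HOL-Algebra.Sylow" "HOL-Algebra.Group_Action" "HOL-Algebra.Multiplicative_Group"
    "HOL-Algebra.SndIsomorphismGrp"
begin

text \<open>Everything is reduced to one tool, the series \<open>centralizer_series G A U\<close>: starting from a normal
subgroup \<open>U\<close>, its next term consists of the elements whose commutators with all elements of \<open>A\<close> lie
in the current term. For \<open>A = G\<close> and \<open>U = 1\<close> it is the upper central series, and a normal subgroup
\<open>N\<close> is nilpotent iff the series for \<open>A = N\<close> and \<open>U = 1\<close> reaches \<open>G\<close>. Keeping \<open>U\<close> as a parameter
replaces arguments in \<open>G/U\<close> by arguments in \<open>G\<close>.

The group-theoretic core is a quantitative form of P. Hall's nilpotency criterion
(\<open>hall_nilpotency\<close>), in the following guise (\<open>engel_action_hypercentral\<close>): if \<open>N\<close> is nilpotent of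
class \<open>c\<close>, is normalised by \<open>x\<close> and has generators \<open>a\<close> with \<open>[a,\<^sub>m x] = 1\<close>, then \<open>N\<close> lies in the term
of index \<open>(2\<^sup>c - 1) m\<close> of the upper central series of \<open>\<langle>x, N\<rangle>\<close>. It is used three times.

\<^item> In a finite group a conjugacy class \<open>C\<close> of left Engel elements generates a nilpotent subgroup
  (\<open>baer_finite\<close>, a theorem of Baer). Two distinct maximal subsets of \<open>C\<close> that generate nilpotent subgroups,
  chosen with maximal intersection, lead to a contradiction, because an element of \<open>C\<close> that
  normalises such a maximal subset belongs to it by the criterion.

\<^item> In a finite group every right Engel element is hypercentral
  (\<open>finite_right_engel_hypercentral\<close>). The inverse of a right Engel element is left Engel, so its
  normal closure is nilpotent, and by the criterion all elements of that closure are right Engel.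
  On a normal elementary abelian \<open>p\<close>-subgroup of it every element of \<open>G\<close> acts with
  \<open>p\<close>-power order, so that \<open>G\<close> fixes a nontrivial element.

\<^item> If \<open>a\<close> is a right Engel element with a bound \<open>m\<close>, then \<open>a\<^sup>G\<close> lies in a term of the upper central
  series of \<open>\<langle>x, a\<^sup>G\<rangle>\<close> whose index does not depend on \<open>x\<close>, and this index bounds the defect of \<open>\<langle>x\<rangle>\<close>.
  This is the harder inclusion of (c).

For an \<open>FC\<^sup>n\<close>-group, (a) follows by induction on \<open>n\<close>: if \<open>a\<close> is left Engel and \<open>C\<close> is the
centralizer of \<open>a\<^sup>G\<close>, then \<open>a\<^sup>G C/C\<close> is nilpotent because \<open>G/C\<close> is an \<open>FC\<^sup>n\<^sup>-\<^sup>1\<close>-group, and \<open>a\<^sup>G \<inter> C\<close>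
is central in \<open>a\<^sup>G\<close>; the finite case is the theorem of Baer.

For (b), a finitely generated \<open>FC\<^sup>n\<close>-group is finite modulo the \<open>n\<close>-th term of its upper central
series. Hence a right Engel element \<open>a\<close> lies in a finite term of the upper central series of each
finitely generated subgroup that contains it, and so does \<open>[a, g]\<close>. If some finite-index subgroup centralizes
\<open>a\<^sup>G\<close>, then one such subgroup detects that \<open>a\<close> lies in a finite term for \<open>G\<close> itself.
In general, the quotient of \<open>G\<close> by the centralizer of the normal closure of a commutator of weight
\<open>i\<close> is an \<open>FC\<^sup>n\<^sup>-\<^sup>i\<close>-group (\<open>fc_weight_commutator\<close>, by the Hall-Witt identity). So commutators \<open>[a, g\<^sub>1, \<dots>, g\<^sub>n\<^sub>-\<^sub>1]\<close> fall under the
case just described, and \<open>a\<close> lies in the term of index \<open>\<omega> + (n - 1)\<close>. The remaining inclusions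
hold in all groups.\<close>


section \<open>Commutators and centralizers modulo a normal subgroup\<close>

text \<open>For normal \<open>U\<close> this is the full preimage in \<open>G\<close> of the centralizer of the image of \<open>A\<close> in \<open>G/U\<close>.\<close>

definition centralizer_mod :: "('a, 'm) monoid_scheme \<Rightarrow> 'a set \<Rightarrow> 'a set \<Rightarrow> 'a set" where
  "centralizer_mod G A U = {g \<in> carrier G. \<forall>y\<in>A. group_commutator G g y \<in> U}"

text \<open>For \<open>A = carrier G\<close> this is the upper central series above \<open>U\<close>. In general the set \<open>A\<close> acts trivially
on the successive factors, so an element of the term of index \<open>k\<close> over \<open>U\<close> is moved into \<open>U\<close> by
any \<open>k\<close> successive commutations with elements of \<open>A\<close>.\<close>

primrec centralizer_series ::
  "('a, 'm) monoid_scheme \<Rightarrow> 'a set \<Rightarrow> 'a set \<Rightarrow> nat \<Rightarrow> 'a set" where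
  "centralizer_series G A U 0 = U"
| "centralizer_series G A U (Suc k) = centralizer_mod G A (centralizer_series G A U k)"

definition conj_class :: "('a, 'm) monoid_scheme \<Rightarrow> 'a \<Rightarrow> 'a set" where
  "conj_class G a = conj_by G a ` carrier G"

definition conj_closed :: "('a, 'm) monoid_scheme \<Rightarrow> 'a set \<Rightarrow> bool" where
  "conj_closed G A \<longleftrightarrow> A \<subseteq> carrier G \<and> (\<forall>a\<in>A. \<forall>h\<in>carrier G. conj_by G a h \<in> A)"

lemma centralizer_mod_mono:
  "A \<subseteq> B \<Longrightarrow> U \<subseteq> V \<Longrightarrow> centralizer_mod G B U \<subseteq> centralizer_mod G A V"
  by (auto simp: centralizer_mod_def)

lemma centralizer_series_mono:
  "A \<subseteq> B \<Longrightarrow> U \<subseteq> V \<Longrightarrow> centralizer_series G B U k \<subseteq> centralizer_series G A V k"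
  by (induction k) (auto dest: centralizer_mod_mono[of A B])

lemma centralizer_series_add:
  "centralizer_series G A (centralizer_series G A U j) k = centralizer_series G A U (j + k)"
  by (induction k) auto

lemma centralizer_mod_carrier: "centralizer_mod G A U \<subseteq> carrier G"
  by (auto simp: centralizer_mod_def)

context group
begin

lemma inv_mult_cancel [simp]:
  assumes "x \<in> carrier G" "y \<in> carrier G"
  shows "inv x \<otimes> (x \<otimes> y) = y" and "x \<otimes> (inv x \<otimes> y) = y"
  using assms by (simp_all add: m_assoc[symmetric])

lemmas word_simps = group_commutator_def conj_by_def m_assoc inv_mult_group

lemma conj_by_closed [simp, intro]:
  "x \<in> carrier G \<Longrightarrow> y \<in> carrier G \<Longrightarrow> conj_by G x y \<in> carrier G"
  by (simp add: conj_by_def)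

lemma group_commutator_closed [simp, intro]:
  "x \<in> carrier G \<Longrightarrow> y \<in> carrier G \<Longrightarrow> group_commutator G x y \<in> carrier G"
  by (simp add: group_commutator_def)

lemma engel_commutator_closed [simp, intro]:
  "x \<in> carrier G \<Longrightarrow> y \<in> carrier G \<Longrightarrow> engel_commutator G x m y \<in> carrier G"
  by (induction m) auto

lemma conj_by_one [simp]:
  "x \<in> carrier G \<Longrightarrow> conj_by G x \<one> = x" "x \<in> carrier G \<Longrightarrow> conj_by G \<one> x = \<one>"
  by (simp_all add: conj_by_def)

lemma conj_by_mult:
  assumes "x \<in> carrier G" "y \<in> carrier G" "z \<in> carrier G"
  shows "conj_by G (x \<otimes> y) z = conj_by G x z \<otimes> conj_by G y z"
    and "conj_by G x (y \<otimes> z) = conj_by G (conj_by G x y) z"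
  using assms by (simp_all add: word_simps)

lemma conj_by_inv:
  assumes "x \<in> carrier G" "y \<in> carrier G"
  shows "conj_by G (inv x) y = inv (conj_by G x y)"
    and "conj_by G (conj_by G x y) (inv y) = x"
    and "conj_by G (conj_by G x (inv y)) y = x"
  using assms by (simp_all add: word_simps)

lemma conj_by_eq_mult_commutator:
  "x \<in> carrier G \<Longrightarrow> y \<in> carrier G \<Longrightarrow> conj_by G x y = x \<otimes> group_commutator G x y"
  by (simp add: word_simps)

lemma commutator_mult_right:
  assumes "x \<in> carrier G" "y \<in> carrier G" "z \<in> carrier G"
  shows "group_commutator G x (y \<otimes> z) =
    group_commutator G x z \<otimes> conj_by G (group_commutator G x y) z"
  using assms by (simp add: word_simps)

lemma commutator_mult_left:
  assumes "x \<in> carrier G" "y \<in> carrier G" "z \<in> carrier G"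
  shows "group_commutator G (x \<otimes> y) z =
    conj_by G (group_commutator G x z) y \<otimes> group_commutator G y z"
  using assms by (simp add: word_simps)

lemma commutator_inv_left:
  assumes "x \<in> carrier G" "y \<in> carrier G"
  shows "group_commutator G (inv x) y = conj_by G (inv (group_commutator G x y)) (inv x)"
  using assms by (simp add: word_simps)

lemma commutator_inv_right:
  assumes "x \<in> carrier G" "y \<in> carrier G"
  shows "group_commutator G x (inv y) = conj_by G (inv (group_commutator G x y)) (inv y)"
  using assms by (simp add: word_simps)

lemma inv_commutator:
  assumes "x \<in> carrier G" "y \<in> carrier G"
  shows "inv (group_commutator G x y) = group_commutator G y x"
  using assms by (simp add: word_simps)

lemma conj_by_commutator:
  assumes "x \<in> carrier G" "y \<in> carrier G" "z \<in> carrier G"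
  shows "conj_by G (group_commutator G x y) z =
    group_commutator G (conj_by G x z) (conj_by G y z)"
  using assms by (simp add: word_simps)

lemma hall_witt:
  assumes "x \<in> carrier G" "y \<in> carrier G" "z \<in> carrier G"
  shows "conj_by G (group_commutator G (group_commutator G x (inv y)) z) y
    \<otimes> conj_by G (group_commutator G (group_commutator G y (inv z)) x) z
    \<otimes> conj_by G (group_commutator G (group_commutator G z (inv x)) y) x = \<one>"
  using assms by (simp add: word_simps)

lemma commutator_one [simp]:
  "x \<in> carrier G \<Longrightarrow> group_commutator G \<one> x = \<one>"
  "x \<in> carrier G \<Longrightarrow> group_commutator G x \<one> = \<one>"
  "x \<in> carrier G \<Longrightarrow> group_commutator G x x = \<one>"
  by (simp_all add: word_simps)

lemma commutator_eq_one_iff: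
  assumes "x \<in> carrier G" "y \<in> carrier G"
  shows "group_commutator G x y = \<one> \<longleftrightarrow> x \<otimes> y = y \<otimes> x"
proof -
  have "group_commutator G x y = inv (y \<otimes> x) \<otimes> (x \<otimes> y)"
    using assms by (simp add: word_simps)
  moreover have "inv (y \<otimes> x) \<otimes> (x \<otimes> y) = \<one> \<longleftrightarrow> x \<otimes> y = y \<otimes> x"
    using inv_solve_left'[of \<one> "y \<otimes> x" "x \<otimes> y"] assms by auto
  ultimately show ?thesis by simp
qed

lemma normal_conj_closed: "N \<lhd> G \<Longrightarrow> conj_closed G N"
  unfolding conj_closed_def conj_by_def
  by (meson normal.inv_op_closed1 normal_imp_subgroup subgroup.subset)

lemma normal_conj_by: "N \<lhd> G \<Longrightarrow> a \<in> N \<Longrightarrow> h \<in> carrier G \<Longrightarrow> conj_by G a h \<in> N"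
  using normal_conj_closed by (auto simp: conj_closed_def)

lemma normal_conj_by_iff:
  assumes "N \<lhd> G" "a \<in> carrier G" "h \<in> carrier G"
  shows "conj_by G a h \<in> N \<longleftrightarrow> a \<in> N"
  using normal_conj_by[OF assms(1), of "conj_by G a h" "inv h"] normal_conj_by[OF assms(1)] assms
  by (auto simp: conj_by_inv)

lemma subgroup_conj_closed_normal: "subgroup N G \<Longrightarrow> conj_closed G N \<Longrightarrow> N \<lhd> G"
  unfolding normal_inv_iff conj_closed_def conj_by_def
  by (metis inv_closed inv_inv)

lemma normal_subgroup_mem:
  assumes "N \<lhd> G"
  shows "N \<subseteq> carrier G" "\<one> \<in> N" "x \<in> N \<Longrightarrow> y \<in> N \<Longrightarrow> x \<otimes> y \<in> N"
    "x \<in> N \<Longrightarrow> inv x \<in> N"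
  using normal_imp_subgroup[OF assms]
  by (auto simp: subgroup.one_closed subgroup.m_closed subgroup.m_inv_closed dest: subgroup.subset)

lemma normal_commutator_left:
  assumes "N \<lhd> G" "x \<in> N" "y \<in> carrier G"
  shows "group_commutator G x y \<in> N"
  using assms normal_conj_by normal_subgroup_mem(3,4) by (simp add: group_commutator_def)

lemma normal_commutator_swap:
  assumes "N \<lhd> G" "x \<in> carrier G" "y \<in> carrier G" "group_commutator G x y \<in> N"
  shows "group_commutator G y x \<in> N"
  using normal_subgroup_mem(4)[OF assms(1,4)] assms by (simp add: inv_commutator)

lemma normal_commutator_right:
  assumes "N \<lhd> G" "x \<in> carrier G" "y \<in> N"
  shows "group_commutator G x y \<in> N"
  using assms normal_commutator_left normal_commutator_swap normal_subgroup_mem(1) by blast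

text \<open>Commutation with \<open>x\<close> is multiplicative modulo \<open>U\<close> up to conjugation, by \<open>commutator_mult_right\<close>.
Therefore conditions \<open>[x, y] \<in> U\<close> need to be checked for generators \<open>y\<close> only.\<close>

lemma commutator_kernel_subgroup:
  assumes U: "U \<lhd> G" and x: "x \<in> carrier G"
  shows "subgroup {y \<in> carrier G. group_commutator G x y \<in> U} G"
proof (rule subgroupI)
  show "{y \<in> carrier G. group_commutator G x y \<in> U} \<noteq> {}"
    using x normal_subgroup_mem[OF U] by (auto intro!: exI[of _ \<one>])
qed (use x U in \<open>auto simp: commutator_inv_right commutator_mult_right
    intro!: normal_conj_by[OF U] normal_subgroup_mem(3,4)[OF U]\<close>)

lemma commutator_kernel_subgroup_left:
  assumes U: "U \<lhd> G" and x: "x \<in> carrier G"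
  shows "subgroup {y \<in> carrier G. group_commutator G y x \<in> U} G"
proof -
  have "{y \<in> carrier G. group_commutator G y x \<in> U} = {y \<in> carrier G. group_commutator G x y \<in> U}"
    using x normal_commutator_swap[OF U] by blast
  then show ?thesis using commutator_kernel_subgroup[OF assms] by simp
qed

lemma centralizer_mod_normal:
  assumes A: "conj_closed G A" and U: "U \<lhd> G"
  shows "centralizer_mod G A U \<lhd> G"
proof (rule subgroup_conj_closed_normal)
  let ?C = "centralizer_mod G A U"
  have Ac: "A \<subseteq> carrier G" using A by (simp add: conj_closed_def)
  show "subgroup ?C G"
  proof (rule subgroupI)
    show "?C \<noteq> {}"
      using Ac normal_subgroup_mem[OF U]
      by (auto simp: centralizer_mod_def intro!: exI[of _ \<one>])
  qed (use Ac U in \<open>auto simp: centralizer_mod_def commutator_inv_left commutator_mult_left subset_iff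
      intro!: normal_conj_by[OF U] normal_subgroup_mem(3,4)[OF U]\<close>)
  show "conj_closed G ?C"
    unfolding conj_closed_def
  proof (intro conjI ballI)
    show "?C \<subseteq> carrier G" by (rule centralizer_mod_carrier)
    fix g h assume g: "g \<in> ?C" and h: "h \<in> carrier G"
    then have gc: "g \<in> carrier G" by (simp add: centralizer_mod_def)
    have "group_commutator G (conj_by G g h) y \<in> U" if y: "y \<in> A" for y
    proof -
      have yc: "y \<in> carrier G" and y': "conj_by G y (inv h) \<in> A"
        using y h Ac A by (auto simp: conj_closed_def)
      have "group_commutator G g (conj_by G y (inv h)) \<in> U"
        using g y' by (simp add: centralizer_mod_def)
      then have "conj_by G (group_commutator G g (conj_by G y (inv h))) h \<in> U"
        using h U normal_conj_by by blast
      then show ?thesis using gc yc h by (simp add: conj_by_commutator conj_by_inv)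
    qed
    then show "conj_by G g h \<in> ?C" using gc h by (simp add: centralizer_mod_def)
  qed
qed

lemma centralizer_series_normal:
  "conj_closed G A \<Longrightarrow> U \<lhd> G \<Longrightarrow> centralizer_series G A U k \<lhd> G"
  by (induction k) (auto intro: centralizer_mod_normal)

lemma centralizer_mod_extends:
  "A \<subseteq> carrier G \<Longrightarrow> U \<lhd> G \<Longrightarrow> U \<subseteq> centralizer_mod G A U"
  using normal_commutator_left[of U] normal_subgroup_mem(1)[of U]
  by (simp add: centralizer_mod_def subset_iff)

lemma centralizer_series_increasing:
  assumes "conj_closed G A" "U \<lhd> G" "i \<le> j"
  shows "centralizer_series G A U i \<subseteq> centralizer_series G A U j"
  using assms(3)
proof (induction j rule: dec_induct)
  case (step j)
  have "centralizer_series G A U j \<subseteq> centralizer_series G A U (Suc j)"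
    using assms centralizer_mod_extends centralizer_series_normal
    by (simp add: conj_closed_def)
  then show ?case using step by blast
qed simp

lemma carrier_conj_closed: "conj_closed G (carrier G)"
  by (simp add: conj_closed_def)

lemma conj_class_closed:
  assumes "a \<in> carrier G"
  shows "conj_closed G (conj_class G a)" "a \<in> conj_class G a"
proof -
  show "conj_closed G (conj_class G a)"
    using assms by (auto simp: conj_closed_def conj_class_def conj_by_mult(2)[symmetric])
  show "a \<in> conj_class G a"
    using assms by (auto simp: conj_class_def intro!: image_eqI[of _ _ \<one>])
qed

lemma conj_class_subset:
  "conj_closed G A \<Longrightarrow> a \<in> A \<Longrightarrow> conj_class G a \<subseteq> A"
  by (auto simp: conj_closed_def conj_class_def)

lemma generate_conj_closed_normal:
  assumes A: "conj_closed G A"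
  shows "generate G A \<lhd> G"
proof (rule normal_generateI)
  show "A \<subseteq> carrier G" using A by (simp add: conj_closed_def)
  fix h g assume "h \<in> A" "g \<in> carrier G"
  then have "conj_by G h (inv g) \<in> A" using A by (simp add: conj_closed_def)
  then show "g \<otimes> h \<otimes> inv g \<in> A" using \<open>g \<in> carrier G\<close> by (simp add: conj_by_def)
qed

lemma normal_closure_eq_generate:
  assumes a: "a \<in> carrier G"
  shows "normal_closure G a = generate G (conj_class G a)"
proof
  have N: "generate G (conj_class G a) \<lhd> G"
    using generate_conj_closed_normal conj_class_closed[OF a] by blast
  have "generate G {a} \<subseteq> generate G (conj_class G a)"
    using conj_class_closed(2)[OF a] by (intro mono_generate) auto
  with N show "normal_closure G a \<subseteq> generate G (conj_class G a)"
    by (auto simp: normal_closure_def)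
  have "a \<in> normal_closure G a"
    by (auto simp: normal_closure_def intro: generate.incl)
  then show "generate G (conj_class G a) \<subseteq> normal_closure G a"
    using normal_closure_normal[OF a] conj_class_subset normal_conj_closed
    by (intro generate_subgroup_incl normal_imp_subgroup) auto
qed

lemma center_mod_eq_centralizer_mod:
  assumes N: "N \<lhd> G"
  shows "center_mod G N = centralizer_mod G (carrier G) N"
proof -
  have "N #> (g \<otimes> x) = N #> (x \<otimes> g) \<longleftrightarrow> group_commutator G g x \<in> N"
    if gx: "g \<in> carrier G" "x \<in> carrier G" for g x
  proof -
    have sub: "subgroup N G" using N normal_imp_subgroup by blast
    have "N #> (g \<otimes> x) = N #> (x \<otimes> g) \<longleftrightarrow> (g \<otimes> x) \<otimes> inv (x \<otimes> g) \<in> N"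
    proof
      assume "N #> (g \<otimes> x) = N #> (x \<otimes> g)"
      then have "g \<otimes> x \<in> N #> (x \<otimes> g)" using gx rcos_self[OF _ sub] by (metis m_closed)
      then obtain n where n: "n \<in> N" "g \<otimes> x = n \<otimes> (x \<otimes> g)" by (auto simp: r_coset_def)
      moreover have "n \<in> carrier G" using n normal_subgroup_mem[OF N] by blast
      ultimately show "(g \<otimes> x) \<otimes> inv (x \<otimes> g) \<in> N" using gx
        by (metis inv_solve_right' m_closed)
    next
      assume n: "(g \<otimes> x) \<otimes> inv (x \<otimes> g) \<in> N"
      have "g \<otimes> x = ((g \<otimes> x) \<otimes> inv (x \<otimes> g)) \<otimes> (x \<otimes> g)" using gx by (simp add: m_assoc inv_mult_group)
      then have "g \<otimes> x \<in> N #> (x \<otimes> g)" using n unfolding r_coset_def by blast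
      then show "N #> (g \<otimes> x) = N #> (x \<otimes> g)" using repr_independence[OF _ _ sub] gx by auto
    qed
    also have "(g \<otimes> x) \<otimes> inv (x \<otimes> g) = conj_by G (group_commutator G g x) (inv (x \<otimes> g))"
      using gx by (simp add: word_simps)
    also have "\<dots> \<in> N \<longleftrightarrow> group_commutator G g x \<in> N"
      using gx by (intro normal_conj_by_iff[OF N]) auto
    finally show ?thesis .
  qed
  then show ?thesis by (auto simp: center_mod_eq[OF N] centralizer_mod_def)
qed

lemma upper_central_fin_eq:
  "upper_central_fin G k = centralizer_series G (carrier G) {\<one>} k"
proof (induction k)
  case (Suc k)
  have "centralizer_series G (carrier G) {\<one>} k \<lhd> G"
    by (intro centralizer_series_normal carrier_conj_closed one_is_normal)
  then show ?case
    using Suc by (simp add: upper_central_fin_Suc center_mod_eq_centralizer_mod)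
qed (simp add: upper_central_fin_0)

lemma engel_commutator_one [simp]: "y \<in> carrier G \<Longrightarrow> engel_commutator G \<one> m y = \<one>"
  by (induction m) auto

lemma engel_commutator_add:
  "engel_commutator G (engel_commutator G x i y) j y = engel_commutator G x (i + j) y"
  by (induction j) auto

lemma engel_commutator_eventually:
  assumes "engel_commutator G x i y = \<one>" "i \<le> j" "y \<in> carrier G"
  shows "engel_commutator G x j y = \<one>"
  using engel_commutator_add[of x i y "j - i"] assms by simp

lemma conj_by_engel_commutator:
  assumes "x \<in> carrier G" "y \<in> carrier G" "z \<in> carrier G"
  shows "conj_by G (engel_commutator G x m y) z = engel_commutator G (conj_by G x z) m (conj_by G y z)"
  using assms by (induction m) (auto simp: conj_by_commutator)

lemma engel_commutator_centralizer_series: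
  assumes "g \<in> centralizer_series G A U (i + k)" "a \<in> A"
  shows "engel_commutator G g k a \<in> centralizer_series G A U i"
  using assms(1)
proof (induction k arbitrary: i)
  case (Suc k)
  have "engel_commutator G g k a \<in> centralizer_series G A U (Suc i)"
    using Suc.prems by (intro Suc.IH) (simp only: add_Suc_shift)
  then show ?case using assms(2) by (simp add: centralizer_mod_def)
qed simp

end

lemma (in group) subgroup_commutator_eq:
  assumes H: "subgroup H G" and "x \<in> H" "y \<in> H"
  shows "conj_by (G\<lparr>carrier := H\<rparr>) x y = conj_by G x y"
    and "group_commutator (G\<lparr>carrier := H\<rparr>) x y = group_commutator G x y"
  using assms m_inv_consistent[OF H] by (simp_all add: conj_by_def group_commutator_def)

lemma (in group) subgroup_commutator_mem:
  assumes H: "subgroup H G" and "x \<in> H" "y \<in> H"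
  shows "conj_by G x y \<in> H" and "group_commutator G x y \<in> H" and "engel_commutator G x m y \<in> H"
proof -
  have c: "conj_by G z y \<in> H" if "z \<in> H" for z
    using that assms by (simp add: conj_by_def subgroup.m_closed subgroup.m_inv_closed)
  have d: "group_commutator G z y \<in> H" if "z \<in> H" for z
    using c that assms by (simp add: group_commutator_def subgroup.m_closed subgroup.m_inv_closed)
  show "conj_by G x y \<in> H" "group_commutator G x y \<in> H" using c d assms by auto
  show "engel_commutator G x m y \<in> H" using assms d by (induction m) auto
qed

lemma (in group) subgroup_engel_commutator_eq:
  assumes H: "subgroup H G" and "x \<in> H" "y \<in> H"
  shows "engel_commutator (G\<lparr>carrier := H\<rparr>) x m y = engel_commutator G x m y"
  by (induction m) (use assms subgroup_commutator_mem in \<open>auto simp: subgroup_commutator_eq\<close>)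

text \<open>The series of a subgroup \<open>H\<close> can be computed in the big group. In particular, with \<open>A = H\<close>, nilpotency
of a subgroup becomes a statement about \<open>G\<close> alone.\<close>

lemma (in group) centralizer_series_subgroup:
  assumes H: "subgroup H G" and A: "A \<subseteq> H"
  shows "centralizer_series (G\<lparr>carrier := H\<rparr>) A (H \<inter> U) k = H \<inter> centralizer_series G A U k"
proof (induction k)
  case (Suc k)
  have "H \<subseteq> carrier G" using H subgroup.subset by blast
  then show ?case using Suc A subgroup_commutator_mem(2)[OF H] 
    by (auto simp: centralizer_mod_def subgroup_commutator_eq[OF H] subset_iff)
qed simp

lemma (in group_hom) hom_conj_by:
  "x \<in> carrier G \<Longrightarrow> y \<in> carrier G \<Longrightarrow> h (conj_by G x y) = conj_by H (h x) (h y)"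
  by (simp add: conj_by_def)

lemma (in group_hom) hom_commutator:
  "x \<in> carrier G \<Longrightarrow> y \<in> carrier G \<Longrightarrow> h (group_commutator G x y) = group_commutator H (h x) (h y)"
  by (simp add: group_commutator_def hom_conj_by)

lemma (in group_hom) hom_engel_commutator:
  "x \<in> carrier G \<Longrightarrow> y \<in> carrier G \<Longrightarrow> h (engel_commutator G x m y) = engel_commutator H (h x) m (h y)"
  by (induction m) (auto simp: hom_commutator)

lemma (in group_hom) centralizer_series_hom:
  assumes A: "A \<subseteq> carrier G" and g: "g \<in> carrier G"
  shows "h g \<in> centralizer_series H (h ` A) V k \<longleftrightarrow>
    g \<in> centralizer_series G A {x \<in> carrier G. h x \<in> V} k"
  using g
proof (induction k arbitrary: g)
  case (Suc k)
  then show ?case using A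
    by (auto simp: centralizer_mod_def subset_iff hom_commutator[symmetric])
qed simp


section \<open>A quantitative form of the nilpotency criterion of P. Hall\<close>

text \<open>The normalizer of an arbitrary subset. Both inclusions are demanded, so that it is a subgroup also
when \<open>E\<close> is infinite.\<close>

definition set_normalizer :: "('a, 'm) monoid_scheme \<Rightarrow> 'a set \<Rightarrow> 'a set" where
  "set_normalizer G E =
    {h \<in> carrier G. \<forall>e\<in>E. conj_by G e h \<in> E \<and> conj_by G e (inv\<^bsub>G\<^esub> h) \<in> E}"

context group
begin

lemma set_normalizer_subgroup:
  assumes E: "E \<subseteq> carrier G"
  shows "subgroup (set_normalizer G E) G"
proof (rule subgroupI)
  show "set_normalizer G E \<noteq> {}"
    using E by (auto simp: set_normalizer_def subset_iff intro!: exI[of _ \<one>])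
  show "a \<otimes> b \<in> set_normalizer G E"
    if "a \<in> set_normalizer G E" "b \<in> set_normalizer G E" for a b
    using that E by (auto simp: set_normalizer_def subset_iff conj_by_mult(2) inv_mult_group)
qed (auto simp: set_normalizer_def)

lemma subgroup_subset_set_normalizer:
  "subgroup E G \<Longrightarrow> E \<subseteq> set_normalizer G E"
  using subgroup_commutator_mem(1)[of E] subgroup.m_inv_closed[of E G] subgroup.subset[of E G]
  by (auto simp: set_normalizer_def)

lemma set_normalizer_normal:
  assumes E: "subgroup E G" and K: "subgroup K G" and EK: "E \<subseteq> K" and KN: "K \<subseteq> set_normalizer G E"
  shows "E \<lhd> G\<lparr>carrier := K\<rparr>"
proof -
  interpret K: group "G\<lparr>carrier := K\<rparr>" using K subgroup_imp_group by blast
  show ?thesis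
    using K.subgroup_conj_closed_normal[of E] subgroup_incl[OF E K EK] EK KN
      subgroup_commutator_eq[OF K]
    by (auto simp: conj_closed_def set_normalizer_def subset_iff)
qed

lemma set_normalizer_generate:
  assumes S: "S \<subseteq> carrier G"
  shows "set_normalizer G S \<subseteq> set_normalizer G (generate G S)"
proof
  fix h assume h: "h \<in> set_normalizer G S"
  have key: "conj_by G e k \<in> generate G S"
    if e: "e \<in> generate G S" and k: "k \<in> carrier G" "\<And>s. s \<in> S \<Longrightarrow> conj_by G s k \<in> S" for e k
    using e
  proof (induction e rule: generate.induct)
    case one
    then show ?case using k generate.one by auto
  next
    case (incl s)
    show ?case using k(2)[OF incl] by (rule generate.incl)
  next
    case (inv s)
    then show ?case using k S generate.inv[of "conj_by G s k" S]
      by (auto simp: conj_by_inv subset_iff)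
  next
    case (eng s t)
    then show ?case using k S generate.eng generate_in_carrier[OF S]
      by (simp add: conj_by_mult)
  qed
  show "h \<in> set_normalizer G (generate G S)"
    using h by (auto simp: set_normalizer_def intro!: key)
qed

lemma centralizer_mod_generate:
  assumes A: "A \<subseteq> carrier G" and U: "U \<lhd> G"
  shows "centralizer_mod G (generate G A) U = centralizer_mod G A U"
proof
  show "centralizer_mod G (generate G A) U \<subseteq> centralizer_mod G A U"
    by (intro centralizer_mod_mono) (auto intro: generate.incl)
  show "centralizer_mod G A U \<subseteq> centralizer_mod G (generate G A) U"
  proof
    fix g assume g: "g \<in> centralizer_mod G A U"
    then have gc: "g \<in> carrier G" by (simp add: centralizer_mod_def)
    have "generate G A \<subseteq> {y \<in> carrier G. group_commutator G g y \<in> U}"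
      using g A by (intro generate_subgroup_incl commutator_kernel_subgroup U gc)
        (auto simp: centralizer_mod_def)
    then show "g \<in> centralizer_mod G (generate G A) U"
      using gc by (auto simp: centralizer_mod_def)
  qed
qed

lemma centralizer_series_generate:
  assumes "conj_closed G A" "U \<lhd> G"
  shows "centralizer_series G (generate G A) U k = centralizer_series G A U k"
  using assms centralizer_series_normal[OF assms]
  by (induction k) (auto simp: centralizer_mod_generate conj_closed_def)

text \<open>This is Fitting's theorem: if the series for \<open>A\<close> and \<open>B\<close> reach \<open>G\<close> in \<open>i\<close> and \<open>j\<close> steps, then the
series for the union reaches it in \<open>i + j\<close> steps. A commutator with an element of \<open>A\<close> lowers the
first index and leaves the second one alone, because the terms are normal; likewise for \<open>B\<close>.\<close>

lemma centralizer_series_Int_subset_Un: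
  assumes A: "conj_closed G A" and B: "conj_closed G B"
  shows "centralizer_series G A {\<one>} i \<inter> centralizer_series G B {\<one>} j
    \<subseteq> centralizer_series G (A \<union> B) {\<one>} (i + j)"
proof (induction "i + j" arbitrary: i j rule: less_induct)
  case less
  note normal = centralizer_series_normal[OF _ one_is_normal]
  have AB: "conj_closed G (A \<union> B)" using A B by (auto simp: conj_closed_def)
  show ?case
  proof (cases "i = 0 \<or> j = 0")
    case True
    then show ?thesis using normal_subgroup_mem(2)[OF normal[OF AB, of "i + j"]] by auto
  next
    case False
    then obtain i' j' where ij: "i = Suc i'" "j = Suc j'" by (metis not0_implies_Suc)
    show ?thesis
    proof
      fix g assume g: "g \<in> centralizer_series G A {\<one>} i \<inter> centralizer_series G B {\<one>} j"
      then have gc: "g \<in> carrier G" by (simp add: ij centralizer_mod_def)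
      have "group_commutator G g y \<in> centralizer_series G (A \<union> B) {\<one>} (i' + j)" if y: "y \<in> A" for y
      proof -
        have "group_commutator G g y \<in> centralizer_series G A {\<one>} i'"
          using g y by (simp add: ij centralizer_mod_def)
        moreover have "group_commutator G g y \<in> centralizer_series G B {\<one>} j"
          using g y A by (intro normal_commutator_left normal[OF B]) (auto simp: conj_closed_def)
        ultimately show ?thesis using less[of i' j] ij by auto
      qed
      moreover have "group_commutator G g y \<in> centralizer_series G (A \<union> B) {\<one>} (i + j')" if y: "y \<in> B" for y
      proof -
        have "group_commutator G g y \<in> centralizer_series G B {\<one>} j'"
          using g y by (simp add: ij centralizer_mod_def)
        moreover have "group_commutator G g y \<in> centralizer_series G A {\<one>} i"
          using g y B by (intro normal_commutator_left normal[OF A]) (auto simp: conj_closed_def)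
        ultimately show ?thesis using less[of i j'] ij by auto
      qed
      ultimately show "g \<in> centralizer_series G (A \<union> B) {\<one>} (i + j)"
        using gc by (auto simp: ij centralizer_mod_def)
    qed
  qed
qed

text \<open>The three subgroups lemma for single elements: by the Hall-Witt identity, if two of the three double commutators lie in a
normal subgroup, so does the third.\<close>

lemma three_commutators:
  assumes U: "U \<lhd> G" and c: "x \<in> carrier G" "y \<in> carrier G" "z \<in> carrier G"
    and 1: "group_commutator G (group_commutator G (inv y) (inv z)) x \<in> U"
    and 2: "group_commutator G (group_commutator G z (inv x)) (inv y) \<in> U"
  shows "group_commutator G (group_commutator G x y) z \<in> U"
proof -
  let ?p = "conj_by G (group_commutator G (group_commutator G x y) z) (inv y)"
  let ?q = "conj_by G (group_commutator G (group_commutator G (inv y) (inv z)) x) z"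
  let ?r = "conj_by G (group_commutator G (group_commutator G z (inv x)) (inv y)) x"
  have "?p \<otimes> ?q \<otimes> ?r = \<one>" using hall_witt[of x "inv y" z] c by simp
  then have "?p = inv (?q \<otimes> ?r)"
    using c inv_equality[of ?p "?q \<otimes> ?r"] by (simp add: m_assoc)
  moreover have "?q \<in> U" "?r \<in> U" using 1 2 U c normal_conj_by by blast+
  ultimately have "?p \<in> U" using normal_subgroup_mem(3,4)[OF U] by simp
  then show ?thesis using normal_conj_by_iff[OF U] c by simp
qed

text \<open>Commutation is bilinear modulo later terms, so the indices of the two arguments add up, as for
a tensor product of two unipotent actions. If one index is \<open>0\<close>, then the hypothesis
\<open>[Z', N] \<le> Z\<close> applies. Otherwise the three subgroups lemma moves a further commutator with an element
of \<open>G\<close> to one of the two arguments.\<close>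

lemma commutator_centralizer_series:
  assumes N: "N \<lhd> G" and Z: "Z \<lhd> G" and Z': "Z' \<lhd> G" and ZZ: "Z' \<subseteq> centralizer_mod G N Z"
    and "u \<in> N" "u \<in> centralizer_series G (carrier G) Z' i"
    and "v \<in> N" "v \<in> centralizer_series G (carrier G) Z' j"
  shows "group_commutator G u v \<in> centralizer_series G (carrier G) Z (i + j)"
  using assms(5-8)
proof (induction "i + j" arbitrary: u v i j rule: less_induct)
  case less
  let ?Z = "centralizer_series G (carrier G) Z"
  let ?Z' = "centralizer_series G (carrier G) Z'"
  note nZ = centralizer_series_normal[OF carrier_conj_closed Z]
  note nZ' = centralizer_series_normal[OF carrier_conj_closed Z']
  note inN = normal_subgroup_mem(1)[OF N, THEN subsetD]
  have uv: "u \<in> carrier G" "v \<in> carrier G" using less.prems inN by auto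
  have Z0: "Z \<subseteq> ?Z (i + j)"
    using centralizer_series_increasing[OF carrier_conj_closed Z, of 0 "i + j"] by simp
  show ?case
  proof (cases "i = 0 \<or> j = 0")
    case True
    then have "group_commutator G u v \<in> Z \<or> group_commutator G v u \<in> Z"
      using less.prems ZZ by (auto simp: centralizer_mod_def)
    then show ?thesis using Z0 normal_commutator_swap[OF Z] uv by blast
  next
    case False
    then obtain i' j' where ij: "i = Suc i'" "j = Suc j'" by (metis not0_implies_Suc)
    have "group_commutator G (group_commutator G u v) k \<in> ?Z (i' + j)" if k: "k \<in> carrier G" for k
    proof (rule three_commutators[OF nZ uv k])
      have v': "inv v \<in> N" "inv v \<in> ?Z' (Suc j')"
        using less.prems normal_subgroup_mem(4)[OF N] normal_subgroup_mem(4)[OF nZ'] ij by blast+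
      then have v: "inv v \<in> N" "group_commutator G (inv v) (inv k) \<in> ?Z' j'"
        using k by (simp_all add: centralizer_mod_def)
      then have "group_commutator G (group_commutator G (inv v) (inv k)) u \<in> ?Z (j' + i)"
        using k less.prems ij by (intro less.hyps normal_commutator_left[OF N]) auto
      then show "group_commutator G (group_commutator G (inv v) (inv k)) u \<in> ?Z (i' + j)"
        by (simp add: ij add.commute)
      have "inv u \<in> N" "inv u \<in> ?Z' (Suc i')"
        using less.prems normal_subgroup_mem(4)[OF N] normal_subgroup_mem(4)[OF nZ'] ij by blast+
      then have u: "inv u \<in> N" "group_commutator G (inv u) k \<in> ?Z' i'"
        using k by (simp_all add: centralizer_mod_def)
      have "group_commutator G k (inv u) \<in> N" "group_commutator G k (inv u) \<in> ?Z' i'"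
        using u(2) normal_commutator_swap[OF nZ'] uv k normal_commutator_right[OF N k u(1)] by auto
      then show "group_commutator G (group_commutator G k (inv u)) (inv v) \<in> ?Z (i' + j)"
        using v' ij by (intro less.hyps) simp_all
    qed
    then show ?thesis using uv ij by (simp add: centralizer_mod_def)
  qed
qed

lemma commutators_conj_closed:
  assumes N: "N \<lhd> G"
  shows "conj_closed G {group_commutator G u v |u v. u \<in> N \<and> v \<in> N}"
proof -
  have "conj_by G (group_commutator G u v) h \<in> {group_commutator G u v |u v. u \<in> N \<and> v \<in> N}"
    if "u \<in> N" "v \<in> N" "h \<in> carrier G" for u v h
    using that normal_conj_by[OF N] normal_subgroup_mem(1)[OF N]
    by (auto simp: conj_by_commutator subset_iff)
  then show ?thesis using normal_subgroup_mem(1)[OF N] by (auto simp: conj_closed_def)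
qed

text \<open>If \<open>N\<close> is nilpotent and \<open>G\<close> acts nilpotently on \<open>N/[N, N]\<close>, then \<open>N\<close> is contained in a finite term of the upper
central series of \<open>G\<close>. The proof descends along the upper central series \<open>Z\<^sub>c, \<dots>, Z\<^sub>0\<close> of \<open>N\<close>. If
\<open>N\<close> lies in the term of index \<open>M\<close> over \<open>Z\<^sub>j\<^sub>+\<^sub>1\<close>, then \<open>[N, N]\<close> lies in the term of index \<open>2M\<close> over
\<open>Z\<^sub>j\<close> by \<open>commutator_centralizer_series\<close>, and therefore \<open>N\<close> in the term of index \<open>2M + m\<close>.\<close>

lemma hall_nilpotency:
  fixes N
  defines "D \<equiv> generate G {group_commutator G u v |u v. u \<in> N \<and> v \<in> N}"
  assumes N: "N \<lhd> G" and c: "N \<subseteq> centralizer_series G N {\<one>} c"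
    and m: "N \<subseteq> centralizer_series G (carrier G) D m"
  shows "N \<subseteq> centralizer_series G (carrier G) {\<one>} ((2 ^ c - 1) * m)"
proof -
  let ?Z = "\<lambda>j. centralizer_series G N {\<one>} j"
  have nZ: "?Z j \<lhd> G" for j
    using centralizer_series_normal normal_conj_closed[OF N] one_is_normal by blast
  have "j \<le> c \<Longrightarrow> N \<subseteq> centralizer_series G (carrier G) (?Z (c - j)) ((2 ^ j - 1) * m)" for j
  proof (induction j)
    case 0
    then show ?case using c by simp
  next
    case (Suc j)
    let ?M = "(2 ^ j - 1) * m"
    let ?Y = "centralizer_series G (carrier G) (?Z (c - Suc j)) (?M + ?M)"
    have IH: "N \<subseteq> centralizer_series G (carrier G) (?Z (c - j)) ?M" using Suc by simp
    have "?Z (c - j) \<subseteq> centralizer_mod G N (?Z (c - Suc j))"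
      using Suc.prems by (simp add: Suc_diff_Suc[symmetric])
    then have "group_commutator G u v \<in> ?Y" if "u \<in> N" "v \<in> N" for u v
      using that IH by (intro commutator_centralizer_series[OF N nZ nZ]) auto
    then have "D \<subseteq> ?Y"
      unfolding D_def
      by (intro generate_subgroup_incl normal_imp_subgroup centralizer_series_normal
          carrier_conj_closed nZ) auto
    then have "N \<subseteq> centralizer_series G (carrier G) ?Y m"
      using m centralizer_series_mono by blast
    moreover have "?M + ?M + m = (2 ^ Suc j - 1) * m"
    proof -
      obtain t where "(2::nat) ^ j = Suc t" by (metis not0_implies_Suc power_eq_0_iff zero_neq_numeral)
      then show ?thesis by (simp add: algebra_simps)
    qed
    ultimately show ?case by (simp add: centralizer_series_add)
  qed
  from this[of c] show ?thesis by simp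
qed

text \<open>Modulo \<open>[N, N]\<close> only the generator \<open>x\<close> acts on \<open>N\<close>. So a single iterated commutator with \<open>x\<close> controls
the commutators with all elements of \<open>G\<close>.\<close>

lemma engel_commutator_imp_centralizer_series:
  assumes N: "N \<lhd> G" and D: "D \<lhd> G" and ND: "\<And>u v. u \<in> N \<Longrightarrow> v \<in> N \<Longrightarrow> group_commutator G u v \<in> D"
    and x: "x \<in> carrier G" and gen: "generate G (insert x N) = carrier G"
    and "y \<in> N" "engel_commutator G y m x \<in> D"
  shows "y \<in> centralizer_series G (carrier G) D m"
  using assms(6,7)
proof (induction m arbitrary: y)
  case (Suc m)
  let ?Z = "centralizer_series G (carrier G) D"
  have yc: "y \<in> carrier G" using Suc.prems normal_subgroup_mem(1)[OF N] by blast
  have Z: "?Z m \<lhd> G" by (intro centralizer_series_normal carrier_conj_closed D)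
  have "engel_commutator G (group_commutator G y x) m x \<in> D"
    using Suc.prems engel_commutator_add[of y 1 x m] by simp
  then have "group_commutator G y x \<in> ?Z m"
    using Suc.prems by (intro Suc.IH normal_commutator_left[OF N] x)
  moreover have "D \<subseteq> ?Z m"
    using centralizer_series_increasing[OF carrier_conj_closed D, of 0 m] by simp
  ultimately have "generate G (insert x N) \<subseteq> {k \<in> carrier G. group_commutator G y k \<in> ?Z m}"
    using Suc.prems x ND normal_subgroup_mem(1)[OF N]
    by (intro generate_subgroup_incl commutator_kernel_subgroup Z yc) auto
  then show ?case using yc by (auto simp: gen centralizer_mod_def)
qed simp

lemma engel_action_hypercentral_top:
  assumes N: "N \<lhd> G" and c: "N \<subseteq> centralizer_series G N {\<one>} c"
    and x: "x \<in> carrier G" and gen: "generate G (insert x N) = carrier G"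
    and A: "A \<subseteq> carrier G" "N = generate G A" and m: "\<And>a. a \<in> A \<Longrightarrow> engel_commutator G a m x = \<one>"
  shows "N \<subseteq> centralizer_series G (carrier G) {\<one>} ((2 ^ c - 1) * m)"
proof (rule hall_nilpotency[OF N c])
  let ?C = "{group_commutator G u v |u v. u \<in> N \<and> v \<in> N}"
  let ?D = "generate G ?C"
  have D: "?D \<lhd> G" using generate_conj_closed_normal commutators_conj_closed[OF N] by blast
  have "a \<in> centralizer_series G (carrier G) ?D m" if a: "a \<in> A" for a
  proof (rule engel_commutator_imp_centralizer_series[OF N D _ x gen])
    show "a \<in> N" using a A generate.incl by auto
    show "engel_commutator G a m x \<in> ?D" using m[OF a] generate.one by auto
  qed (auto intro!: generate.incl)
  then show "N \<subseteq> centralizer_series G (carrier G) ?D m"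
    unfolding A(2) using A(2) D
    by (intro generate_subgroup_incl normal_imp_subgroup centralizer_series_normal
        carrier_conj_closed) auto
qed

text \<open>Passing to the group \<open>\<langle>x, N\<rangle>\<close> removes the hypothesis that \<open>x\<close> and \<open>N\<close> generate \<open>G\<close>. The index depends
on \<open>c\<close> and \<open>m\<close> only, and this is the source of the uniform bound on subnormal defects.\<close>

lemma engel_action_hypercentral:
  assumes N: "subgroup N G" and c: "N \<subseteq> centralizer_series G N {\<one>} c"
    and x: "x \<in> set_normalizer G N"
    and A: "N = generate G A" and m: "\<And>a. a \<in> A \<Longrightarrow> engel_commutator G a m x = \<one>"
  defines "K \<equiv> generate G (insert x N)"
  shows "N \<lhd> G\<lparr>carrier := K\<rparr>"
    and "N \<subseteq> centralizer_series (G\<lparr>carrier := K\<rparr>) K {\<one>} ((2 ^ c - 1) * m)"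
proof -
  have xc: "x \<in> carrier G" using x by (simp add: set_normalizer_def)
  have Nc: "N \<subseteq> carrier G" using N subgroup.subset by blast
  have K: "subgroup K G" unfolding K_def using xc Nc by (intro generate_is_subgroup) auto
  have NK: "N \<subseteq> K" and xK: "x \<in> K" unfolding K_def by (auto intro: generate.incl)
  have "K \<subseteq> set_normalizer G N"
    unfolding K_def using x subgroup_subset_set_normalizer[OF N]
    by (intro generate_subgroup_incl set_normalizer_subgroup Nc) auto
  then show nK: "N \<lhd> G\<lparr>carrier := K\<rparr>" using set_normalizer_normal[OF N K NK] by blast
  have AN: "A \<subseteq> N" unfolding A by (auto intro: generate.incl)
  interpret K: group "G\<lparr>carrier := K\<rparr>" using K subgroup_imp_group by blast
  have one: "{\<one>} = K \<inter> {\<one>}" using subgroup.one_closed[OF K] by auto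
  have "N \<subseteq> centralizer_series (G\<lparr>carrier := K\<rparr>) (carrier (G\<lparr>carrier := K\<rparr>))
      {\<one>\<^bsub>G\<lparr>carrier := K\<rparr>\<^esub>} ((2 ^ c - 1) * m)"
  proof (rule K.engel_action_hypercentral_top[OF nK, of _ x A])
    show "N \<subseteq> centralizer_series (G\<lparr>carrier := K\<rparr>) N {\<one>\<^bsub>G\<lparr>carrier := K\<rparr>\<^esub>} c"
      using c NK centralizer_series_subgroup[OF K NK, of "{\<one>}" c] one by simp
    show "generate (G\<lparr>carrier := K\<rparr>) (insert x N) = carrier (G\<lparr>carrier := K\<rparr>)"
      using generate_consistent[of "insert x N" K] K NK xK K_def by simp
    show "N = generate (G\<lparr>carrier := K\<rparr>) A"
      using generate_consistent[of A K] K NK AN A by auto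
    show "engel_commutator (G\<lparr>carrier := K\<rparr>) a m x = \<one>\<^bsub>G\<lparr>carrier := K\<rparr>\<^esub>" if "a \<in> A" for a
      using that m AN NK xK subgroup_engel_commutator_eq[OF K] by (auto simp: subset_iff)
  qed (use AN NK xK in auto)
  then show "N \<subseteq> centralizer_series (G\<lparr>carrier := K\<rparr>) K {\<one>} ((2 ^ c - 1) * m)" by simp
qed

end


section \<open>Left Engel elements of finite groups\<close>

text \<open>For a subgroup \<open>U\<close> this is nilpotency, by \<open>centralizer_series_subgroup\<close>; the series is taken in \<open>G\<close>, so
that subgroups can be compared without a change of the ambient group.\<close>

definition nilpotent_subset :: "('a, 'm) monoid_scheme \<Rightarrow> 'a set \<Rightarrow> bool" where
  "nilpotent_subset G U \<longleftrightarrow> (\<exists>k. U \<subseteq> centralizer_series G U {\<one>\<^bsub>G\<^esub>} k)"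

lemma nilpotent_subset_mono:
  "nilpotent_subset G U \<Longrightarrow> V \<subseteq> U \<Longrightarrow> nilpotent_subset G V"
  unfolding nilpotent_subset_def
  by (meson centralizer_series_mono order_refl subset_trans)

context group
begin

text \<open>Take the first term \<open>Z\<^sub>i\<close> of the upper central series of \<open>U\<close> that is not contained in \<open>E\<close>. Its
elements normalise \<open>E\<close>, since \<open>[Z\<^sub>i, E] \<le> Z\<^sub>i\<^sub>-\<^sub>1 \<le> E\<close>.\<close>

lemma nilpotent_normalizer_condition:
  assumes U: "subgroup U G" and nil: "nilpotent_subset G U"
    and E: "subgroup E G" "E \<subset> U"
  obtains g where "g \<in> U" "g \<notin> E" "g \<in> set_normalizer G E"
proof -
  let ?Z = "centralizer_series G U {\<one>}"
  have Uc: "U \<subseteq> carrier G" using U subgroup.subset by blast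
  interpret H: group "G\<lparr>carrier := U\<rparr>" using U subgroup_imp_group by blast
  have "\<exists>i. \<not> U \<inter> ?Z i \<subseteq> E" using nil E(2) by (auto simp: nilpotent_subset_def)
  then obtain i where i: "\<not> U \<inter> ?Z i \<subseteq> E" and least: "\<And>j. j < i \<Longrightarrow> U \<inter> ?Z j \<subseteq> E"
    using exists_least_iff[of "\<lambda>i. \<not> U \<inter> ?Z i \<subseteq> E"] by blast
  have "i \<noteq> 0" using i E(1) subgroup.one_closed by auto
  then obtain j where j: "i = Suc j" by (metis not0_implies_Suc)
  obtain g where g: "g \<in> U" "g \<in> ?Z i" "g \<notin> E" using i by blast
  have sub: "U \<inter> ?Z i = centralizer_series (G\<lparr>carrier := U\<rparr>) U {\<one>} i"
    using centralizer_series_subgroup[OF U order_refl, of "{\<one>}" i] subgroup.one_closed[OF U]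
    by simp
  have "centralizer_series (G\<lparr>carrier := U\<rparr>) U {\<one>} i \<lhd> G\<lparr>carrier := U\<rparr>"
    using H.centralizer_series_normal[OF H.carrier_conj_closed H.one_is_normal] by simp
  then have "inv g \<in> U \<inter> ?Z i"
    using g H.normal_subgroup_mem(4) m_inv_consistent[OF U] sub by fastforce
  moreover have "conj_by G e h \<in> E" if h: "h \<in> U \<inter> ?Z i" and e: "e \<in> E" for e h
  proof -
    have c: "e \<in> U" "h \<in> U" "e \<in> carrier G" "h \<in> carrier G" using h e E Uc by auto
    have "group_commutator G h e \<in> U \<inter> ?Z j"
      using h c subgroup_commutator_mem(2)[OF U] by (simp add: j centralizer_mod_def)
    then have "group_commutator G h e \<in> E" using least j by blast
    then have "group_commutator G e h \<in> E"
      using inv_commutator[of h e] c subgroup.m_inv_closed[OF E(1)] by metis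
    then show ?thesis
      using conj_by_eq_mult_commutator[of e h] c e subgroup.m_closed[OF E(1)] by simp
  qed
  ultimately have "g \<in> set_normalizer G E"
    using g Uc by (auto simp: set_normalizer_def)
  then show ?thesis using g that by blast
qed

lemma centralizer_series_conj:
  assumes A: "A \<subseteq> carrier G" and w: "w \<in> carrier G"
  shows "g \<in> centralizer_series G A {\<one>} k \<Longrightarrow>
    conj_by G g w \<in> centralizer_series G ((\<lambda>a. conj_by G a w) ` A) {\<one>} k"
proof (induction k arbitrary: g)
  case (Suc k)
  then show ?case
    using A w by (auto simp: centralizer_mod_def subset_iff conj_by_commutator[symmetric])
qed (use w in simp)

lemma nilpotent_subset_conj:
  assumes "A \<subseteq> carrier G" "w \<in> carrier G" "nilpotent_subset G A"
  shows "nilpotent_subset G ((\<lambda>a. conj_by G a w) ` A)"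
  using assms centralizer_series_conj unfolding nilpotent_subset_def by blast

lemma generate_conj:
  assumes "A \<subseteq> carrier G" and w: "w \<in> carrier G"
  shows "generate G ((\<lambda>a. conj_by G a w) ` A) = (\<lambda>a. conj_by G a w) ` generate G A"
proof -
  interpret h: group_hom G G "\<lambda>a. conj_by G a w"
    by unfold_locales (auto simp: hom_def conj_by_mult w)
  show ?thesis using h.generate_img assms by metis
qed

lemma central_series_cyclic_extension:
  assumes N: "N \<lhd> G" and f: "N \<subseteq> centralizer_series G (carrier G) {\<one>} f"
    and x: "x \<in> carrier G" and gen: "generate G (insert x N) = carrier G"
  shows "carrier G \<subseteq> centralizer_series G (carrier G) {\<one>} (Suc f)"
proof -
  let ?Z = "centralizer_series G (carrier G) {\<one>}"
  have Z: "?Z k \<lhd> G" for k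
    by (intro centralizer_series_normal carrier_conj_closed one_is_normal)
  have "generate G (insert x N) \<subseteq> {y \<in> carrier G. group_commutator G x y \<in> ?Z f}"
  proof (rule generate_subgroup_incl[OF _ commutator_kernel_subgroup[OF Z x]])
    show "insert x N \<subseteq> {y \<in> carrier G. group_commutator G x y \<in> ?Z f}"
      using x f normal_commutator_right[OF N x] normal_subgroup_mem(1)[OF N]
        normal_subgroup_mem(2)[OF Z] by auto
  qed
  then have "x \<in> ?Z (Suc f)" using x gen by (auto simp: centralizer_mod_def)
  moreover have "N \<subseteq> ?Z (Suc f)"
    using f centralizer_series_increasing[OF carrier_conj_closed one_is_normal, of f "Suc f"] by auto
  ultimately have "generate G (insert x N) \<subseteq> ?Z (Suc f)"
    by (intro generate_subgroup_incl normal_imp_subgroup Z) auto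
  then show ?thesis using gen by simp
qed

text \<open>The left Engel element \<open>w\<close> acts on the generators \<open>S\<close> by iterated commutators that vanish, with a uniform length since \<open>S\<close> is finite.
So \<open>\<langle>S\<rangle>\<close> lies in a finite term of the upper central series of \<open>\<langle>w, S\<rangle>\<close>, and the quotient by that
term is cyclic.\<close>

lemma nilpotent_extend_by_left_engel:
  assumes fin: "finite (carrier G)" and S: "S \<subseteq> carrier G" and nil: "nilpotent_subset G (generate G S)"
    and w: "w \<in> set_normalizer G S" "w \<in> left_engel G"
  shows "nilpotent_subset G (generate G (insert w S))"
proof -
  let ?U = "generate G S" and ?K = "generate G (insert w (generate G S))"
  have wc: "w \<in> carrier G" using w by (simp add: set_normalizer_def)
  have U: "subgroup ?U G" using S generate_is_subgroup by blast
  have Uc: "?U \<subseteq> carrier G" using U subgroup.subset by blast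
  have K: "subgroup ?K G" using wc Uc by (intro generate_is_subgroup) auto
  have UK: "?U \<subseteq> ?K" and wK: "w \<in> ?K" by (auto intro: generate.incl)
  obtain c where c: "?U \<subseteq> centralizer_series G ?U {\<one>} c"
    using nil by (auto simp: nilpotent_subset_def)
  have ex: "\<forall>s\<in>S. \<exists>m. engel_commutator G s m w = \<one>"
    using w(2) S by (auto simp: left_engel_def)
  obtain m where m: "\<forall>s\<in>S. engel_commutator G s (m s) w = \<one>"
    using bchoice[OF ex] by (rule exE)
  have fS: "finite S" using fin S finite_subset by blast
  have M: "engel_commutator G s (Max (m ` S)) w = \<one>" if "s \<in> S" for s
    using engel_commutator_eventually[OF bspec[OF m that] _ wc] that fS by simp
  define f where "f = (2 ^ c - 1) * Max (m ` S)"
  note H = engel_action_hypercentral[OF U c _ refl M]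
  have wU: "w \<in> set_normalizer G ?U" using w set_normalizer_generate[OF S] by blast
  interpret K: group "G\<lparr>carrier := ?K\<rparr>" using K subgroup_imp_group by blast
  have one: "{\<one>} = ?K \<inter> {\<one>}" using subgroup.one_closed[OF K] by auto
  have "carrier (G\<lparr>carrier := ?K\<rparr>) \<subseteq>
      centralizer_series (G\<lparr>carrier := ?K\<rparr>) (carrier (G\<lparr>carrier := ?K\<rparr>))
        {\<one>\<^bsub>G\<lparr>carrier := ?K\<rparr>\<^esub>} (Suc f)"
  proof (rule K.central_series_cyclic_extension)
    show "?U \<lhd> G\<lparr>carrier := ?K\<rparr>" using H(1)[OF wU] .
    show "?U \<subseteq> centralizer_series (G\<lparr>carrier := ?K\<rparr>) (carrier (G\<lparr>carrier := ?K\<rparr>))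
        {\<one>\<^bsub>G\<lparr>carrier := ?K\<rparr>\<^esub>} f"
      using H(2)[OF wU] by (simp add: f_def)
    show "w \<in> carrier (G\<lparr>carrier := ?K\<rparr>)" using wK by simp
    show "generate (G\<lparr>carrier := ?K\<rparr>) (insert w ?U) = carrier (G\<lparr>carrier := ?K\<rparr>)"
      using generate_consistent[of "insert w ?U" ?K] K UK wK by simp
  qed
  then have "?K \<subseteq> centralizer_series G ?K {\<one>} (Suc f)"
    using centralizer_series_subgroup[OF K order_refl, of "{\<one>}" "Suc f"] one
    by (simp del: centralizer_series.simps)
  then have "nilpotent_subset G ?K" unfolding nilpotent_subset_def by blast
  moreover have "generate G (insert w S) \<subseteq> ?K"
    using wK by (intro mono_generate) (auto intro: generate.incl)
  ultimately show ?thesis by (rule nilpotent_subset_mono)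
qed

text \<open>The normalizer condition, with the normalising element taken from \<open>C\<close>: among the subgroups of \<open>\<langle>S\<rangle>\<close> that meet
\<open>C\<close> exactly in \<open>I\<close> choose a maximal one, \<open>E\<close>. Enlarging \<open>E\<close> by an element \<open>g\<close> that normalises it
produces a new element of \<open>C\<close>, and this element normalises \<open>E \<inter> C = I\<close>.\<close>

lemma normalizing_conjugate_exists:
  assumes fin: "finite (carrier G)" and C: "conj_closed G C"
    and S: "S \<subseteq> C" "nilpotent_subset G (generate G S)" "generate G S \<inter> C = S"
    and I: "I \<subset> S" "generate G I \<inter> C = I"
  obtains u where "u \<in> S" "u \<notin> I" "u \<in> set_normalizer G I"
proof -
  have Cc: "C \<subseteq> carrier G" using C by (simp add: conj_closed_def)
  let ?Es = "{E. subgroup E G \<and> E \<subseteq> generate G S \<and> E \<inter> C = I}"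
  have Sc: "S \<subseteq> carrier G" and Ic: "I \<subseteq> carrier G" using S I Cc by auto
  have fEs: "finite ?Es" using fin subgroup.subset by (intro finite_subset[of ?Es "Pow (carrier G)"]) auto
  have "generate G I \<in> ?Es"
    using Ic I generate_is_subgroup mono_generate[of I S] by auto
  from finite_has_maximal2[OF fEs this]
  obtain E where "E \<in> ?Es" "generate G I \<subseteq> E \<and> (\<forall>E'\<in>?Es. E \<subseteq> E' \<longrightarrow> E = E')"
    by (rule bexE)
  then have E: "E \<in> ?Es" and max: "\<And>E'. E' \<in> ?Es \<Longrightarrow> E \<subseteq> E' \<Longrightarrow> E = E'"
    by simp_all
  have "E \<noteq> generate G S" using E S(3) I by auto
  then have ES: "E \<subset> generate G S" and Esub: "subgroup E G" using E by auto
  obtain g where g: "g \<in> generate G S" "g \<notin> E" "g \<in> set_normalizer G E"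
    using nilpotent_normalizer_condition[OF generate_is_subgroup[OF Sc] S(2) Esub ES] .
  let ?E' = "generate G (insert g E)"
  have gc: "g \<in> carrier G" using g by (simp add: set_normalizer_def)
  have Ec: "E \<subseteq> carrier G" using E subgroup.subset by blast
  have E': "subgroup ?E' G" "?E' \<subseteq> generate G S" "E \<subseteq> ?E'" "g \<in> ?E'"
    using gc Ec g E generate_is_subgroup[of "insert g E"]
      generate_subgroup_incl[of "insert g E" "generate G S"] generate_is_subgroup[OF Sc]
    by (auto intro: generate.incl)
  have "\<not> ?E' \<inter> C \<subseteq> I"
  proof
    assume "?E' \<inter> C \<subseteq> I"
    then have "?E' \<in> ?Es" using E' E by auto
    then show False using max E' g by blast
  qed
  then obtain u where u: "u \<in> ?E'" "u \<in> C" "u \<notin> I" by blast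
  have "?E' \<subseteq> set_normalizer G E"
    using g subgroup_subset_set_normalizer[of E] E Ec
    by (intro generate_subgroup_incl set_normalizer_subgroup) auto
  then have "u \<in> set_normalizer G E" using u by blast
  moreover have "I = E \<inter> C" using E by simp
  ultimately have "u \<in> set_normalizer G I"
    using C by (auto simp: set_normalizer_def conj_closed_def)
  moreover have "u \<in> S" using u E' S(3) by blast
  ultimately show ?thesis using u that by blast
qed

text \<open>Suppose not. Then there are two distinct maximal sets \<open>S\<close> and \<open>T\<close> among the subsets of \<open>C\<close> that
generate nilpotent subgroups. Take them with \<open>I = S \<inter> T\<close> as large as possible, and let \<open>u \<in> S\<close> and
\<open>v \<in> T\<close> be elements outside \<open>I\<close> that normalise \<open>I\<close>. By the choice of \<open>I\<close>, a maximal set that contains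
\<open>I\<close> is determined by any of its elements outside \<open>I\<close>. Since \<open>[v,\<^sub>m u] = 1\<close> for some \<open>m\<close>, the conjugate of \<open>u\<close> by
\<open>[v,\<^sub>m u]\<close> lies in \<open>S\<close>; descending to \<open>m = 0\<close>, the conjugate of \<open>u\<close> by \<open>v\<close> lies in \<open>S\<close>. Then \<open>v\<close>
normalises \<open>S\<close>, hence \<open>v \<in> S\<close> by maximality, a contradiction.\<close>

theorem baer_finite:
  assumes fin: "finite (carrier G)" and C: "conj_closed G C" and L: "C \<subseteq> left_engel G"
  shows "nilpotent_subset G (generate G C)"
proof (rule ccontr)
  assume contra: "\<not> nilpotent_subset G (generate G C)"
  have Cc: "C \<subseteq> carrier G" and fC: "finite C"
    using C fin finite_subset by (auto simp: conj_closed_def)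
  define F where "F = {S. S \<subseteq> C \<and> nilpotent_subset G (generate G S)}"
  define M where "M = {S \<in> F. \<forall>R\<in>F. S \<subseteq> R \<longrightarrow> S = R}"
  let ?c = "\<lambda>w S. (\<lambda>a. conj_by G a w) ` S"
  have fF: "finite F" using fC by (simp add: F_def)
  have F_sub: "S \<subseteq> carrier G" if "S \<in> F" for S using that Cc by (auto simp: F_def)
  have F_extend: "insert w S \<in> F" if "S \<in> F" "w \<in> C" "w \<in> set_normalizer G S" for w S
    using that nilpotent_extend_by_left_engel[OF fin F_sub[OF that(1)]] L by (auto simp: F_def)
  have M_extend: "w \<in> S" if "S \<in> M" "w \<in> C" "w \<in> set_normalizer G S" for w S
    using F_extend[of S w] that by (auto simp: M_def)
  have M_above: "\<exists>R\<in>M. S \<subseteq> R" if "S \<in> F" for S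
    using finite_has_maximal2[OF fF that] by (auto simp: M_def)
  have M_closed: "generate G S \<inter> C = S" if "S \<in> M" for S
  proof -
    have S: "S \<in> F" using that by (simp add: M_def)
    have "generate G (generate G S \<inter> C) \<subseteq> generate G S"
      using generate_is_subgroup[OF F_sub[OF S]] by (intro generate_subgroup_incl) auto
    then have "generate G S \<inter> C \<in> F"
      using S nilpotent_subset_mono by (auto simp: F_def)
    moreover have "S \<subseteq> generate G S \<inter> C" using S by (auto simp: F_def intro: generate.incl)
    ultimately show ?thesis using that by (auto simp: M_def)
  qed
  have F_conj: "?c w S \<in> F" if "S \<in> F" "w \<in> carrier G" for w S
    using that nilpotent_subset_conj[of "generate G S" w] generate_conj[OF F_sub[OF that(1)] that(2)]
      generate_in_carrier[OF F_sub[OF that(1)]] C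
    by (auto simp: F_def conj_closed_def)
  have conj_back: "?c (inv w) (?c w S) = S" if "S \<subseteq> carrier G" "w \<in> carrier G" for w S
    using that by (force simp: image_image conj_by_inv subset_iff)
  have M_conj: "?c w S \<in> M" if S: "S \<in> M" and w: "w \<in> carrier G" for w S
    unfolding M_def
  proof (intro CollectI conjI ballI impI)
    have SF: "S \<in> F" using S by (simp add: M_def)
    show "?c w S \<in> F" using F_conj[OF SF w] .
    fix R assume R: "R \<in> F" "?c w S \<subseteq> R"
    have "?c (inv w) (?c w S) \<subseteq> ?c (inv w) R" using R(2) by (rule image_mono)
    then have "S \<subseteq> ?c (inv w) R" using conj_back[OF F_sub[OF SF] w] by simp
    then have "S = ?c (inv w) R" using S F_conj[OF R(1)] w by (auto simp: M_def)
    then show "?c w S = R" using conj_back[OF F_sub[OF R(1)], of "inv w"] w by simp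
  qed
  have "{} \<in> F"
    using generate_empty by (auto simp: F_def nilpotent_subset_def intro: exI[of _ 0])
  then have single: "{w} \<in> F" if "w \<in> C" for w
    using F_extend[of "{}" w] that Cc by (auto simp: set_normalizer_def)
  obtain S0 where S0: "S0 \<in> M" using M_above[OF \<open>{} \<in> F\<close>] by blast
  have "\<not> C \<subseteq> S0"
    using S0 contra by (auto simp: M_def F_def dest: subset_antisym)
  then obtain w where w: "w \<in> C" "w \<notin> S0" by blast
  then obtain T0 where T0: "T0 \<in> M" "w \<in> T0" using M_above[OF single[OF w(1)]] by blast
  let ?P = "{(S, T). S \<in> M \<and> T \<in> M \<and> S \<noteq> T}"
  let ?f = "\<lambda>q. card (fst q \<inter> snd q)"
  have bound: "\<forall>q. q \<in> ?P \<longrightarrow> ?f q < Suc (card C)"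
    using fC by (auto simp: M_def F_def less_Suc_eq_le intro!: card_mono)
  have "(S0, T0) \<in> ?P" using S0 T0 w by auto
  from ex_has_greatest_nat[of "\<lambda>q. q \<in> ?P", OF this bound]
  obtain p where p: "p \<in> ?P \<and> (\<forall>q. q \<in> ?P \<longrightarrow> ?f q \<le> ?f p)" by (rule exE)
  obtain S T where "p = (S, T)" by (cases p)
  then have S: "S \<in> M" and T: "T \<in> M" and ST: "S \<noteq> T" using p by simp_all
  have max: "card (S' \<inter> T') \<le> card (S \<inter> T)" if "S' \<in> M" "T' \<in> M" "S' \<noteq> T'" for S' T'
    using p that \<open>p = (S, T)\<close> by simp
  define I where "I = S \<inter> T"
  have MF: "R \<in> F" "R \<subseteq> C" "nilpotent_subset G (generate G R)" if "R \<in> M" for R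
    using that by (auto simp: M_def F_def)
  have SC: "S \<subseteq> C" and TC: "T \<subseteq> C" using MF S T by auto
  \<comment> \<open>A maximal set above \<open>I\<close> is determined by any element outside \<open>I\<close>.\<close>
  have unique: "R = R'" if "R \<in> M" "R' \<in> M" "I \<subseteq> R" "I \<subseteq> R'" "w \<in> R" "w \<in> R'" "w \<notin> I" for R R' w
  proof (rule ccontr)
    assume "R \<noteq> R'"
    then have "card (R \<inter> R') \<le> card I" using max that by (simp add: I_def)
    moreover have "I \<subset> R \<inter> R'" using that by blast
    moreover have "finite (R \<inter> R')"
      using MF(2)[OF that(1)] fC by (meson finite_Int finite_subset)
    ultimately show False using psubset_card_mono[of "R \<inter> R'" I] by simp
  qed
  have I_closed: "generate G I \<inter> C = I"
  proof
    have "generate G I \<subseteq> generate G S" "generate G I \<subseteq> generate G T"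
      unfolding I_def by (intro mono_generate; blast)+
    then show "generate G I \<inter> C \<subseteq> I" using M_closed[OF S] M_closed[OF T] by (auto simp: I_def)
    show "I \<subseteq> generate G I \<inter> C" using SC by (auto simp: I_def intro: generate.incl)
  qed
  have "R = R'" if "R \<in> M" "R' \<in> M" "R \<subseteq> R'" for R R' using that by (simp add: M_def)
  from this[OF S T] this[OF T S] have "\<not> S \<subseteq> T" "\<not> T \<subseteq> S" using ST by auto
  then have IS: "I \<subset> S" and IT: "I \<subset> T" by (auto simp: I_def)
  obtain u where u: "u \<in> S" "u \<notin> I" "u \<in> set_normalizer G I"
    using normalizing_conjugate_exists[OF fin C MF(2,3)[OF S] M_closed[OF S] IS I_closed] .
  obtain v where v: "v \<in> T" "v \<notin> I" "v \<in> set_normalizer G I"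
    using normalizing_conjugate_exists[OF fin C MF(2,3)[OF T] M_closed[OF T] IT I_closed] .
  have Ic: "I \<subseteq> carrier G" using IS SC Cc by blast
  note nI = set_normalizer_subgroup[OF Ic]
  have uc: "u \<in> carrier G" and vc: "v \<in> carrier G" using u v SC TC Cc by auto
  \<comment> \<open>The set \<open>S\<close> and its conjugate by \<open>w'\<close> share \<open>I\<close> and a conjugate of \<open>z\<close>, hence coincide.\<close>
  have absorb: "w \<in> S" if w: "w \<in> C" "w \<in> set_normalizer G I"
    and z: "z \<in> S" "z \<notin> I" "conj_by G z w' \<in> S" and w': "w' = w \<or> w' = inv w" for w z w'
  proof -
    have wc: "w \<in> carrier G" using w Cc by blast
    have w'n: "w' \<in> set_normalizer G I" using w w' subgroup.m_inv_closed[OF nI] by blast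
    then have w'c: "w' \<in> carrier G" and inv_w'n: "inv w' \<in> set_normalizer G I"
      using subgroup.m_inv_closed[OF nI] by (auto simp: set_normalizer_def)
    have zc: "z \<in> carrier G" using z SC Cc by blast
    have "I \<subseteq> ?c w' S"
    proof
      fix i assume i: "i \<in> I"
      then have "conj_by G i (inv w') \<in> S" using w'n IS by (auto simp: set_normalizer_def)
      then show "i \<in> ?c w' S"
        using i Ic w'c by (auto simp: conj_by_inv subset_iff intro!: image_eqI[of _ _ "conj_by G i (inv w')"])
    qed
    moreover have "conj_by G z w' \<notin> I"
      using inv_w'n z w'c zc by (auto simp: set_normalizer_def conj_by_inv)
    ultimately have eq: "?c w' S = S"
      using unique[OF M_conj[OF S w'c] S, of "conj_by G z w'"] z IS by auto
    have eq': "?c (inv w') S = S" using conj_back[OF F_sub[OF MF(1)[OF S]] w'c] eq by simp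
    have "w \<in> set_normalizer G S"
      using eq eq' w' wc by (auto simp: set_normalizer_def)
    then show ?thesis using M_extend[OF S w(1)] by blast
  qed
  let ?g = "\<lambda>k. engel_commutator G v k u"
  have g: "?g k \<in> set_normalizer G I" for k
    using subgroup_commutator_mem(3)[OF nI v(3) u(3)] .
  have "v \<in> carrier G \<and> u \<in> left_engel G" using u SC L vc by blast
  then obtain m where m: "?g m = \<one>" by (auto simp: left_engel_def)
  have step: "conj_by G u (?g k) \<in> S" if "conj_by G u (?g (Suc k)) \<in> S" for k
  proof -
    have gc: "?g k \<in> carrier G" using uc vc by simp
    define w where "w = conj_by G u (?g k)"
    have wC: "w \<in> C" using C u(1) SC gc by (auto simp: w_def conj_closed_def)
    have wc: "w \<in> carrier G" using wC Cc by blast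
    have wn: "w \<in> set_normalizer G I"
      unfolding w_def using subgroup_commutator_mem(1)[OF nI u(3) g] .
    \<comment> \<open>With \<open>w\<close> the conjugate of \<open>u\<close> by \<open>?g k\<close>, the next commutator is \<open>w\<^sup>-\<^sup>1 u\<close>.\<close>
    have "?g (Suc k) = inv w \<otimes> u"
      using gc uc by (simp add: w_def word_simps)
    then have "conj_by G u (?g (Suc k)) = conj_by G (conj_by G u (inv w)) u"
      using uc wc by (simp add: conj_by_mult)
    then have "conj_by G (conj_by G u (inv w)) u \<in> S" using that by simp
    then have "conj_by G (conj_by G u (inv w)) u \<in> generate G S" by (rule generate.incl)
    moreover have "u \<in> generate G S" using u by (auto intro: generate.incl)
    ultimately have "conj_by G (conj_by G (conj_by G u (inv w)) u) (inv u) \<in> generate G S"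
      using generate_is_subgroup[of S] SC Cc subgroup_commutator_mem(1)[of "generate G S"]
        subgroup.m_inv_closed[of "generate G S" G] by blast
    then have "conj_by G u (inv w) \<in> generate G S" using uc wc by (simp add: conj_by_inv)
    moreover have "conj_by G u (inv w) \<in> C" using C u SC wc by (auto simp: conj_closed_def)
    ultimately have "conj_by G u (inv w) \<in> S" using M_closed[OF S] by blast
    then show ?thesis using absorb[OF wC wn u(1,2)] by (simp add: w_def)
  qed
  have "conj_by G u (?g (m - k)) \<in> S" for k
  proof (induction k)
    case 0
    then show ?case using m u uc by simp
  next
    case (Suc k)
    then show ?case using step[of "m - Suc k"]
      by (cases "k < m") (simp_all add: Suc_diff_Suc del: engel_commutator.simps)
  qed
  from this[of m] have "conj_by G u v \<in> S" by simp
  then have "v \<in> S" using absorb[OF _ v(3) u(1,2), of v] v TC by blast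
  then show False using v by (simp add: I_def)
qed

end


section \<open>Right Engel elements of finite groups\<close>

context group
begin

lemma left_engel_conj:
  assumes "a \<in> left_engel G" "h \<in> carrier G"
  shows "conj_by G a h \<in> left_engel G"
proof -
  have a: "a \<in> carrier G" using assms by (simp add: left_engel_def)
  have "\<exists>m\<ge>1. engel_commutator G g m (conj_by G a h) = \<one>" if g: "g \<in> carrier G" for g
  proof -
    obtain m where "m \<ge> 1" and m: "engel_commutator G (conj_by G g (inv h)) m a = \<one>"
      using assms g unfolding left_engel_def by blast
    moreover have "engel_commutator G g m (conj_by G a h) = \<one>"
      using conj_by_engel_commutator[of "conj_by G g (inv h)" a h m] m assms(2) a g
      by (simp add: conj_by_inv)
    ultimately show ?thesis by blast
  qed
  then show ?thesis using assms a by (simp add: left_engel_def)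
qed

lemma engel_commutator_conj_eq_one:
  assumes a: "a \<in> carrier G" and h: "h \<in> carrier G" and x: "x \<in> carrier G"
    and m: "engel_commutator G a m (conj_by G x (inv h)) = \<one>"
  shows "engel_commutator G (conj_by G a h) m x = \<one>"
  using conj_by_engel_commutator[of a "conj_by G x (inv h)" h m] assms by (simp add: conj_by_inv)

lemma right_engel_conj:
  assumes "a \<in> right_engel G" "h \<in> carrier G"
  shows "conj_by G a h \<in> right_engel G"
proof -
  have a: "a \<in> carrier G" using assms by (simp add: right_engel_def)
  have "\<exists>m\<ge>1. engel_commutator G (conj_by G a h) m g = \<one>" if g: "g \<in> carrier G" for g
  proof -
    obtain m where "m \<ge> 1" and m: "engel_commutator G a m (conj_by G g (inv h)) = \<one>"
      using assms g unfolding right_engel_def by blast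
    then show ?thesis using engel_commutator_conj_eq_one[OF a assms(2) g] by blast
  qed
  then show ?thesis using assms a by (simp add: right_engel_def)
qed

text \<open>Heineken's identity. It follows from \<open>[x, a\<^sup>-\<^sup>1] = a\<^sup>x a\<^sup>-\<^sup>1\<close>, since the second factor commutes with
\<open>a\<^sup>-\<^sup>1\<close> and may be dropped from the next commutator, up to conjugation.\<close>

lemma engel_commutator_inv_swap:
  assumes x: "x \<in> carrier G" and a: "a \<in> carrier G"
  shows "engel_commutator G x (Suc (Suc n)) (inv a) =
    conj_by G (conj_by G (engel_commutator G a (Suc n) (conj_by G (inv a) (inv x))) x) (inv a)"
proof -
  define b where "b = conj_by G a x"
  have b: "b \<in> carrier G" using x a by (simp add: b_def)
  have "group_commutator G x (inv a) = b \<otimes> inv a"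
    using x a by (simp add: b_def word_simps)
  then have "engel_commutator G x (1 + 1) (inv a) = conj_by G (group_commutator G b (inv a)) (inv a)"
    using b a by (simp add: commutator_mult_left)
  then have "engel_commutator G x (1 + 1 + n) (inv a) =
      engel_commutator G (conj_by G (group_commutator G b (inv a)) (inv a)) n (inv a)"
    using engel_commutator_add[of x "1 + 1" "inv a" n] by simp
  also have "\<dots> = conj_by G (engel_commutator G (group_commutator G b (inv a)) n (inv a)) (inv a)"
    using conj_by_engel_commutator[of "group_commutator G b (inv a)" "inv a" "inv a" n] a b
    by (simp add: conj_by_def)
  also have "engel_commutator G (group_commutator G b (inv a)) n (inv a) = engel_commutator G b (Suc n) (inv a)"
    using engel_commutator_add[of b 1 "inv a" n] by simp
  also have "\<dots> = conj_by G (engel_commutator G a (Suc n) (conj_by G (inv a) (inv x))) x"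
    using conj_by_engel_commutator[of a "conj_by G (inv a) (inv x)" x "Suc n"] a x
    by (simp add: b_def conj_by_inv)
  finally show ?thesis by simp
qed

lemma inv_right_engel_left_engel:
  assumes "a \<in> right_engel G"
  shows "inv a \<in> left_engel G"
proof -
  have a: "a \<in> carrier G" using assms by (simp add: right_engel_def)
  have "\<exists>m\<ge>1. engel_commutator G x m (inv a) = \<one>" if x: "x \<in> carrier G" for x
  proof -
    obtain m where m: "m \<ge> 1" "engel_commutator G a m (conj_by G (inv a) (inv x)) = \<one>"
      using assms a x unfolding right_engel_def by blast
    then obtain n where "m = Suc n" by (metis Suc_le_D One_nat_def)
    then have "engel_commutator G x (Suc (Suc n)) (inv a) = \<one>"
      using m engel_commutator_inv_swap[OF x a, of n] a x by simp
    then show ?thesis by (metis le_add1 plus_1_eq_Suc)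
  qed
  then show ?thesis using a by (simp add: left_engel_def)
qed

lemma finite_left_engel_nilpotent:
  assumes fin: "finite (carrier G)" and a: "a \<in> left_engel G"
  shows "nilpotent_subset G (generate G (conj_class G a))"
proof (rule baer_finite[OF fin])
  have "a \<in> carrier G" using a by (simp add: left_engel_def)
  then show "conj_closed G (conj_class G a)" by (rule conj_class_closed)
  show "conj_class G a \<subseteq> left_engel G"
    using left_engel_conj[OF a] by (auto simp: conj_class_def)
qed

lemma generate_conj_class_inv_subset:
  assumes a: "a \<in> carrier G"
  shows "generate G (conj_class G a) \<subseteq> generate G (conj_class G (inv a))"
proof -
  have N: "generate G (conj_class G (inv a)) \<lhd> G"
    using a by (intro generate_conj_closed_normal conj_class_closed) auto
  have "inv a \<in> generate G (conj_class G (inv a))"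
    using a conj_class_closed(2)[of "inv a"] by (intro generate.incl) auto
  then have "a \<in> generate G (conj_class G (inv a))"
    using normal_subgroup_mem(4)[OF N] a by fastforce
  then show ?thesis
    using conj_class_subset[OF normal_conj_closed[OF N]]
    by (intro generate_subgroup_incl normal_imp_subgroup N)
qed

text \<open>The Engel condition on generators carries over to all of \<open>N\<close>, with a bound that does not
depend on the element.\<close>

lemma bounded_engel_on_nilpotent_normal:
  assumes N: "N \<lhd> G" "N \<subseteq> centralizer_series G N {\<one>} c"
    and A: "N = generate G A" and x: "x \<in> carrier G"
    and m: "\<And>b. b \<in> A \<Longrightarrow> engel_commutator G b m x = \<one>" and n: "n \<in> N"
  shows "engel_commutator G n ((2 ^ c - 1) * m) x = \<one>"
proof -
  let ?K = "generate G (insert x N)" and ?f = "(2 ^ c - 1) * m"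
  have "N \<subseteq> carrier G" using normal_subgroup_mem(1)[OF N(1)] .
  then have K: "subgroup ?K G" using x by (intro generate_is_subgroup) auto
  interpret K: group "G\<lparr>carrier := ?K\<rparr>" using K subgroup_imp_group by blast
  have nK: "n \<in> ?K" and xK: "x \<in> ?K" using n by (auto intro: generate.incl)
  have "x \<in> set_normalizer G N"
    using x normal_conj_by[OF N(1)] by (auto simp: set_normalizer_def)
  then have "N \<subseteq> centralizer_series (G\<lparr>carrier := ?K\<rparr>) ?K {\<one>} ?f"
    using engel_action_hypercentral(2)[OF normal_imp_subgroup[OF N(1)] N(2) _ A m] by blast
  then have "n \<in> centralizer_series (G\<lparr>carrier := ?K\<rparr>) ?K {\<one>} (0 + ?f)" using n by auto
  from K.engel_commutator_centralizer_series[OF this xK]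
  have "engel_commutator (G\<lparr>carrier := ?K\<rparr>) n ?f x \<in> {\<one>}" by simp
  then show ?thesis using subgroup_engel_commutator_eq[OF K nK xK] by simp
qed

end

context group
begin

text \<open>By induction on \<open>j\<close>, the power \<open>X = x\<^bsup>p^j\<^esup>\<close> centralizes \<open>[y, x]\<close> and thus also \<open>w = [y, X]\<close>. Hence
conjugation by \<open>X\<^sup>p\<close> takes \<open>y\<close> to \<open>y w\<^sup>p = y\<close>.\<close>

lemma prime_power_centralizes:
  assumes M: "M \<lhd> G" and p: "\<And>y. y \<in> M \<Longrightarrow> y [^] (p::nat) = \<one>"
    and x: "x \<in> carrier G" and "y \<in> M" "engel_commutator G y j x = \<one>"
  shows "conj_by G y (x [^] (p ^ j)) = y"
  using assms(4,5)
proof (induction j arbitrary: y)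
  case 0
  then show ?case using x by simp
next
  case (Suc j)
  let ?X = "x [^] (p ^ j)"
  let ?P = "{z \<in> M. conj_by G z ?X = z}"
  note Mc = normal_subgroup_mem(1)[OF M, THEN subsetD]
  have X: "?X \<in> carrier G" using x by simp
  have y: "y \<in> carrier G" using Suc.prems Mc by blast
  have P: "subgroup ?P G"
  proof (rule subgroupI)
    show "?P \<noteq> {}" using normal_subgroup_mem(2)[OF M] X by auto
  qed (use M X Mc in \<open>auto simp: conj_by_mult conj_by_inv normal_subgroup_mem(3,4)\<close>)
  have xX: "x \<otimes> ?X = ?X \<otimes> x" using x by (simp add: nat_pow_comm[of x 1, simplified])
  have Pinv: "conj_by G z x \<in> ?P" if z: "z \<in> ?P" for z
  proof -
    have zc: "z \<in> carrier G" using z Mc by blast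
    have "conj_by G (conj_by G z x) ?X = conj_by G (conj_by G z ?X) x"
      using zc x X xX by (simp add: conj_by_mult(2)[symmetric])
    then show ?thesis using z x normal_conj_by[OF M] by simp
  qed
  have "engel_commutator G (group_commutator G y x) j x = \<one>"
    using Suc.prems engel_commutator_add[of y 1 x j] by simp
  moreover have yxM: "group_commutator G y x \<in> M"
    using Suc.prems x normal_commutator_left[OF M] by simp
  ultimately have yx: "group_commutator G y x \<in> ?P" using Suc.IH by simp
  have "group_commutator G y (x [^] n) \<in> ?P" for n :: nat
  proof (induction n)
    case 0
    then show ?case using y P subgroup.one_closed[OF P] by simp
  next
    case (Suc n)
    have "group_commutator G y (x [^] Suc n) =
        group_commutator G y x \<otimes> conj_by G (group_commutator G y (x [^] n)) x"
      using x y by (simp add: commutator_mult_right)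
    then show ?case using Suc Pinv yx subgroup.m_closed[OF P] by simp
  qed
  then have w: "group_commutator G y ?X \<in> ?P" by blast
  define w where "w = group_commutator G y ?X"
  have wc: "w \<in> carrier G" using y X by (simp add: w_def)
  have wX: "conj_by G w ?X = w" and wM: "w \<in> M" using w by (simp_all add: w_def)
  have wXr: "conj_by G (w [^] r) ?X = w [^] r" for r :: nat
    by (induction r) (use wX wc X in \<open>auto simp: conj_by_mult\<close>)
  have "conj_by G y (?X [^] r) = y \<otimes> w [^] r" for r :: nat
  proof (induction r)
    case (Suc r)
    have "conj_by G y (?X [^] Suc r) = conj_by G (conj_by G y (?X [^] r)) ?X"
      using y X by (simp add: conj_by_mult)
    also have "\<dots> = (y \<otimes> w) \<otimes> w [^] r"
      using Suc y wc X wXr by (simp add: conj_by_mult conj_by_eq_mult_commutator[of y] w_def)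
    also have "\<dots> = y \<otimes> w [^] Suc r"
      using y wc nat_pow_comm[of w 1 r] by (simp add: m_assoc)
    finally show ?case .
  qed (use y in simp)
  from this[of p] have "conj_by G y (?X [^] p) = y" using p[OF wM] y by simp
  then show ?case using x by (simp add: nat_pow_pow mult.commute)
qed

lemma stabilizer_subgroup:
  assumes y: "y \<in> carrier G"
  shows "subgroup {g \<in> carrier G. conj_by G y g = y} G"
proof (rule subgroupI)
  show "{g \<in> carrier G. conj_by G y g = y} \<noteq> {}" using y by (auto intro!: exI[of _ \<one>])
  show "inv a \<in> {g \<in> carrier G. conj_by G y g = y}"
    if "a \<in> {g \<in> carrier G. conj_by G y g = y}" for a
    using that conj_by_inv(2)[OF y, of a] by auto
qed (use y in \<open>auto simp: conj_by_mult\<close>)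

lemma card_conj_class:
  assumes y: "y \<in> carrier G"
  shows "card (conj_class G y) * card {g \<in> carrier G. conj_by G y g = y} = order G"
proof -
  let ?\<phi> = "\<lambda>g. (\<lambda>h \<in> carrier G. g \<otimes> h \<otimes> (inv g))"
  interpret A: group_action G "carrier G" ?\<phi> by (rule action_by_conjugation)
  have inv_image: "carrier G = (\<lambda>g. inv g) ` carrier G"
    by (force intro: image_eqI[of _ _ "inv x" for x])
  have stab: "conj_by G y g = y \<longleftrightarrow> conj_by G y (inv g) = y" if "g \<in> carrier G" for g
  proof
    show "conj_by G y (inv g) = y" if "conj_by G y g = y"
      using conj_by_inv(2)[OF y \<open>g \<in> carrier G\<close>] that by simp
    show "conj_by G y g = y" if "conj_by G y (inv g) = y"
      using conj_by_inv(3)[OF y \<open>g \<in> carrier G\<close>] that by simp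
  qed
  have "conj_class G y = orbit G ?\<phi> y"
    unfolding conj_class_def orbit_def using y
    by (subst inv_image) (auto simp: conj_by_def image_image)
  moreover have "{g \<in> carrier G. conj_by G y g = y} = stabilizer G ?\<phi> y"
    unfolding stabilizer_def using y stab by (auto simp: conj_by_def)
  ultimately show ?thesis using A.orbit_stabilizer_theorem[OF y] by simp
qed

lemma subgroup_card_dvd:
  assumes "subgroup H G" "subgroup K G" "H \<subseteq> K"
  shows "card H dvd card K"
proof -
  interpret K: group "G\<lparr>carrier := K\<rparr>" using assms subgroup_imp_group by blast
  have "subgroup H (G\<lparr>carrier := K\<rparr>)" using assms subgroup_incl by blast
  from K.lagrange[OF this]
  have "card (rcosets\<^bsub>G\<lparr>carrier := K\<rparr>\<^esub> H) * card H = card K" by (simp add: order_def)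
  then show ?thesis by (metis dvd_triv_right)
qed

lemma subgroup_pow_card:
  assumes "subgroup H G" "x \<in> H"
  shows "x [^] card H = \<one>"
proof -
  interpret H: group "G\<lparr>carrier := H\<rparr>" using assms subgroup_imp_group by blast
  show ?thesis using H.pow_order_eq_1[of x] assms(2) nat_pow_consistent[of x "card H" H]
    by (simp add: order_def)
qed

lemma mem_subgroup_coprime_power:
  assumes S: "subgroup S G" and x: "x \<in> carrier G"
    and m: "x [^] (m::nat) \<in> S" "m \<noteq> 0" and n: "x [^] (n::nat) = \<one>" and "coprime m n"
  shows "x \<in> S"
proof -
  obtain k l where kl: "m * k = n * l + 1" using bezout_nat[OF m(2), of n] \<open>coprime m n\<close> by auto
  have "(x [^] m) [^] k = x [^] (n * l + 1)" using x kl by (simp add: nat_pow_pow)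
  also have "\<dots> = (x [^] n) [^] l \<otimes> x" using x by (simp add: nat_pow_pow nat_pow_mult[symmetric])
  finally have "(x [^] m) [^] k = x" using n x by simp
  moreover have "(x [^] m) [^] k \<in> S"
    by (induction k) (use S m in \<open>auto simp: subgroup.one_closed subgroup.m_closed\<close>)
  ultimately show ?thesis by simp
qed

text \<open>For a prime \<open>q \<noteq> p\<close>, a Sylow \<open>q\<close>-subgroup of \<open>G\<close> centralizes \<open>M\<close> by \<open>prime_power_centralizes\<close>. So the
length of a nontrivial orbit of \<open>G\<close> on \<open>M\<close> is divisible by \<open>p\<close>, and \<open>p\<close> divides the order of \<open>M\<close>;
therefore the trivial element is not the only fixed point.\<close>

lemma engel_action_fixed_point:
  assumes fin: "finite (carrier G)" and M: "M \<lhd> G" and ne: "M \<noteq> {\<one>}"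
    and p: "prime p" and exp: "\<And>y. y \<in> M \<Longrightarrow> y [^] (p::nat) = \<one>"
    and engel: "\<And>y x. y \<in> M \<Longrightarrow> x \<in> carrier G \<Longrightarrow> \<exists>j. engel_commutator G y j x = \<one>"
  shows "\<exists>z\<in>M. z \<noteq> \<one> \<and> (\<forall>g\<in>carrier G. conj_by G z g = z)"
proof (rule ccontr)
  assume "\<not> ?thesis"
  then have contra: "\<exists>g\<in>carrier G. conj_by G z g \<noteq> z" if "z \<in> M" "z \<noteq> \<one>" for z
    using that by blast
  note Mc = normal_subgroup_mem(1)[OF M]
  have Msub: "subgroup M G" using M normal_imp_subgroup by blast
  \<comment> \<open>For a prime \<open>q \<noteq> p\<close> the stabilizer contains a Sylow \<open>q\<close>-subgroup, so \<open>q\<close> does not divide the orbit length.\<close>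
  have dvd: "p dvd card (conj_class G y)" if y: "y \<in> M" "y \<noteq> \<one>" for y
  proof -
    let ?S = "{g \<in> carrier G. conj_by G y g = y}"
    have yc: "y \<in> carrier G" using y Mc by blast
    have S: "subgroup ?S G" using stabilizer_subgroup[OF yc] .
    have eq: "card (conj_class G y) * card ?S = order G" using card_conj_class[OF yc] .
    have pos: "order G > 0" using fin order_gt_0_iff_finite by blast
    have "card (conj_class G y) \<noteq> 1"
    proof
      assume "card (conj_class G y) = 1"
      then obtain c where "conj_class G y = {c}" using card_1_singletonE by blast
      then have "conj_by G y g = y" if "g \<in> carrier G" for g
        using that conj_class_closed(2)[OF yc] by (auto simp: conj_class_def)
      then show False using contra y by blast
    qed
    then obtain q where q: "prime q" "q dvd card (conj_class G y)"
      using prime_factor_nat by blast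
    show ?thesis
    proof (cases "q = p")
      case False
      define b where "b = multiplicity q (order G)"
      obtain m where m: "order G = q ^ b * m"
        using multiplicity_dvd[of q "order G"] unfolding b_def dvd_def by blast
      obtain Q where Q: "subgroup Q G" "card Q = q ^ b"
        using sylow_thm[OF q(1) is_group m fin] by blast
      have "Q \<subseteq> ?S"
      proof
        fix x assume x: "x \<in> Q"
        have xc: "x \<in> carrier G" using x Q subgroup.subset by blast
        obtain j where "engel_commutator G y j x = \<one>" using engel y xc by blast
        then have "x [^] (p ^ j) \<in> ?S"
          using prime_power_centralizes[OF M exp xc y(1)] xc by simp
        moreover have "x [^] (q ^ b) = \<one>" using subgroup_pow_card[OF Q(1) x] Q(2) by simp
        moreover have "coprime (p ^ j) (q ^ b)"
          using False p q primes_coprime by (simp add: primes_coprime)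
        ultimately show "x \<in> ?S" using mem_subgroup_coprime_power[OF S xc, of "p ^ j" "q ^ b"] p
          by (simp add: prime_gt_0_nat)
      qed
      then have "q ^ b dvd card ?S" using subgroup_card_dvd[OF Q(1) S] Q(2) by simp
      then have "q * q ^ b dvd order G" using mult_dvd_mono[OF q(2)] eq by metis
      then have "q ^ Suc b dvd order G" by simp
      then have "Suc b \<le> multiplicity q (order G)"
        using pos q(1) not_prime_unit by (intro multiplicity_geI) auto
      then show ?thesis by (simp add: b_def)
    qed (use q in simp)
  qed
  let ?C = "conj_class G ` (M - {\<one>})"
  have sub: "conj_class G y \<subseteq> M - {\<one>}" if y: "y \<in> M - {\<one>}" for y
  proof -
    have yc: "y \<in> carrier G" using y Mc by blast
    have "conj_by G y g \<noteq> \<one>" if "g \<in> carrier G" for g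
      using that y yc conj_by_inv(2)[OF yc that] by auto
    then show ?thesis
      using y normal_conj_by[OF M] by (auto simp: conj_class_def)
  qed
  have un: "\<Union>?C = M - {\<one>}"
    using sub conj_class_closed(2) Mc by blast
  have class_eq: "conj_class G z = conj_class G y" if yz: "y \<in> carrier G" "z \<in> conj_class G y" for y z
  proof -
    have sub: "conj_class G z \<subseteq> conj_class G y"
      using that conj_class_closed conj_class_subset by blast
    obtain g where g: "g \<in> carrier G" "z = conj_by G y g"
      using yz by (auto simp: conj_class_def)
    have "z \<in> carrier G" using g yz by simp
    moreover have "y \<in> conj_class G z"
      unfolding conj_class_def g(2)
      by (rule image_eqI[of _ _ "inv g"]) (use g(1) yz(1) in \<open>simp_all add: conj_by_inv(2)\<close>)
    ultimately have "conj_class G y \<subseteq> conj_class G z"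
      using conj_class_closed conj_class_subset by blast
    then show ?thesis using sub by blast
  qed
  have finM: "finite M" using Mc fin finite_subset by blast
  have "p dvd card (\<Union>?C)"
  proof (rule dvd_partition)
    show "finite (\<Union>?C)" using un finM by simp
    show "\<forall>c\<in>?C. p dvd card c" using dvd by auto
    show "\<forall>c1\<in>?C. \<forall>c2\<in>?C. c1 \<noteq> c2 \<longrightarrow> c1 \<inter> c2 = {}"
    proof (intro ballI impI)
      fix c1 c2 assume c: "c1 \<in> ?C" "c2 \<in> ?C" "c1 \<noteq> c2"
      then obtain y1 y2 where y: "y1 \<in> carrier G" "c1 = conj_class G y1"
        "y2 \<in> carrier G" "c2 = conj_class G y2" using Mc by blast
      have "c1 = c2" if z: "z \<in> c1" "z \<in> c2" for z
        using class_eq[of y1 z] class_eq[of y2 z] z y by simp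
      then show "c1 \<inter> c2 = {}" using c(3) by (meson disjoint_iff)
    qed
  qed
  then have 1: "p dvd card M - 1"
    using un finM normal_subgroup_mem(2)[OF M] by (simp add: card_Diff_singleton)
  obtain y where y: "y \<in> M" "y \<noteq> \<one>" using ne normal_subgroup_mem(2)[OF M] by blast
  have yc: "y \<in> carrier G" using y Mc by blast
  have "ord y dvd p" using exp[OF y(1)] pow_eq_id[OF yc] by blast
  then have "ord y = p" using p y ord_eq_1[OF yc] by (metis prime_nat_iff)
  moreover have "ord y dvd card M" using subgroup_pow_card[OF Msub y(1)] pow_eq_id[OF yc] by blast
  ultimately have 2: "p dvd card M" by simp
  have "card M > 0" using finM y by (auto simp: card_gt_0_iff)
  then have "p dvd 1" using 1 2 by (metis One_nat_def Suc_leI dvd_diffD1)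
  then show False using p by simp
qed

end

context group
begin

lemma quotient_hom:
  assumes L: "L \<lhd> G"
  shows "group_hom G (G Mod L) (\<lambda>x. L #> x)"
    and "(\<lambda>x. L #> x) ` carrier G = carrier (G Mod L)"
    and "x \<in> carrier G \<Longrightarrow> L #> x = \<one>\<^bsub>G Mod L\<^esub> \<longleftrightarrow> x \<in> L"
proof -
  interpret L: normal L G by fact
  show "group_hom G (G Mod L) (\<lambda>x. L #> x)"
    using L.r_coset_hom_Mod L.factorgroup_is_group is_group
    by (simp add: group_hom_def group_hom_axioms_def)
  show "(\<lambda>x. L #> x) ` carrier G = carrier (G Mod L)" by (simp add: carrier_FactGroup)
  show "L #> x = \<one>\<^bsub>G Mod L\<^esub> \<longleftrightarrow> x \<in> L" if "x \<in> carrier G"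
    using that coset_join1[of L x] coset_join2[of x L] L.is_subgroup L.subset by auto
qed

lemma centralizer_series_quotient:
  assumes L: "L \<lhd> G" and A: "A \<subseteq> carrier G" and g: "g \<in> carrier G"
  shows "L #> g \<in> centralizer_series (G Mod L) ((\<lambda>x. L #> x) ` A) {\<one>\<^bsub>G Mod L\<^esub>} k \<longleftrightarrow>
    g \<in> centralizer_series G A L k"
proof -
  interpret q: group_hom G "G Mod L" "\<lambda>x. L #> x" by (rule quotient_hom(1)[OF L])
  have "{x \<in> carrier G. L #> x \<in> {\<one>\<^bsub>G Mod L\<^esub>}} = L"
    using quotient_hom(3)[OF L] normal_subgroup_mem(1)[OF L] by auto
  then show ?thesis using q.centralizer_series_hom[OF A g] by simp
qed

lemma engel_commutator_quotient:
  assumes L: "L \<lhd> G" and x: "x \<in> carrier G" "y \<in> carrier G"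
  shows "engel_commutator (G Mod L) (L #> x) m (L #> y) = \<one>\<^bsub>G Mod L\<^esub> \<longleftrightarrow>
    engel_commutator G x m y \<in> L"
proof -
  interpret q: group_hom G "G Mod L" "\<lambda>x. L #> x" by (rule quotient_hom(1)[OF L])
  show ?thesis using q.hom_engel_commutator[OF x, of m]
      quotient_hom(3)[OF L, of "engel_commutator G x m y"] x by simp
qed

lemma left_engel_quotient:
  assumes L: "L \<lhd> G" and a: "a \<in> carrier G"
  shows "L #> a \<in> left_engel (G Mod L) \<longleftrightarrow>
    (\<forall>g\<in>carrier G. \<exists>m\<ge>1. engel_commutator G g m a \<in> L)"
  unfolding left_engel_def quotient_hom(2)[OF L, symmetric]
  using engel_commutator_quotient[OF L _ a] a by (simp del: mult_FactGroup one_FactGroup)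

lemma right_engel_quotient:
  assumes L: "L \<lhd> G" and a: "a \<in> carrier G"
  shows "L #> a \<in> right_engel (G Mod L) \<longleftrightarrow>
    (\<forall>g\<in>carrier G. \<exists>m\<ge>1. engel_commutator G a m g \<in> L)"
  unfolding right_engel_def quotient_hom(2)[OF L, symmetric]
  using engel_commutator_quotient[OF L a] a by (simp del: mult_FactGroup one_FactGroup)

text \<open>The class of the inverse consists of left Engel elements, which gives nilpotency. The Engel
condition then passes from the class to the subgroup that it generates.\<close>

lemma finite_right_engel_conj_class:
  assumes fin: "finite (carrier G)" and a: "a \<in> right_engel G"
  defines "N \<equiv> generate G (conj_class G a)"
  shows "N \<lhd> G" and "nilpotent_subset G N"
    and "n \<in> N \<Longrightarrow> x \<in> carrier G \<Longrightarrow> \<exists>j. engel_commutator G n j x = \<one>"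
proof -
  have ac: "a \<in> carrier G" using a by (simp add: right_engel_def)
  show N: "N \<lhd> G"
    unfolding N_def using ac by (intro generate_conj_closed_normal conj_class_closed)
  show nil: "nilpotent_subset G N"
    unfolding N_def
    using finite_left_engel_nilpotent[OF fin inv_right_engel_left_engel[OF a]]
      generate_conj_class_inv_subset[OF ac] by (rule nilpotent_subset_mono)
  assume n: "n \<in> N" and x: "x \<in> carrier G"
  obtain c where c: "N \<subseteq> centralizer_series G N {\<one>} c" using nil by (auto simp: nilpotent_subset_def)
  have ex: "\<forall>b\<in>conj_class G a. \<exists>m. engel_commutator G b m x = \<one>"
    using right_engel_conj[OF a] x by (auto simp: conj_class_def right_engel_def)
  obtain m where m: "\<forall>b\<in>conj_class G a. engel_commutator G b (m b) x = \<one>"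
    using bchoice[OF ex] by (rule exE)
  have "finite (conj_class G a)" using fin by (simp add: conj_class_def)
  then have "engel_commutator G b (Max (m ` conj_class G a)) x = \<one>" if "b \<in> conj_class G a" for b
    using engel_commutator_eventually[OF bspec[OF m that] _ x] that by simp
  then show "\<exists>j. engel_commutator G n j x = \<one>"
    using bounded_engel_on_nilpotent_normal[OF N c _ x _ n, of "conj_class G a"] N_def by blast
qed

text \<open>For a suitable prime \<open>p\<close>, the elements of order dividing \<open>p\<close> in the centre of the nilpotent normal
closure of \<open>a\<close> form a nontrivial normal subgroup, in which \<open>G\<close> has a nontrivial fixed point.\<close>

lemma finite_right_engel_center:
  assumes fin: "finite (carrier G)" and a: "a \<in> right_engel G" "a \<noteq> \<one>"
  shows "\<exists>z\<in>carrier G. z \<noteq> \<one> \<and> (\<forall>g\<in>carrier G. conj_by G z g = z)"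
proof -
  have ac: "a \<in> carrier G" using a by (simp add: right_engel_def)
  define N where "N = generate G (conj_class G a)"
  note NN = finite_right_engel_conj_class[OF fin a(1), folded N_def]
  note N = NN(1)
  have aN: "a \<in> N" using conj_class_closed(2)[OF ac] by (auto simp: N_def intro: generate.incl)
  let ?Z = "centralizer_series G N {\<one>}"
  have nZ: "?Z k \<lhd> G" for k
    by (intro centralizer_series_normal normal_conj_closed N one_is_normal)
  obtain c where c: "N \<subseteq> ?Z c" using NN(2) by (auto simp: nilpotent_subset_def)
  then have "\<exists>i. \<not> N \<inter> ?Z i \<subseteq> {\<one>}" using aN a(2) by blast
  then obtain i where i: "\<not> N \<inter> ?Z i \<subseteq> {\<one>}" and least: "\<And>j. j < i \<Longrightarrow> N \<inter> ?Z j \<subseteq> {\<one>}"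
    using exists_least_iff[of "\<lambda>i. \<not> N \<inter> ?Z i \<subseteq> {\<one>}"] by blast
  have "i \<noteq> 0" using i by auto
  then obtain j where j: "i = Suc j" by (metis not0_implies_Suc)
  obtain n0 where n0: "n0 \<in> N" "n0 \<in> ?Z i" "n0 \<noteq> \<one>" using i by blast
  define Z where "Z = N \<inter> ?Z 1"
  have Nc: "N \<subseteq> carrier G" using normal_subgroup_mem(1)[OF N] .
  have comm: "y \<otimes> z = z \<otimes> y" if "y \<in> Z" "z \<in> Z" for y z
    using that Nc commutator_eq_one_iff[of y z] by (auto simp: Z_def centralizer_mod_def)
  have n0Z: "n0 \<in> Z"
  proof -
    have "group_commutator G n0 y \<in> N \<inter> ?Z j" if "y \<in> N" for y
      using n0 that normal_commutator_left[OF N] Nc by (auto simp: j centralizer_mod_def)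
    then show ?thesis using least[of j] j n0 Nc by (auto simp: Z_def centralizer_mod_def)
  qed
  have Z: "Z \<lhd> G"
    unfolding Z_def
    using normal_subgroup_intersect[OF N nZ] .
  have Zc: "Z \<subseteq> carrier G" using normal_subgroup_mem(1)[OF Z] .
  have n0c: "n0 \<in> carrier G" using n0Z Zc by blast
  have "ord n0 \<noteq> 1" using n0 ord_eq_1[OF n0c] by simp
  then obtain p where p: "prime p" "p dvd ord n0" using prime_factor_nat by blast
  define M where "M = {y \<in> Z. y [^] p = \<one>}"
  have pow_conj: "conj_by G y h [^] k = conj_by G (y [^] k) h"
    if "y \<in> carrier G" "h \<in> carrier G" for y h and k :: nat
    by (induction k) (use that in \<open>auto simp: conj_by_mult\<close>)
  have M: "M \<lhd> G"
  proof (rule subgroup_conj_closed_normal)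
    show "subgroup M G"
    proof (rule subgroupI)
      show "M \<subseteq> carrier G" using Zc by (auto simp: M_def)
      show "M \<noteq> {}" using normal_subgroup_mem(2)[OF Z] by (auto simp: M_def)
      show "inv y \<in> M" if "y \<in> M" for y
        using that Zc normal_subgroup_mem(4)[OF Z] nat_pow_inv[of y p] by (auto simp: M_def)
      show "y \<otimes> z \<in> M" if "y \<in> M" "z \<in> M" for y z
        using that Zc normal_subgroup_mem(3)[OF Z] pow_mult_distrib[OF comm, of y z p]
        by (auto simp: M_def subset_iff)
    qed
    show "conj_closed G M"
      using Zc normal_conj_by[OF Z] pow_conj by (auto simp: conj_closed_def M_def subset_iff)
  qed
  obtain k where k: "ord n0 = p * k" using p(2) by (auto simp: dvd_def)
  have kp: "\<not> ord n0 dvd k"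
  proof
    assume "ord n0 dvd k"
    moreover have "ord n0 > 0" using fin n0c ord_ge_1[of n0] by simp
    then have "k > 0" using k by simp
    ultimately have "p * k \<le> k" using k dvd_imp_le by metis
    then show False using \<open>k > 0\<close> p(1) prime_gt_1_nat[of p] by simp
  qed
  have "n0 [^] k \<in> Z"
    by (induction k) (use n0Z normal_subgroup_mem(2,3)[OF Z] in auto)
  moreover have "(n0 [^] k) [^] p = \<one>"
    using k n0c pow_ord_eq_1[OF n0c] by (simp add: nat_pow_pow mult.commute)
  ultimately have "n0 [^] k \<in> M" by (simp add: M_def)
  moreover have "n0 [^] k \<noteq> \<one>" using kp pow_eq_id[OF n0c] by simp
  ultimately have "M \<noteq> {\<one>}" by blast
  moreover have "\<exists>j. engel_commutator G y j x = \<one>" if "y \<in> M" "x \<in> carrier G" for y x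
    using that NN(3) by (auto simp: M_def Z_def)
  ultimately have "\<exists>z\<in>M. z \<noteq> \<one> \<and> (\<forall>g\<in>carrier G. conj_by G z g = z)"
    by (intro engel_action_fixed_point[OF fin M _ p(1)]) (auto simp: M_def)
  then show ?thesis using Zc by (auto simp: M_def)
qed

text \<open>The upper central series becomes stationary at some term \<open>L\<close>. Then \<open>G/L\<close> has trivial centre and thus
no right Engel elements apart from the identity.\<close>

theorem finite_right_engel_hypercentral:
  assumes fin: "finite (carrier G)"
  shows "\<exists>k. right_engel G \<subseteq> centralizer_series G (carrier G) {\<one>} k"
proof -
  let ?Z = "centralizer_series G (carrier G) {\<one>}"
  have nZ: "?Z k \<lhd> G" for k
    by (intro centralizer_series_normal carrier_conj_closed one_is_normal)
  have "\<exists>k. ?Z (Suc k) \<subseteq> ?Z k"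
  proof (rule ccontr)
    assume contra: "\<nexists>k. ?Z (Suc k) \<subseteq> ?Z k"
    have fZ: "finite (?Z k)" for k using normal_subgroup_mem(1)[OF nZ] fin finite_subset by blast
    have "card (?Z k) \<ge> k" for k
    proof (induction k)
      case (Suc k)
      have "?Z k \<subset> ?Z (Suc k)"
        using centralizer_series_increasing[OF carrier_conj_closed one_is_normal, of k "Suc k"] contra
        by auto
      then have "card (?Z k) < card (?Z (Suc k))" by (rule psubset_card_mono[OF fZ])
      then show ?case using Suc by simp
    qed simp
    moreover have "card (?Z k) \<le> card (carrier G)" for k
      using normal_subgroup_mem(1)[OF nZ] fin card_mono by blast
    ultimately show False by (metis Suc_n_not_le_n order_trans)
  qed
  then obtain k where k: "?Z (Suc k) \<subseteq> ?Z k" by blast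
  define L where "L = ?Z k"
  have L: "L \<lhd> G" using nZ by (simp add: L_def)
  interpret q: group_hom G "G Mod L" "\<lambda>x. L #> x" by (rule quotient_hom(1)[OF L])
  have "a \<in> L" if a: "a \<in> right_engel G" for a
  proof (rule ccontr)
    assume "a \<notin> L"
    have ac: "a \<in> carrier G" using a by (simp add: right_engel_def)
    have "\<one> \<in> L" using normal_subgroup_mem(2)[OF L] .
    then have "L #> a \<in> right_engel (G Mod L)"
      unfolding right_engel_quotient[OF L ac]
      using a unfolding right_engel_def mem_Collect_eq by metis
    moreover have "L #> a \<noteq> \<one>\<^bsub>G Mod L\<^esub>" using quotient_hom(3)[OF L ac] \<open>a \<notin> L\<close> by simp
    moreover have "finite (carrier (G Mod L))"
      using fin quotient_hom(2)[OF L] finite_imageI by metis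
    ultimately have "\<exists>Y\<in>carrier (G Mod L). Y \<noteq> \<one>\<^bsub>G Mod L\<^esub> \<and>
        (\<forall>g\<in>carrier (G Mod L). conj_by (G Mod L) Y g = Y)"
      by (intro q.H.finite_right_engel_center)
    then obtain Y where Y: "Y \<in> carrier (G Mod L)" "Y \<noteq> \<one>\<^bsub>G Mod L\<^esub>"
      "\<forall>g\<in>carrier (G Mod L). conj_by (G Mod L) Y g = Y"
      by (elim bexE conjE)
    obtain y where y: "y \<in> carrier G" "Y = L #> y" using Y(1) quotient_hom(2)[OF L] by blast
    have "group_commutator G y g \<in> L" if g: "g \<in> carrier G" for g
    proof -
      have "L #> g \<in> carrier (G Mod L)" using g quotient_hom(2)[OF L] by blast
      then have "group_commutator (G Mod L) Y (L #> g) = \<one>\<^bsub>G Mod L\<^esub>"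
        using Y(1,3) by (simp add: group_commutator_def del: mult_FactGroup one_FactGroup)
      then show ?thesis
        using q.hom_commutator[OF y(1) g] quotient_hom(3)[OF L, of "group_commutator G y g"] y g
        by simp
    qed
    then have "y \<in> ?Z (Suc k)" using y(1) by (simp add: L_def centralizer_mod_def)
    then have "y \<in> L" using k by (auto simp: L_def)
    then show False using Y(2) y quotient_hom(3)[OF L y(1)] by simp
  qed
  then show ?thesis unfolding L_def by blast
qed

end


section \<open>\<open>FC\<^sup>n\<close>-conditions modulo a normal subgroup\<close>

text \<open>For normal \<open>K\<close>, this says that \<open>G/K\<close> is an \<open>FC\<^sup>n\<close>-group. The definition follows the recursion for
\<open>FC\<^sup>n\<close>-groups through the preimages in \<open>G\<close> of the centralizers, so all quotients involved are
quotients of the one group \<open>G\<close>. The centralizer of a conjugacy class equals that of the normal closure that it generates.\<close>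

primrec fc_mod :: "('a, 'm) monoid_scheme \<Rightarrow> nat \<Rightarrow> 'a set \<Rightarrow> bool" where
  "fc_mod G 0 K \<longleftrightarrow> finite ((\<lambda>g. K #>\<^bsub>G\<^esub> g) ` carrier G)"
| "fc_mod G (Suc n) K \<longleftrightarrow> (\<forall>x\<in>carrier G. fc_mod G n (centralizer_mod G (conj_class G x) K))"

text \<open>A substitute for right Engel elements that is visibly closed under commutation with arbitrary
elements of \<open>G\<close>.\<close>

definition locally_hypercentral :: "('a, 'm) monoid_scheme \<Rightarrow> 'a set" where
  "locally_hypercentral G = {a \<in> carrier G. \<forall>X. finite X \<and> X \<subseteq> carrier G \<longrightarrow>
     (\<exists>k. a \<in> centralizer_series G (generate G (insert a X)) {\<one>\<^bsub>G\<^esub>} k)}"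

text \<open>The element \<open>a\<close> lowers the level of an \<open>FC\<close>-condition by \<open>i\<close> on passing to the centralizer of its class.
All normal subgroups \<open>K\<close> are admitted, because the conditions for two elements are applied one after
the other.\<close>

definition fc_weight :: "('a, 'm) monoid_scheme \<Rightarrow> nat \<Rightarrow> 'a \<Rightarrow> bool" where
  "fc_weight G i a \<longleftrightarrow> (\<forall>n K. K \<lhd> G \<longrightarrow> fc_mod G (n + i) K \<longrightarrow>
     fc_mod G n (centralizer_mod G (conj_class G a) K))"

context group
begin

lemma centralizer_mod_class_normal:
  "x \<in> carrier G \<Longrightarrow> K \<lhd> G \<Longrightarrow> centralizer_mod G (conj_class G x) K \<lhd> G"
  by (intro centralizer_mod_normal conj_class_closed)

text \<open>At level \<open>0\<close> every coset of \<open>L\<close> is a union of cosets of \<open>K\<close>, and it is determined by any of them.\<close>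

lemma fc_mod_mono:
  assumes "K \<lhd> G" "L \<lhd> G" "K \<subseteq> L" "fc_mod G n K"
  shows "fc_mod G n L"
  using assms
proof (induction n arbitrary: K L)
  case 0
  have K: "subgroup K G" and L: "subgroup L G" using 0 normal_imp_subgroup by auto
  have "L #> g = (\<Union>h\<in>K #> g. L #> h)" if g: "g \<in> carrier G" for g
  proof -
    have "L #> h = L #> g" if "h \<in> K #> g" for h
      using repr_independence[OF _ g L, of h] that \<open>K \<subseteq> L\<close> by (auto simp: r_coset_def)
    then show ?thesis using rcos_self[OF g K] by blast
  qed
  then have "(\<lambda>g. L #> g) ` carrier G = (\<lambda>X. \<Union>h\<in>X. L #> h) ` (\<lambda>g. K #> g) ` carrier G"
    by (simp add: image_image)
  then show ?case using 0 by simp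
next
  case (Suc n)
  have "fc_mod G n (centralizer_mod G (conj_class G x) L)" if x: "x \<in> carrier G" for x
    by (rule Suc.IH[of "centralizer_mod G (conj_class G x) K"])
      (use Suc.prems x centralizer_mod_class_normal centralizer_mod_mono[OF order_refl, of K L] in simp_all)
  then show ?case by simp
qed

lemma fc_mod_Int:
  assumes "K \<subseteq> carrier G" "L \<subseteq> carrier G" "fc_mod G n K" "fc_mod G n L"
  shows "fc_mod G n (K \<inter> L)"
  using assms
proof (induction n arbitrary: K L)
  case 0
  have "(K \<inter> L) #> g = (K #> g) \<inter> (L #> g)" if g: "g \<in> carrier G" for g
    using g 0(1,2) by (auto simp: r_coset_def subset_iff)
  then have "(\<lambda>g. (K \<inter> L) #> g) ` carrier G \<subseteq>
      (\<lambda>(X, Y). X \<inter> Y) ` ((\<lambda>g. K #> g) ` carrier G \<times> (\<lambda>g. L #> g) ` carrier G)"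
    by auto
  moreover have "finite ((\<lambda>(X, Y). X \<inter> Y) ` ((\<lambda>g. K #> g) ` carrier G \<times> (\<lambda>g. L #> g) ` carrier G))"
    using 0 by simp
  ultimately show ?case using finite_subset by auto
next
  case (Suc n)
  have "centralizer_mod G A (K \<inter> L) = centralizer_mod G A K \<inter> centralizer_mod G A L" for A
    by (auto simp: centralizer_mod_def)
  then show ?case using Suc by (simp add: centralizer_mod_carrier)
qed

lemma subgroup_Int_normal:
  assumes H: "subgroup H G" and K: "K \<lhd> G"
  shows "H \<inter> K \<lhd> G\<lparr>carrier := H\<rparr>"
proof -
  interpret H: group "G\<lparr>carrier := H\<rparr>" using H subgroup_imp_group by blast
  have Ks: "subgroup K G" using K normal_imp_subgroup by blast
  have "subgroup (H \<inter> K) (G\<lparr>carrier := H\<rparr>)"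
    by (rule subgroup_incl[OF subgroups_Inter_pair[OF H Ks] H]) simp
  moreover have "conj_closed (G\<lparr>carrier := H\<rparr>) (H \<inter> K)"
    using subgroup_commutator_eq(1)[OF H] subgroup_commutator_mem(1)[OF H] normal_conj_by[OF K]
      subgroup.subset[OF H]
    by (auto simp: conj_closed_def subset_iff)
  ultimately show ?thesis using H.subgroup_conj_closed_normal by blast
qed

lemma fc_mod_subgroup:
  assumes H: "subgroup H G"
  shows "K \<lhd> G \<Longrightarrow> fc_mod G n K \<Longrightarrow> fc_mod (G\<lparr>carrier := H\<rparr>) n (H \<inter> K)"
proof (induction n arbitrary: K)
  case 0
  have Hc: "H \<subseteq> carrier G" using H subgroup.subset by blast
  have "(H \<inter> K) #>\<^bsub>G\<lparr>carrier := H\<rparr>\<^esub> h = H \<inter> (K #> h)" if h: "h \<in> H" for h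
  proof -
    have "k \<in> H" if "k \<in> K" "k \<otimes> h \<in> H" for k
    proof -
      have kc: "k \<in> carrier G" using that normal_subgroup_mem(1)[OF 0(1)] by blast
      have "(k \<otimes> h) \<otimes> inv h \<in> H"
        using that h subgroup.m_closed[OF H] subgroup.m_inv_closed[OF H] by blast
      then show ?thesis using kc h Hc by (simp add: m_assoc subset_iff)
    qed
    then show ?thesis using h subgroup.m_closed[OF H] by (auto simp: r_coset_def)
  qed
  then have "(\<lambda>h. (H \<inter> K) #>\<^bsub>G\<lparr>carrier := H\<rparr>\<^esub> h) ` H = (\<lambda>X. H \<inter> X) ` (\<lambda>g. K #> g) ` H"
    unfolding image_image by (rule image_cong[OF refl])
  moreover have "(\<lambda>g. K #> g) ` H \<subseteq> (\<lambda>g. K #> g) ` carrier G" using Hc by (rule image_mono)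
  ultimately show ?case using 0(2) by (simp add: finite_subset)
next
  case (Suc n)
  interpret H: group "G\<lparr>carrier := H\<rparr>" using H subgroup_imp_group by blast
  have Hc: "H \<subseteq> carrier G" using H subgroup.subset by blast
  have "fc_mod (G\<lparr>carrier := H\<rparr>) n
      (centralizer_mod (G\<lparr>carrier := H\<rparr>) (conj_class (G\<lparr>carrier := H\<rparr>) x) (H \<inter> K))"
    if x: "x \<in> H" for x
  proof (rule H.fc_mod_mono)
    let ?C = "centralizer_mod G (conj_class G x) K"
    have xc: "x \<in> carrier G" using x Hc by blast
    have C: "?C \<lhd> G" using centralizer_mod_class_normal[OF xc Suc.prems(1)] .
    show "H \<inter> ?C \<lhd> G\<lparr>carrier := H\<rparr>" using subgroup_Int_normal[OF H C] .
    show "centralizer_mod (G\<lparr>carrier := H\<rparr>) (conj_class (G\<lparr>carrier := H\<rparr>) x) (H \<inter> K)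
        \<lhd> G\<lparr>carrier := H\<rparr>"
      using H.centralizer_mod_class_normal[OF _ subgroup_Int_normal[OF H Suc.prems(1)], of x] x by simp
    have "conj_class (G\<lparr>carrier := H\<rparr>) x \<subseteq> conj_class G x \<inter> H"
      using x Hc subgroup_commutator_eq(1)[OF H] subgroup_commutator_mem(1)[OF H]
      by (auto simp: conj_class_def)
    then show "H \<inter> ?C \<subseteq>
        centralizer_mod (G\<lparr>carrier := H\<rparr>) (conj_class (G\<lparr>carrier := H\<rparr>) x) (H \<inter> K)"
      using subgroup_commutator_eq(2)[OF H] subgroup_commutator_mem(2)[OF H]
      by (auto simp: centralizer_mod_def subset_iff)
    show "fc_mod (G\<lparr>carrier := H\<rparr>) n (H \<inter> ?C)"
      using Suc.prems xc by (intro Suc.IH C) simp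
  qed
  then show ?case by simp
qed

text \<open>In the step, the preimage \<open>C\<close> of the centralizer in \<open>G/K\<close> satisfies \<open>G/C \<cong> (G/K)/(C/K)\<close>, so that the
induction hypothesis applies to \<open>C\<close>.\<close>

lemma fc_group_Mod_imp_fc_mod:
  "K \<lhd> G \<Longrightarrow> fc_group n (G Mod K) \<Longrightarrow> fc_mod G n K"
proof (induction n arbitrary: K)
  case 0
  then show ?case by (simp add: carrier_FactGroup)
next
  case (Suc n)
  note K = Suc.prems(1)
  let ?Q = "G Mod K"
  interpret q: group_hom G ?Q "\<lambda>x. K #> x" by (rule quotient_hom(1)[OF K])
  have "fc_mod G n (centralizer_mod G (conj_class G x) K)" if x: "x \<in> carrier G" for x
  proof -
    \<comment> \<open>\<open>C'\<close> is the centralizer prescribed by the recursion in \<open>G/K\<close>, and \<open>C\<close> below is its preimage in \<open>G\<close>.\<close>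
    define X where "X = K #> x"
    have X: "X \<in> carrier ?Q" using x quotient_hom(2)[OF K] by (auto simp: X_def)
    define C' where "C' = centralizer ?Q (normal_closure ?Q X)"
    have C': "C' \<lhd> ?Q"
      unfolding C'_def using X by (intro q.H.centralizer_normal q.H.normal_closure_normal)
    have fc: "fc_group n (?Q Mod C')"
      using Suc.prems(2) X fc_group_Suc_iff[OF q.H.is_group, of n] unfolding C'_def by blast
    define h where "h = (\<lambda>Y. C' #>\<^bsub>?Q\<^esub> Y) \<circ> (\<lambda>g. K #> g)"
    interpret r: group_hom ?Q "?Q Mod C'" "\<lambda>Y. C' #>\<^bsub>?Q\<^esub> Y" by (rule q.H.quotient_hom(1)[OF C'])
    interpret h: group_hom G "?Q Mod C'" h
      unfolding h_def using Group.hom_compose[OF q.homh r.homh] is_group r.H.is_group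
      by (simp add: group_hom_def group_hom_axioms_def)
    define C where "C = kernel G (?Q Mod C') h"
    have C_iff: "g \<in> C \<longleftrightarrow> g \<in> carrier G \<and> K #> g \<in> C'" for g
      unfolding C_def kernel_def h_def
      using q.H.quotient_hom(3)[OF C', of "K #> g"] q.hom_closed[of g]
      by (auto simp del: one_FactGroup)
    have C: "C \<lhd> G" unfolding C_def by (rule h.normal_kernel)
    have "h ` carrier G = carrier (?Q Mod C')"
      unfolding h_def image_comp[symmetric] quotient_hom(2)[OF K] q.H.quotient_hom(2)[OF C'] ..
    then have "G Mod C \<cong> ?Q Mod C'" unfolding C_def by (rule h.FactGroup_iso)
    then have "?Q Mod C' \<cong> G Mod C"
      using group.iso_sym normal.factorgroup_is_group[OF C] by blast
    then have "fc_group n (G Mod C)"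
      using fc_group_iso[OF r.H.is_group normal.factorgroup_is_group[OF C]] fc by blast
    then have fcC: "fc_mod G n C" using Suc.IH[OF C] by blast
    have "X \<in> normal_closure ?Q X" by (auto simp: normal_closure_def intro: generate.incl)
    then have class_X: "conj_class ?Q X \<subseteq> normal_closure ?Q X"
      using q.H.conj_class_subset q.H.normal_conj_closed q.H.normal_closure_normal[OF X] by blast
    have "C \<subseteq> centralizer_mod G (conj_class G x) K"
    proof
      fix g assume "g \<in> C"
      then have g: "g \<in> carrier G" and gC: "K #> g \<in> C'" using C_iff by auto
      have "group_commutator G g y \<in> K" if y: "y \<in> conj_class G x" for y
      proof -
        have yc: "y \<in> carrier G" using y x by (auto simp: conj_class_def)
        have "K #> y \<in> conj_class ?Q X"
          using y x q.hom_conj_by by (auto simp: conj_class_def X_def)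
        then have "(K #> g) \<otimes>\<^bsub>?Q\<^esub> (K #> y) = (K #> y) \<otimes>\<^bsub>?Q\<^esub> (K #> g)"
          using gC class_X unfolding C'_def centralizer_def by blast
        then have "group_commutator ?Q (K #> g) (K #> y) = \<one>\<^bsub>?Q\<^esub>"
          using q.H.commutator_eq_one_iff q.hom_closed g yc by blast
        then show ?thesis
          using q.hom_commutator[OF g yc] quotient_hom(3)[OF K, of "group_commutator G g y"] g yc
          by simp
      qed
      then show "g \<in> centralizer_mod G (conj_class G x) K" using g by (simp add: centralizer_mod_def)
    qed
    then show ?thesis
      using fc_mod_mono[OF C centralizer_mod_class_normal[OF x K]] fcC by blast
  qed
  then show ?case by simp
qed

lemma nilpotent_normal_series:
  assumes N: "N \<lhd> G" and c: "N \<subseteq> centralizer_series G N {\<one>} c"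
  shows "centralizer_series G N {\<one>} (Suc c) = carrier G"
  using c normal_commutator_right[OF N] by (auto simp: centralizer_mod_def)

text \<open>In the step, \<open>a\<close> is left Engel modulo the centralizer \<open>C\<close> of its class modulo \<open>K\<close>, and \<open>C\<close> is the term of
index \<open>1\<close> of the series over \<open>K\<close>. So the series over \<open>K\<close> is one step longer than the one over \<open>C\<close>.\<close>

lemma fc_left_engel_series:
  assumes a: "a \<in> carrier G"
  shows "K \<lhd> G \<Longrightarrow> fc_mod G n K \<Longrightarrow> \<forall>g\<in>carrier G. \<exists>m\<ge>1. engel_commutator G g m a \<in> K \<Longrightarrow>
    \<exists>k. centralizer_series G (conj_class G a) K k = carrier G"
proof (induction n arbitrary: K)
  case 0
  note K = 0(1)
  let ?Q = "G Mod K"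
  interpret q: group_hom G ?Q "\<lambda>x. K #> x" by (rule quotient_hom(1)[OF K])
  have fin: "finite (carrier ?Q)" using 0(2) by (simp add: carrier_FactGroup)
  have La: "K #> a \<in> left_engel ?Q" using left_engel_quotient[OF K a] 0(3) by blast
  let ?N = "generate ?Q (conj_class ?Q (K #> a))"
  have Ka: "K #> a \<in> carrier ?Q" using q.hom_closed[OF a] .
  have N: "?N \<lhd> ?Q" using Ka by (intro q.H.generate_conj_closed_normal q.H.conj_class_closed)
  obtain c where "?N \<subseteq> centralizer_series ?Q ?N {\<one>\<^bsub>?Q\<^esub>} c"
    using q.H.finite_left_engel_nilpotent[OF fin La] unfolding nilpotent_subset_def by blast
  then have "carrier ?Q = centralizer_series ?Q ?N {\<one>\<^bsub>?Q\<^esub>} (Suc c)"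
    using q.H.nilpotent_normal_series[OF N] by blast
  also have "\<dots> \<subseteq> centralizer_series ?Q (conj_class ?Q (K #> a)) {\<one>\<^bsub>?Q\<^esub>} (Suc c)"
    by (rule centralizer_series_mono) (auto intro: generate.incl)
  also have "conj_class ?Q (K #> a) = (\<lambda>x. K #> x) ` conj_class G a"
    unfolding conj_class_def quotient_hom(2)[OF K, symmetric] image_image
    using q.hom_conj_by[OF a] by simp
  finally have top: "carrier ?Q \<subseteq> centralizer_series ?Q ((\<lambda>x. K #> x) ` conj_class G a) {\<one>\<^bsub>?Q\<^esub>} (Suc c)" .
  have "conj_class G a \<subseteq> carrier G" using conj_class_closed(1)[OF a] by (simp add: conj_closed_def)
  note pre = centralizer_series_quotient[OF K this]
  have "g \<in> centralizer_series G (conj_class G a) K (Suc c)" if g: "g \<in> carrier G" for g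
    using subsetD[OF top q.hom_closed[OF g]] unfolding pre[OF g] .
  then have "centralizer_series G (conj_class G a) K (Suc c) = carrier G"
    using centralizer_mod_carrier[of G] by auto
  then show ?case by blast
next
  case (Suc n)
  let ?C = "centralizer_mod G (conj_class G a) K"
  have C: "?C \<lhd> G" using centralizer_mod_class_normal[OF a Suc.prems(1)] .
  have "K \<subseteq> ?C"
    using centralizer_mod_extends[OF _ Suc.prems(1)] conj_class_closed(1)[OF a]
    by (simp add: conj_closed_def)
  then have "\<forall>g\<in>carrier G. \<exists>m\<ge>1. engel_commutator G g m a \<in> ?C"
    using Suc.prems(3) by blast
  then obtain k where "centralizer_series G (conj_class G a) ?C k = carrier G"
    using Suc.IH[OF C] Suc.prems(2) a by auto
  then have "centralizer_series G (conj_class G a) K (1 + k) = carrier G"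
    using centralizer_series_add[of G "conj_class G a" K 1 k] by simp
  then show ?case by blast
qed

lemma fc_mod_carrier: "fc_mod G n (carrier G)"
proof (induction n)
  case 0
  have "(\<lambda>g. carrier G #> g) ` carrier G = {carrier G}"
    using coset_join2[OF _ subgroup_self] by auto
  then show ?case by simp
next
  case (Suc n)
  have "centralizer_mod G (conj_class G x) (carrier G) = carrier G" if "x \<in> carrier G" for x
    using conj_class_closed(1)[OF that] by (auto simp: centralizer_mod_def conj_closed_def)
  then show ?case using Suc by simp
qed

text \<open>Modulo \<open>K\<close>, the centre is the intersection of the centralizers of the finitely many generators. Therefore
each passage to the centre lowers the level by one.\<close>

lemma fc_mod_finitely_generated:
  assumes X: "finite X" "X \<subseteq> carrier G" "generate G X = carrier G"
  shows "K \<lhd> G \<Longrightarrow> fc_mod G n K \<Longrightarrow> fc_mod G 0 (centralizer_series G (carrier G) K n)"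
proof (induction n arbitrary: K)
  case (Suc n)
  note K = Suc.prems(1)
  let ?A = "\<lambda>Y. \<Union>y\<in>Y. conj_class G y"
  have A: "conj_closed G (?A Y)" if "Y \<subseteq> carrier G" for Y
    using that conj_class_closed(1) unfolding conj_closed_def by blast
  have "fc_mod G n (centralizer_mod G (?A Y) K)" if "finite Y" "Y \<subseteq> carrier G" for Y
    using that
  proof (induction Y)
    case empty
    have "centralizer_mod G {} K = carrier G" by (auto simp: centralizer_mod_def)
    then show ?case using fc_mod_carrier by simp
  next
    case (insert y Y)
    have "centralizer_mod G (?A (insert y Y)) K =
        centralizer_mod G (conj_class G y) K \<inter> centralizer_mod G (?A Y) K"
      by (auto simp: centralizer_mod_def)
    then show ?case
      using fc_mod_Int[OF centralizer_mod_carrier centralizer_mod_carrier] insert Suc.prems by simp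
  qed
  then have "fc_mod G n (centralizer_mod G (?A X) K)" using X by blast
  moreover have "centralizer_mod G (?A X) K \<subseteq> centralizer_mod G (carrier G) K"
  proof -
    have "X \<subseteq> ?A X" using conj_class_closed(2) X(2) by blast
    then have "centralizer_mod G (?A X) K \<subseteq> centralizer_mod G X K"
      by (intro centralizer_mod_mono) auto
    then show ?thesis using centralizer_mod_generate[OF X(2) K] X(3) by simp
  qed
  ultimately have "fc_mod G n (centralizer_mod G (carrier G) K)"
    using fc_mod_mono[OF centralizer_mod_normal[OF A[OF X(2)] K]
        centralizer_mod_normal[OF carrier_conj_closed K]] by blast
  from Suc.IH[OF centralizer_mod_normal[OF carrier_conj_closed K] this]
  show ?case using centralizer_series_add[of G "carrier G" K 1 n] by simp
qed simp

lemma fc_finitely_generated_right_engel: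
  assumes X: "finite X" "X \<subseteq> carrier G" "generate G X = carrier G" and fc: "fc_mod G n {\<one>}"
    and a: "a \<in> right_engel G"
  shows "\<exists>k. a \<in> centralizer_series G (carrier G) {\<one>} k"
proof -
  let ?L = "centralizer_series G (carrier G) {\<one>} n"
  have ac: "a \<in> carrier G" using a by (simp add: right_engel_def)
  have L: "?L \<lhd> G" by (intro centralizer_series_normal carrier_conj_closed one_is_normal)
  interpret q: group_hom G "G Mod ?L" "\<lambda>x. ?L #> x" by (rule quotient_hom(1)[OF L])
  have "finite (carrier (G Mod ?L))"
    using fc_mod_finitely_generated[OF X one_is_normal fc] by (simp add: carrier_FactGroup)
  moreover have "?L #> a \<in> right_engel (G Mod ?L)"
    unfolding right_engel_quotient[OF L ac]
    using a normal_subgroup_mem(2)[OF L] unfolding right_engel_def mem_Collect_eq by metis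
  ultimately obtain k where
    "?L #> a \<in> centralizer_series (G Mod ?L) (carrier (G Mod ?L)) {\<one>\<^bsub>G Mod ?L\<^esub>} k"
    using q.H.finite_right_engel_hypercentral by blast
  then have "a \<in> centralizer_series G (carrier G) ?L k"
    using centralizer_series_quotient[OF L order_refl ac] quotient_hom(2)[OF L] by simp
  then show ?thesis unfolding centralizer_series_add by blast
qed

text \<open>A finitely generated subgroup \<open>H\<close> inherits the \<open>FC\<close>-condition, and is thus finite modulo a term of its
upper central series. There the right Engel elements are hypercentral.\<close>

lemma fc_right_engel_locally_hypercentral:
  assumes fc: "fc_mod G n {\<one>}"
  shows "right_engel G \<subseteq> locally_hypercentral G"
proof
  fix a assume a: "a \<in> right_engel G"
  have ac: "a \<in> carrier G" using a by (simp add: right_engel_def)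
  have "\<exists>k. a \<in> centralizer_series G (generate G (insert a X)) {\<one>} k"
    if X: "finite X" "X \<subseteq> carrier G" for X
  proof -
    let ?H = "generate G (insert a X)"
    have H: "subgroup ?H G" using X ac by (intro generate_is_subgroup) auto
    have XH: "insert a X \<subseteq> ?H" by (auto intro: generate.incl)
    interpret H: group "G\<lparr>carrier := ?H\<rparr>" using H subgroup_imp_group by blast
    have one: "?H \<inter> {\<one>} = {\<one>}" using subgroup.one_closed[OF H] by auto
    have "\<exists>k. a \<in> centralizer_series (G\<lparr>carrier := ?H\<rparr>) (carrier (G\<lparr>carrier := ?H\<rparr>))
        {\<one>\<^bsub>G\<lparr>carrier := ?H\<rparr>\<^esub>} k"
    proof (rule H.fc_finitely_generated_right_engel)
      show "finite (insert a X)" "insert a X \<subseteq> carrier (G\<lparr>carrier := ?H\<rparr>)" using X XH by simp_all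
      show "generate (G\<lparr>carrier := ?H\<rparr>) (insert a X) = carrier (G\<lparr>carrier := ?H\<rparr>)"
        using generate_consistent[OF XH H] by simp
      show "fc_mod (G\<lparr>carrier := ?H\<rparr>) n {\<one>\<^bsub>G\<lparr>carrier := ?H\<rparr>\<^esub>}"
        using fc_mod_subgroup[OF H one_is_normal fc] one by simp
      show "a \<in> right_engel (G\<lparr>carrier := ?H\<rparr>)"
        using a XH subgroup.subset[OF H] subgroup_engel_commutator_eq[OF H]
        by (auto simp: right_engel_def subset_iff)
    qed
    then show ?thesis using centralizer_series_subgroup[OF H order_refl, of "{\<one>}"] one by auto
  qed
  then show "a \<in> locally_hypercentral G" using ac by (simp add: locally_hypercentral_def)
qed

lemma locally_hypercentral_commutator:
  assumes a: "a \<in> locally_hypercentral G" and g: "g \<in> carrier G"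
  shows "group_commutator G a g \<in> locally_hypercentral G"
proof -
  have ac: "a \<in> carrier G" using a by (simp add: locally_hypercentral_def)
  let ?b = "group_commutator G a g"
  have "\<exists>k. ?b \<in> centralizer_series G (generate G (insert ?b X)) {\<one>} k"
    if X: "finite X" "X \<subseteq> carrier G" for X
  proof -
    let ?H = "generate G (insert a (insert g X))"
    obtain k where k: "a \<in> centralizer_series G ?H {\<one>} k"
      using a X g by (auto simp: locally_hypercentral_def dest: spec[of _ "insert g X"])
    have H: "subgroup ?H G" using X ac g by (intro generate_is_subgroup) auto
    have XH: "insert a (insert g X) \<subseteq> ?H" by (auto intro: generate.incl)
    interpret H: group "G\<lparr>carrier := ?H\<rparr>" using H subgroup_imp_group by blast
    have one: "?H \<inter> {\<one>} = {\<one>}" using subgroup.one_closed[OF H] by auto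
    let ?Z = "centralizer_series (G\<lparr>carrier := ?H\<rparr>) ?H {\<one>} k"
    have Z: "?Z = ?H \<inter> centralizer_series G ?H {\<one>} k"
      using centralizer_series_subgroup[OF H order_refl, of "{\<one>}" k] one by simp
    have "?Z \<lhd> G\<lparr>carrier := ?H\<rparr>"
      using H.centralizer_series_normal[OF H.carrier_conj_closed H.one_is_normal, of k] by simp
    then have "group_commutator (G\<lparr>carrier := ?H\<rparr>) a g \<in> ?Z"
      using k XH Z by (intro H.normal_commutator_left) auto
    then have "?b \<in> centralizer_series G ?H {\<one>} k"
      using subgroup_commutator_eq(2)[OF H, of a g] XH Z by simp
    moreover have "generate G (insert ?b X) \<subseteq> ?H"
      using XH subgroup_commutator_mem(2)[OF H, of a g] by (intro generate_subgroup_incl H) auto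
    ultimately show ?thesis using centralizer_series_mono[OF _ order_refl] by blast
  qed
  then show ?thesis using ac g by (simp add: locally_hypercentral_def)
qed

text \<open>Let \<open>u\<close> centralize the class of \<open>g\<close> modulo the centralizer of the class of \<open>a\<close>, and vice versa. Then \<open>u\<close> centralizes the
class of \<open>[a, g]\<close>, by the three subgroups lemma. The elements \<open>u\<close> form a normal subgroup, and each
of the two conditions lowers the level by \<open>i + j\<close>.\<close>

lemma fc_weight_commutator:
  assumes a: "a \<in> carrier G" "fc_weight G i a" and g: "g \<in> carrier G" "fc_weight G j g"
  shows "fc_weight G (i + j) (group_commutator G a g)"
  unfolding fc_weight_def
proof (intro allI impI)
  fix n K assume K: "K \<lhd> G" and fc: "fc_mod G (n + (i + j)) K"
  let ?C = "centralizer_mod G (conj_class G a) K" and ?D = "centralizer_mod G (conj_class G g) K"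
  let ?CC = "centralizer_mod G (conj_class G g) ?C" and ?DD = "centralizer_mod G (conj_class G a) ?D"
  have C: "?C \<lhd> G" and D: "?D \<lhd> G" using a g K centralizer_mod_class_normal by auto
  have CC: "?CC \<lhd> G" and DD: "?DD \<lhd> G" using a g C D centralizer_mod_class_normal by auto
  have "n + (i + j) = (n + j) + i" "n + (i + j) = (n + i) + j" by auto
  then have "fc_mod G (n + j) ?C" "fc_mod G (n + i) ?D"
    using a(2) g(2) K fc unfolding fc_weight_def by metis+
  then have "fc_mod G n ?CC" "fc_mod G n ?DD"
    using a(2) g(2) C D unfolding fc_weight_def by metis+
  then have "fc_mod G n (?CC \<inter> ?DD)"
    by (intro fc_mod_Int centralizer_mod_carrier)
  moreover have "?CC \<inter> ?DD \<subseteq> centralizer_mod G (conj_class G (group_commutator G a g)) K"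
  proof
    fix u assume u: "u \<in> ?CC \<inter> ?DD"
    then have uc: "u \<in> carrier G" by (simp add: centralizer_mod_def)
    have "group_commutator G u y \<in> K" if y: "y \<in> conj_class G (group_commutator G a g)" for y
    proof -
      obtain h where h: "h \<in> carrier G" "y = conj_by G (group_commutator G a g) h"
        using y by (auto simp: conj_class_def)
      define a' g' where "a' = conj_by G a h" and "g' = conj_by G g h"
      have y': "y = group_commutator G a' g'" using h a g by (simp add: a'_def g'_def conj_by_commutator)
      have a'c: "a' \<in> carrier G" "g' \<in> carrier G" using a g h by (simp_all add: a'_def g'_def)
      have cl: "a' \<in> conj_class G a" "g' \<in> conj_class G g"
        using h by (auto simp: a'_def g'_def conj_class_def)
      have "group_commutator G y u \<in> K"
        unfolding y'
      proof (rule three_commutators[OF K a'c uc])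
        have "inv u \<in> ?CC" using u normal_subgroup_mem(4)[OF CC] by blast
        then have "g' \<in> {y \<in> carrier G. group_commutator G (inv u) y \<in> ?C}"
          using cl a'c by (simp add: centralizer_mod_def)
        then have "inv g' \<in> {y \<in> carrier G. group_commutator G (inv u) y \<in> ?C}"
          by (rule subgroup.m_inv_closed[OF commutator_kernel_subgroup[OF C inv_closed[OF uc]]])
        then have "group_commutator G (inv g') (inv u) \<in> ?C"
          using normal_commutator_swap[OF C] uc by simp
        then show "group_commutator G (group_commutator G (inv g') (inv u)) a' \<in> K"
          using cl by (simp add: centralizer_mod_def)
        have "a' \<in> {y \<in> carrier G. group_commutator G u y \<in> ?D}"
          using u cl a'c by (simp add: centralizer_mod_def)
        then have "inv a' \<in> {y \<in> carrier G. group_commutator G u y \<in> ?D}"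
          by (rule subgroup.m_inv_closed[OF commutator_kernel_subgroup[OF D uc]])
        then have "g' \<in> {y \<in> carrier G. group_commutator G (group_commutator G u (inv a')) y \<in> K}"
          using cl a'c by (simp add: centralizer_mod_def)
        moreover have "group_commutator G u (inv a') \<in> carrier G" using uc a'c by simp
        ultimately have "inv g' \<in> {y \<in> carrier G. group_commutator G (group_commutator G u (inv a')) y \<in> K}"
          by (intro subgroup.m_inv_closed[OF commutator_kernel_subgroup[OF K]])
        then show "group_commutator G (group_commutator G u (inv a')) (inv g') \<in> K" by simp
      qed
      then show ?thesis using normal_commutator_swap[OF K] uc y' a'c by simp
    qed
    then show "u \<in> centralizer_mod G (conj_class G (group_commutator G a g)) K"
      using uc by (simp add: centralizer_mod_def)
  qed
  ultimately show "fc_mod G n (centralizer_mod G (conj_class G (group_commutator G a g)) K)"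
    using fc_mod_mono[OF normal_subgroup_intersect[OF CC DD] centralizer_mod_class_normal[OF _ K]] a g
    by simp
qed

lemma fc_weight_1: "a \<in> carrier G \<Longrightarrow> fc_weight G 1 a"
  by (simp add: fc_weight_def)

text \<open>The centralizer \<open>C\<close> of the class of \<open>a\<close> has a finite transversal \<open>T\<close>. Commutators \<open>[a, g\<^sub>1, \<dots>, g\<^sub>k]\<close> do not
change if each \<open>g\<^sub>i\<close> is replaced by its representative in \<open>T\<close>, because \<open>C\<close> centralizes the normal closure of
\<open>a\<close>. So \<open>\<langle>a, T\<rangle>\<close> decides whether \<open>a\<close> lies in a given finite term.\<close>

lemma locally_hypercentral_finite_index:
  assumes a: "a \<in> locally_hypercentral G" and fin: "fc_mod G 0 (centralizer_mod G (conj_class G a) {\<one>})"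
  shows "\<exists>k. a \<in> centralizer_series G (carrier G) {\<one>} k"
proof -
  let ?C = "centralizer_mod G (conj_class G a) {\<one>}"
  have ac: "a \<in> carrier G" using a by (simp add: locally_hypercentral_def)
  have C: "?C \<lhd> G" using centralizer_mod_class_normal[OF ac one_is_normal] .
  let ?f = "\<lambda>g. ?C #> g"
  obtain T where T: "T \<subseteq> carrier G" "finite T" "?f ` carrier G = ?f ` T"
    using finite_subset_image[of "?f ` carrier G" ?f "carrier G"] fin by auto
  let ?H = "generate G (insert a T)"
  obtain k where k: "a \<in> centralizer_series G ?H {\<one>} k"
    using a T(1,2) unfolding locally_hypercentral_def by blast
  \<comment> \<open>\<open>?N\<close> is a normal subgroup that contains \<open>a\<close> and is centralized by \<open>?C\<close>.\<close>
  let ?N = "centralizer_mod G ?C {\<one>}"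
  have N: "?N \<lhd> G" using centralizer_mod_normal[OF normal_conj_closed[OF C] one_is_normal] .
  have aN: "a \<in> ?N"
  proof -
    have "group_commutator G a c = \<one>" if c: "c \<in> ?C" for c
    proof -
      have cc: "c \<in> carrier G" "group_commutator G c a = \<one>"
        using c conj_class_closed(2)[OF ac] by (auto simp: centralizer_mod_def)
      then show ?thesis using inv_commutator[OF cc(1) ac] by simp
    qed
    then show ?thesis using ac by (simp add: centralizer_mod_def)
  qed
  have "?N \<inter> centralizer_series G ?H {\<one>} j \<subseteq> centralizer_series G (carrier G) {\<one>} j" for j
  proof (induction j)
    case (Suc j)
    show ?case
    proof
      fix b assume b: "b \<in> ?N \<inter> centralizer_series G ?H {\<one>} (Suc j)"
      then have bc: "b \<in> carrier G" by (simp add: centralizer_mod_def)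
      have "group_commutator G b g \<in> centralizer_series G (carrier G) {\<one>} j" if g: "g \<in> carrier G" for g
      proof -
        obtain t where t: "t \<in> T" "?C #> g = ?C #> t" using g T(3) by blast
        then have "g \<in> ?C #> t" using rcos_self[OF g normal_imp_subgroup[OF C]] by simp
        then obtain c where c: "c \<in> ?C" "g = c \<otimes> t" by (auto simp: r_coset_def)
        have cc: "c \<in> carrier G" "t \<in> carrier G" using c t T by (auto simp: centralizer_mod_def)
        have "group_commutator G b c = \<one>" using b c by (auto simp: centralizer_mod_def)
        then have "group_commutator G b g = group_commutator G b t"
          using c(2) cc bc by (simp add: commutator_mult_right)
        moreover have "t \<in> ?H" using t by (auto intro: generate.incl)
        then have "group_commutator G b t \<in> centralizer_series G ?H {\<one>} j"
          using b by (auto simp: centralizer_mod_def)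
        moreover have "group_commutator G b t \<in> ?N"
          using b normal_commutator_left[OF N _ cc(2)] by blast
        ultimately show ?thesis using Suc by auto
      qed
      then show "b \<in> centralizer_series G (carrier G) {\<one>} (Suc j)"
        using bc by (simp add: centralizer_mod_def)
    qed
  qed simp
  then show ?thesis using aN k by blast
qed

lemma upper_central_omega_plus_eq:
  "upper_central_omega_plus G k =
    centralizer_series G (carrier G) (\<Union>j. centralizer_series G (carrier G) {\<one>} j) k"
proof (induction k)
  case 0
  then show ?case by (simp add: upper_central_omega upper_central_fin_eq)
next
  case (Suc k)
  have "upper_central_omega_plus G k \<lhd> G"
    unfolding upper_central_omega_plus_def
    using upper_central_normal_mono[OF lex_nat2_well_order] by blast
  then show ?case
    using Suc by (simp add: upper_central_omega_plus_Suc center_mod_eq_centralizer_mod)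
qed

text \<open>Each commutator with an element of \<open>G\<close> raises the weight by one and preserves local hypercentrality. After \<open>m\<close>
commutators the centralizer has finite index.\<close>

lemma locally_hypercentral_upper_central:
  "a \<in> locally_hypercentral G \<Longrightarrow> fc_weight G i a \<Longrightarrow> fc_mod G (m + i) {\<one>} \<Longrightarrow>
    a \<in> upper_central_omega_plus G m"
proof (induction m arbitrary: a i)
  case 0
  then have "fc_mod G 0 (centralizer_mod G (conj_class G a) {\<one>})"
    using one_is_normal unfolding fc_weight_def by blast
  then show ?case
    using locally_hypercentral_finite_index[OF 0(1)] by (auto simp: upper_central_omega_plus_eq)
next
  case (Suc m)
  have ac: "a \<in> carrier G" using Suc.prems by (simp add: locally_hypercentral_def)
  have "group_commutator G a g \<in> upper_central_omega_plus G m" if g: "g \<in> carrier G" for g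
  proof (rule Suc.IH)
    show "group_commutator G a g \<in> locally_hypercentral G"
      using locally_hypercentral_commutator[OF Suc.prems(1) g] .
    show "fc_weight G (i + 1) (group_commutator G a g)"
      using fc_weight_commutator[OF ac Suc.prems(2) g fc_weight_1[OF g]] .
    show "fc_mod G (m + (i + 1)) {\<one>}" using Suc.prems(3) by (simp only: add_Suc add_Suc_right add_0_right One_nat_def)
  qed
  then show ?case using ac by (simp add: upper_central_omega_plus_eq centralizer_mod_def)
qed

lemma fc_right_engel_upper_central:
  assumes "n \<ge> 1" "fc_mod G n {\<one>}"
  shows "right_engel G \<subseteq> upper_central_omega_plus G (n - 1)"
proof
  fix a assume a: "a \<in> right_engel G"
  then have "a \<in> carrier G" by (simp add: right_engel_def)
  then show "a \<in> upper_central_omega_plus G (n - 1)"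
    using a assms fc_right_engel_locally_hypercentral[OF assms(2)]
    by (intro locally_hypercentral_upper_central[of a 1] fc_weight_1) auto
qed

end

lemma fc_group_imp_fc_mod:
  assumes "fc_group n G"
  shows "fc_mod G n {\<one>\<^bsub>G\<^esub>}"
proof -
  interpret group G using assms by (rule fc_group_imp_group)
  have Q: "group (G Mod {\<one>\<^bsub>G\<^esub>})" using normal.factorgroup_is_group[OF one_is_normal] .
  have "G Mod {\<one>\<^bsub>G\<^esub>} \<cong> G" using trivial_factor_iso is_isoI by blast
  then have "G \<cong> G Mod {\<one>\<^bsub>G\<^esub>}" using group.iso_sym[OF Q] by blast
  then have "fc_group n (G Mod {\<one>\<^bsub>G\<^esub>})" using fc_group_iso[OF is_group Q] assms by blast
  then show ?thesis by (rule fc_group_Mod_imp_fc_mod[OF one_is_normal])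
qed


section \<open>The Fitting subgroup\<close>

context group
begin

lemma nilpotent_group_iff:
  assumes N: "N \<lhd> G"
  shows "nilpotent_group (G\<lparr>carrier := N\<rparr>) \<longleftrightarrow> nilpotent_subset G N"
proof -
  have sub: "subgroup N G" using N normal_imp_subgroup by blast
  interpret N: group "G\<lparr>carrier := N\<rparr>" using sub subgroup_imp_group by blast
  have "upper_central_fin (G\<lparr>carrier := N\<rparr>) c = N \<inter> centralizer_series G N {\<one>} c" for c
    using N.upper_central_fin_eq[of c] centralizer_series_subgroup[OF sub order_refl, of "{\<one>}" c]
      subgroup.one_closed[OF sub] by simp
  then show ?thesis
    unfolding nilpotent_group_def nilpotent_subset_def using N.is_group by auto
qed

lemma nilpotent_normal_Un:
  assumes A: "A \<lhd> G" "nilpotent_subset G A" and B: "B \<lhd> G" "nilpotent_subset G B"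
  shows "generate G (A \<union> B) \<lhd> G" "nilpotent_subset G (generate G (A \<union> B))"
proof -
  have AB: "conj_closed G (A \<union> B)"
    using normal_conj_closed[OF A(1)] normal_conj_closed[OF B(1)] by (auto simp: conj_closed_def)
  show N: "generate G (A \<union> B) \<lhd> G" using AB by (rule generate_conj_closed_normal)
  obtain c d where c: "A \<subseteq> centralizer_series G A {\<one>} c" and d: "B \<subseteq> centralizer_series G B {\<one>} d"
    using A B unfolding nilpotent_subset_def by blast
  have "carrier G \<subseteq> centralizer_series G (A \<union> B) {\<one>} (Suc c + Suc d)"
    using centralizer_series_Int_subset_Un[of A B "Suc c" "Suc d"]
      nilpotent_normal_series[OF A(1) c] nilpotent_normal_series[OF B(1) d]
      normal_conj_closed A(1) B(1) by (metis Int_absorb)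
  then have "generate G (A \<union> B) \<subseteq> centralizer_series G (generate G (A \<union> B)) {\<one>} (Suc c + Suc d)"
    using centralizer_series_generate[OF AB one_is_normal] normal_subgroup_mem(1)[OF N] by blast
  then show "nilpotent_subset G (generate G (A \<union> B))" unfolding nilpotent_subset_def by blast
qed

text \<open>By Fitting's theorem the union is already closed under products.\<close>

lemma fitting_subgroup_eq:
  "fitting_subgroup G = \<Union>{N. N \<lhd> G \<and> nilpotent_subset G N}"
proof
  let ?F = "\<Union>{N. N \<lhd> G \<and> nilpotent_subset G N}"
  have F: "fitting_subgroup G = generate G ?F"
    unfolding fitting_subgroup_def using nilpotent_group_iff by (metis (no_types, lifting) Collect_cong)
  show "?F \<subseteq> fitting_subgroup G" unfolding F by (auto intro: generate.incl)
  have "subgroup ?F G"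
  proof (rule subgroupI)
    show "?F \<subseteq> carrier G" using normal_subgroup_mem(1) by blast
    have "nilpotent_subset G {\<one>}" unfolding nilpotent_subset_def by (rule exI[of _ 0]) simp
    then have "{\<one>} \<in> {N. N \<lhd> G \<and> nilpotent_subset G N}" using one_is_normal by simp
    then show "?F \<noteq> {}" by blast
    show "inv a \<in> ?F" if "a \<in> ?F" for a
      using that normal_subgroup_mem(4) by blast
    show "a \<otimes> b \<in> ?F" if ab: "a \<in> ?F" "b \<in> ?F" for a b
    proof -
      obtain A B where A: "A \<lhd> G" "nilpotent_subset G A" "a \<in> A"
        and B: "B \<lhd> G" "nilpotent_subset G B" "b \<in> B" using ab by blast
      note AB = nilpotent_normal_Un[OF A(1,2) B(1,2)]
      have "a \<otimes> b \<in> generate G (A \<union> B)"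
        using A(3) B(3) by (intro generate.eng generate.incl) auto
      then show ?thesis using AB by blast
    qed
  qed
  then show "fitting_subgroup G \<subseteq> ?F" unfolding F by (intro generate_subgroup_incl) auto
qed

lemma fitting_subset_bounded_left_engel: "fitting_subgroup G \<subseteq> bounded_left_engel G"
proof
  fix a assume "a \<in> fitting_subgroup G"
  then obtain N c where N: "N \<lhd> G" "N \<subseteq> centralizer_series G N {\<one>} c" "a \<in> N"
    unfolding fitting_subgroup_eq nilpotent_subset_def by blast
  have "engel_commutator G g (Suc c) a = \<one>" if g: "g \<in> carrier G" for g
  proof -
    have "g \<in> centralizer_series G N {\<one>} (0 + Suc c)"
      using nilpotent_normal_series[OF N(1,2)] g by simp
    from engel_commutator_centralizer_series[OF this N(3)] show ?thesis by simp
  qed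
  then show "a \<in> bounded_left_engel G"
    using N normal_subgroup_mem(1)[OF N(1)] unfolding bounded_left_engel_def
    by (auto intro!: exI[of _ "Suc c"])
qed

lemma fc_left_engel_nilpotent:
  assumes fc: "fc_mod G n {\<one>}" and a: "a \<in> left_engel G"
  shows "nilpotent_subset G (generate G (conj_class G a))"
proof -
  have ac: "a \<in> carrier G" using a by (simp add: left_engel_def)
  have "\<forall>g\<in>carrier G. \<exists>m\<ge>1. engel_commutator G g m a \<in> {\<one>}"
    using a by (simp add: left_engel_def)
  from fc_left_engel_series[OF ac one_is_normal fc this] obtain k
    where "centralizer_series G (conj_class G a) {\<one>} k = carrier G" by blast
  then have "centralizer_series G (generate G (conj_class G a)) {\<one>} k = carrier G"
    using centralizer_series_generate[OF conj_class_closed(1)[OF ac] one_is_normal] by simp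
  moreover have "generate G (conj_class G a) \<subseteq> carrier G"
    using ac normal_subgroup_mem(1)[OF generate_conj_closed_normal[OF conj_class_closed(1)]] by blast
  ultimately show ?thesis unfolding nilpotent_subset_def by blast
qed

lemma fc_left_engel_subset_fitting:
  assumes fc: "fc_mod G n {\<one>}"
  shows "left_engel G \<subseteq> fitting_subgroup G"
proof
  fix a assume a: "a \<in> left_engel G"
  then have ac: "a \<in> carrier G" by (simp add: left_engel_def)
  have "generate G (conj_class G a) \<lhd> G"
    using ac by (intro generate_conj_closed_normal conj_class_closed)
  moreover have "a \<in> generate G (conj_class G a)"
    using ac by (intro generate.incl conj_class_closed)
  ultimately show "a \<in> fitting_subgroup G"
    unfolding fitting_subgroup_eq using fc_left_engel_nilpotent[OF fc a] by blast
qed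


section \<open>The hypercentre and subnormality of cyclic subgroups\<close>

text \<open>A commutator with \<open>g\<close> moves \<open>a\<close> to an earlier term, and there is no infinite descent.\<close>

lemma upper_central_right_engel:
  assumes r: "Well_order r" and g: "g \<in> carrier G"
  shows "a \<in> upper_central r G i \<Longrightarrow> \<exists>m\<ge>1. engel_commutator G a m g = \<one>"
proof (induction i arbitrary: a rule: underS_wf[OF r])
  case (1 i)
  consider "zero_pos r i" | j where "succ_pos r j i" | "lim_pos r i" by (rule pos_cases)
  then show ?case
  proof cases
    case 1
    then have "a = \<one>" using \<open>a \<in> upper_central r G i\<close> upper_central_zero[OF r 1, of G] by simp
    then have "engel_commutator G a 1 g = \<one>" using g by (simp del: engel_commutator.simps)
    then show ?thesis by blast
  next
    case (2 j)
    have "upper_central r G j \<lhd> G" using upper_central_normal_mono[OF r] by blast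
    then have "a \<in> centralizer_mod G (carrier G) (upper_central r G j)"
      using \<open>a \<in> upper_central r G i\<close> upper_central_succ[OF r 2, of G]
      by (simp add: center_mod_eq_centralizer_mod)
    then have "group_commutator G a g \<in> upper_central r G j" using g by (simp add: centralizer_mod_def)
    then obtain m where "engel_commutator G (group_commutator G a g) m g = \<one>"
      using "1.IH"[OF succ_pos_underS[OF r 2]] by blast
    then have "engel_commutator G a (1 + m) g = \<one>" using engel_commutator_add[of a 1 g m] by simp
    then show ?thesis by (metis le_add1)
  next
    case 3
    then show ?thesis using "1.IH" \<open>a \<in> upper_central r G i\<close> upper_central_lim[OF r 3, of G] by blast
  qed
qed

lemma hypercenter_subset_right_engel: "hypercenter G \<subseteq> right_engel G"
proof
  fix a assume "a \<in> hypercenter G"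
  then obtain r :: "'a set rel" and i where r: "Well_order r" "a \<in> upper_central r G i"
    unfolding hypercenter_def by blast
  have "upper_central r G i \<lhd> G" using upper_central_normal_mono[OF r(1)] by blast
  then have "a \<in> carrier G" using r(2) normal_subgroup_mem(1) by blast
  then show "a \<in> right_engel G"
    using upper_central_right_engel[OF r(1) _ r(2)] by (simp add: right_engel_def)
qed

lemma cyclic_join_subgroup:
  assumes T: "T \<lhd> G" and x: "x \<in> carrier G"
  shows "subgroup (T <#> generate G {x}) G" and "T \<subseteq> T <#> generate G {x}"
    and "generate G {x} \<subseteq> T <#> generate G {x}"
proof -
  have X: "subgroup (generate G {x}) G" using x by (intro generate_is_subgroup) auto
  interpret second_isomorphism_grp T G "generate G {x}"
    using T X by (simp add: second_isomorphism_grp_def second_isomorphism_grp_axioms_def)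
  show "subgroup (T <#> generate G {x}) G" by (rule normal_set_mult_subgroup)
  have c: "T \<subseteq> carrier G" "generate G {x} \<subseteq> carrier G"
    using normal_subgroup_mem(1)[OF T] subgroup.subset[OF X] by auto
  show "T \<subseteq> T <#> generate G {x}"
  proof
    fix t assume t: "t \<in> T"
    then have "t \<otimes> \<one> \<in> T <#> generate G {x}"
      unfolding set_mult_def using subgroup.one_closed[OF X] by blast
    then show "t \<in> T <#> generate G {x}" using t c by auto
  qed
  show "generate G {x} \<subseteq> T <#> generate G {x}"
  proof
    fix y assume y: "y \<in> generate G {x}"
    then have "\<one> \<otimes> y \<in> T <#> generate G {x}"
      unfolding set_mult_def using normal_subgroup_mem(2)[OF T] by blast
    then show "y \<in> T <#> generate G {x}" using y c by auto
  qed
qed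

text \<open>Elements \<open>t\<close> of \<open>T'\<close> normalise \<open>T \<langle>x\<rangle>\<close> because \<open>e\<^sup>t = e [e, t]\<close> with \<open>[e, t] \<in> T\<close>. Applied to the
terms of a central series, this gives an ascending series that starts at \<open>\<langle>x\<rangle>\<close>.\<close>

lemma cyclic_join_normal:
  assumes T: "T \<lhd> G" and T': "T' \<lhd> G" and x: "x \<in> carrier G" and sub: "T \<subseteq> T'"
    and central: "\<And>t g. t \<in> T' \<Longrightarrow> g \<in> carrier G \<Longrightarrow> group_commutator G t g \<in> T"
  shows "T <#> generate G {x} \<lhd> G\<lparr>carrier := T' <#> generate G {x}\<rparr>"
proof (rule set_normalizer_normal)
  let ?S = "T <#> generate G {x}"
  note S = cyclic_join_subgroup[OF T x] and S' = cyclic_join_subgroup[OF T' x]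
  show "subgroup ?S G" "subgroup (T' <#> generate G {x}) G" using S S' by auto
  show "?S \<subseteq> T' <#> generate G {x}" using sub by (auto simp: set_mult_def)
  have Sc: "?S \<subseteq> carrier G" using subgroup.subset[OF S(1)] .
  note nS = set_normalizer_subgroup[OF Sc]
  have conj: "conj_by G e t \<in> ?S" if "e \<in> ?S" "t \<in> T'" for e t
  proof -
    have c: "e \<in> carrier G" "t \<in> carrier G" using that Sc normal_subgroup_mem(1)[OF T'] by auto
    then have "group_commutator G e t \<in> ?S"
      using normal_commutator_swap[OF T] central that S(2) by blast
    then show ?thesis
      using that c subgroup.m_closed[OF S(1)] by (simp add: conj_by_eq_mult_commutator)
  qed
  have "T' \<subseteq> set_normalizer G ?S"
    using conj normal_subgroup_mem(1,4)[OF T'] by (auto simp: set_normalizer_def)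
  moreover have "generate G {x} \<subseteq> set_normalizer G ?S"
    using subgroup_subset_set_normalizer[OF S(1)] S(3) by blast
  ultimately show "T' <#> generate G {x} \<subseteq> set_normalizer G ?S"
    using subgroup.m_closed[OF nS] by (auto simp: set_mult_def)
qed

lemma join_normal_closure_facts:
  assumes x: "x \<in> carrier G" and a: "a \<in> carrier G"
  defines "K \<equiv> generate G ({x} \<union> normal_closure G a)"
  shows "subgroup K G" "x \<in> K" "normal_closure G a \<subseteq> K" "a \<in> K"
    "generate (G\<lparr>carrier := K\<rparr>) {x} = generate G {x}"
    "generate (G\<lparr>carrier := K\<rparr>) (insert x (normal_closure G a)) = K"
proof -
  show K: "subgroup K G"
    unfolding K_def using x normal_closure_subset[OF a] by (intro generate_is_subgroup) auto
  show xK: "x \<in> K" and NK: "normal_closure G a \<subseteq> K" unfolding K_def by (auto intro: generate.incl)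
  have "a \<in> normal_closure G a" by (auto simp: normal_closure_def intro: generate.incl)
  then show "a \<in> K" using NK by blast
  show "generate (G\<lparr>carrier := K\<rparr>) {x} = generate G {x}"
    using generate_consistent[OF _ K, of "{x}"] xK by simp
  show "generate (G\<lparr>carrier := K\<rparr>) (insert x (normal_closure G a)) = K"
    using generate_consistent[OF _ K, of "insert x (normal_closure G a)"] xK NK by (simp add: K_def)
qed

text \<open>Within \<open>K = \<langle>x, a\<^sup>G\<rangle>\<close> the subgroups \<open>(K \<inter> Z\<^sub>i) \<langle>x\<rangle>\<close> form an ascending series, where \<open>Z\<^sub>i\<close> is the term of index \<open>i\<close> of the
upper central series of \<open>G\<close>. It reaches \<open>K\<close> at an index \<open>t\<close> with \<open>a \<in> Z\<^sub>t\<close>.\<close>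

lemma hypercenter_subset_rho: "hypercenter G \<subseteq> rho G"
proof
  fix a assume "a \<in> hypercenter G"
  then obtain w :: "'a set rel" and t where w: "Well_order w" "t \<in> Field w" "a \<in> upper_central w G t"
    unfolding hypercenter_def by blast
  let ?Z = "upper_central w G"
  have Z: "?Z i \<lhd> G" for i using upper_central_normal_mono[OF w(1)] by blast
  have ac: "a \<in> carrier G" using w(3) normal_subgroup_mem(1)[OF Z] by blast
  have "ascendant (generate G {x}) (join_normal_closure G x a)" if x: "x \<in> carrier G" for x
  proof -
    define K where "K = generate G ({x} \<union> normal_closure G a)"
    note Kf = join_normal_closure_facts[OF x ac, folded K_def]
    let ?K = "G\<lparr>carrier := K\<rparr>"
    interpret K: group ?K using Kf(1) subgroup_imp_group by blast
    let ?T = "\<lambda>i. K \<inter> ?Z i"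
    have T: "?T i \<lhd> ?K" for i using subgroup_Int_normal[OF Kf(1) Z] .
    have xK: "x \<in> carrier ?K" using Kf(2) by simp
    define S where "S = (\<lambda>i. ?T i <#>\<^bsub>?K\<^esub> generate ?K {x})"
    \<comment> \<open>An ascending series ends with a last index, so the well-order is cut off after \<open>t\<close>.\<close>
    define P where "P = under w t"
    define r where "r = Restr w P"
    have PF: "P \<subseteq> Field w" by (auto simp: P_def under_def Field_def)
    have refl: "refl_on (Field w) w" and trans: "trans w"
      using w(1) by (auto simp: order_on_defs well_order_on_def)
    have down: "j \<in> P" if "(j, i) \<in> w" "i \<in> P" for i j
      using that trans by (auto simp: P_def under_def trans_def)
    have r: "Well_order r" unfolding r_def using w(1) by (rule Well_order_Restr)
    have Fr: "Field r = P" unfolding r_def using refl PF by (rule Refl_Field_Restr2)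
    have uS: "underS r i = underS w i" and u: "under r i = under w i" if "i \<in> P" for i
      using that down by (auto simp: r_def underS_def under_def)
    have tP: "t \<in> P" using refl w(2) by (auto simp: P_def under_def refl_on_def)
    have "\<exists>z\<in>P. underS w z = {}"
    proof -
      have "i \<in> P \<longrightarrow> (\<exists>z\<in>P. underS w z = {})" for i
      proof (induction i rule: underS_wf[OF w(1)])
        case (1 i)
        then show ?case using down by (auto simp: underS_def)
      qed
      then show ?thesis using tP by blast
    qed
    then obtain z where z: "z \<in> P" "underS w z = {}" by blast
    have "S z = generate G {x}"
    proof -
      have "?Z z = {\<one>}" using upper_central_zero[OF w(1)] z(2) by (simp add: zero_pos_def)
      then have "?T z = {\<one>}" using subgroup.one_closed[OF Kf(1)] by auto
      moreover have "generate G {x} \<subseteq> carrier G" using x by (intro generate_incl) auto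
      ultimately show ?thesis
        unfolding S_def Kf(5) by (auto simp: set_mult_def subset_iff)
    qed
    moreover have "S t = carrier ?K"
    proof
      note St = K.cyclic_join_subgroup[OF T[of t] xK]
      have "normal_closure G a \<subseteq> ?Z t"
        using conj_class_subset[OF normal_conj_closed[OF Z] w(3)] normal_closure_eq_generate[OF ac]
          generate_subgroup_incl[OF _ normal_imp_subgroup[OF Z]] by metis
      then have "normal_closure G a \<subseteq> S t" using Kf(3) St(2) unfolding S_def by blast
      moreover have "x \<in> S t" using St(3) unfolding S_def by (auto intro: generate.incl)
      ultimately have "generate ?K (insert x (normal_closure G a)) \<subseteq> S t"
        using St(1) unfolding S_def by (intro K.generate_subgroup_incl) auto
      then show "carrier ?K \<subseteq> S t" using Kf(6) by simp
      show "S t \<subseteq> carrier ?K" using subgroup.subset[OF St(1)] unfolding S_def .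
    qed
    moreover have "S i \<lhd> ?K\<lparr>carrier := S j\<rparr>" if ij: "i \<in> P" "j \<in> P" "succ_pos r i j" for i j
    proof -
      have succ: "succ_pos w i j" using ij uS[OF ij(2)] u[OF ij(1)] PF by (auto simp: succ_pos_def)
      have eq: "?Z j = centralizer_mod G (carrier G) (?Z i)"
        using upper_central_succ[OF w(1) succ, of G] center_mod_eq_centralizer_mod[OF Z] by simp
      show ?thesis
        unfolding S_def
      proof (rule K.cyclic_join_normal[OF T T xK])
        show "?T i \<subseteq> ?T j" using eq centralizer_mod_extends[OF order_refl Z] by blast
        fix b g assume b: "b \<in> ?T j" and g: "g \<in> carrier ?K"
        then have "g \<in> K" "g \<in> carrier G" using subgroup.subset[OF Kf(1)] by auto
        then show "group_commutator ?K b g \<in> ?T i"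
          using b eq subgroup_commutator_eq(2)[OF Kf(1), of b g] subgroup_commutator_mem(2)[OF Kf(1), of b g]
          by (auto simp: centralizer_mod_def)
      qed
    qed
    moreover have "S i = (\<Union>j\<in>underS r i. S j)" if i: "i \<in> P" "lim_pos r i" for i
    proof -
      have "\<not> succ_pos w j i" for j
      proof
        assume s: "succ_pos w j i"
        then have "j \<in> P" using succ_pos_underS[OF w(1) s] down i(1) by (auto simp: underS_def)
        then have "succ_pos r j i" using s uS[OF i(1)] u Fr by (simp add: succ_pos_def)
        then show False using i by (auto simp: lim_pos_def)
      qed
      then have "lim_pos w i" using i uS[OF i(1)] by (auto simp: lim_pos_def zero_pos_def)
      then have "?Z i = (\<Union>j\<in>underS r i. ?Z j)"
        using upper_central_lim[OF w(1)] uS[OF i(1)] by simp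
      then show ?thesis by (auto simp: S_def set_mult_def)
    qed
    moreover have "subgroup (S i) ?K" for i
      unfolding S_def using K.cyclic_join_subgroup(1)[OF T xK] .
    moreover have "zero_pos r z" using z uS[OF z(1)] by (simp add: zero_pos_def)
    moreover have "(i, t) \<in> r" if "i \<in> P" for i
      using that tP by (auto simp: r_def P_def under_def)
    ultimately have "ascending_series r S (generate G {x}) ?K"
      using r z tP unfolding ascending_series_def Fr by blast
    then show ?thesis
      unfolding join_normal_closure_def K_def[symmetric] by (rule ascending_series_imp_ascendant)
  qed
  then show "a \<in> rho G" using ac by (simp add: rho_def)
qed

lemma series_step_commutator:
  assumes S': "subgroup S' G" and S: "S \<lhd> G\<lparr>carrier := S'\<rparr>" and x: "x \<in> S" and b: "b \<in> S'"
  shows "group_commutator G b x \<in> S"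
proof -
  interpret S': group "G\<lparr>carrier := S'\<rparr>" using S' subgroup_imp_group by blast
  have "S \<subseteq> S'" using S'.normal_subgroup_mem(1)[OF S] by simp
  then show ?thesis
    using S'.normal_commutator_right[OF S, of b x] x b subgroup_commutator_eq(2)[OF S', of b x] by auto
qed

lemma engel_commutator_cyclic:
  assumes x: "x \<in> carrier G" and "engel_commutator G b m x \<in> generate G {x}"
  shows "engel_commutator G b (Suc m) x = \<one>"
proof -
  have "generate G {x} \<subseteq> {y \<in> carrier G. group_commutator G y x \<in> {\<one>}}"
    using x by (intro generate_subgroup_incl commutator_kernel_subgroup_left one_is_normal) auto
  then show ?thesis using assms(2) by auto
qed

text \<open>Commutation with \<open>x\<close> takes each term of an ascending series from \<open>\<langle>x\<rangle>\<close> into an earlier one. By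
well-foundedness some \<open>[a,\<^sub>m x]\<close> lies in \<open>\<langle>x\<rangle>\<close>, and one more commutator kills it.\<close>

lemma rho_subset_right_engel: "rho G \<subseteq> right_engel G"
proof
  fix a assume a: "a \<in> rho G"
  then have ac: "a \<in> carrier G" by (simp add: rho_def)
  have "\<exists>m\<ge>1. engel_commutator G a m x = \<one>" if x: "x \<in> carrier G" for x
  proof -
    define K where "K = generate G ({x} \<union> normal_closure G a)"
    note Kf = join_normal_closure_facts[OF x ac, folded K_def]
    let ?K = "G\<lparr>carrier := K\<rparr>"
    have "ascendant (generate G {x}) ?K"
      using a x unfolding rho_def join_normal_closure_def K_def by blast
    then obtain r :: "'a set rel" and S where S: "ascending_series r S (generate G {x}) ?K"
      unfolding ascendant_def by blast
    have r: "Well_order r" using S by (simp add: ascending_series_def)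
    have sub: "subgroup (S i) G" if "i \<in> Field r" for i
      using S that incl_subgroup[OF Kf(1)] unfolding ascending_series_def by blast
    obtain z where z: "z \<in> Field r" "zero_pos r z" "S z = generate G {x}"
      using S unfolding ascending_series_def by blast
    have zi: "z = i \<or> z \<in> underS r i" if "i \<in> Field r" for i
      using underS_cases[OF r z(1) that] z(2) by (auto simp: zero_pos_def)
    have xS: "x \<in> S i" if "i \<in> Field r" for i
      using zi[OF that] ascending_series_mono[OF S] z(3) generate.incl[of x "{x}" G] by blast
    have "i \<in> Field r \<longrightarrow> (\<forall>b\<in>S i. \<exists>m. engel_commutator G b m x \<in> generate G {x})" for i
    proof (induction i rule: underS_wf[OF r])
      case (1 i)
      show ?case
      proof (intro impI ballI)
        fix b assume i: "i \<in> Field r" and b: "b \<in> S i"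
        consider "zero_pos r i" | j where "succ_pos r j i" | "lim_pos r i" by (rule pos_cases)
        then show "\<exists>m. engel_commutator G b m x \<in> generate G {x}"
        proof cases
          case 1
          then have "z = i" using zi[OF i] by (auto simp: zero_pos_def)
          then have "engel_commutator G b 0 x \<in> generate G {x}" using b z(3) by simp
          then show ?thesis by blast
        next
          case (2 j)
          have j: "j \<in> underS r i" "j \<in> Field r"
            using succ_pos_underS[OF r 2] underS_Field(1)[OF r] by blast+
          have "S j \<lhd> ?K\<lparr>carrier := S i\<rparr>" using S i j 2 unfolding ascending_series_def by blast
          then have "group_commutator G b x \<in> S j"
            using series_step_commutator[OF sub[OF i] _ xS[OF j(2)] b] by simp
          then obtain m where "engel_commutator G (group_commutator G b x) m x \<in> generate G {x}"
            using "1.IH"[OF j(1)] j(2) by blast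
          then have "engel_commutator G b (1 + m) x \<in> generate G {x}"
            using engel_commutator_add[of b 1 x m] by simp
          then show ?thesis by blast
        next
          case 3
          then have "S i = (\<Union>j\<in>underS r i. S j)" using S i unfolding ascending_series_def by blast
          then show ?thesis using b "1.IH" underS_Field(1)[OF r] by blast
        qed
      qed
    qed
    moreover obtain t where "t \<in> Field r" "S t = K"
      using S unfolding ascending_series_def by auto
    ultimately obtain m where "engel_commutator G a m x \<in> generate G {x}" using Kf(4) by blast
    then have "engel_commutator G a (Suc m) x = \<one>" using engel_commutator_cyclic[OF x] by blast
    then show ?thesis by (metis One_nat_def Suc_le_mono zero_le)
  qed
  then show "a \<in> right_engel G" using ac by (simp add: right_engel_def)
qed

lemma bounded_rho_subset_bounded_right_engel: "bounded_rho G \<subseteq> bounded_right_engel G"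
proof
  fix a assume a: "a \<in> bounded_rho G"
  then have ac: "a \<in> carrier G" by (simp add: bounded_rho_def)
  obtain k where k: "\<And>x. x \<in> carrier G \<Longrightarrow>
      subnormal_defect_le k (generate G {x}) (join_normal_closure G x a)"
    using a unfolding bounded_rho_def by blast
  have "engel_commutator G a (Suc k) x = \<one>" if x: "x \<in> carrier G" for x
  proof -
    define K where "K = generate G ({x} \<union> normal_closure G a)"
    note Kf = join_normal_closure_facts[OF x ac, folded K_def]
    let ?K = "G\<lparr>carrier := K\<rparr>"
    obtain d S where d: "d \<le> k" and sub: "\<And>i. i \<le> d \<Longrightarrow> subgroup (S i) ?K" and S0: "S 0 = generate G {x}"
      and Sd: "S d = K" and norm: "\<And>i. i < d \<Longrightarrow> S i \<lhd> ?K\<lparr>carrier := S (Suc i)\<rparr>"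
      using k[OF x] unfolding subnormal_defect_le_def join_normal_closure_def K_def[symmetric] by auto
    have subG: "subgroup (S i) G" if "i \<le> d" for i using incl_subgroup[OF Kf(1) sub[OF that]] .
    have xS: "x \<in> S i" if "i \<le> d" for i
      using that
    proof (induction i)
      case 0
      then show ?case using S0 by (auto intro: generate.incl)
    next
      case (Suc i)
      have "S i \<subseteq> S (Suc i)"
        using normal_imp_subgroup[OF norm[of i]] Suc subgroup.subset by fastforce
      then show ?case using Suc by auto
    qed
    have "i \<le> d \<Longrightarrow> engel_commutator G a i x \<in> S (d - i)" for i
    proof (induction i)
      case 0
      then show ?case using Kf(4) Sd by simp
    next
      case (Suc i)
      have "S (d - Suc i) \<lhd> G\<lparr>carrier := S (d - i)\<rparr>"
        using norm[of "d - Suc i"] Suc.prems by (simp add: Suc_diff_Suc)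
      then show ?case
        using series_step_commutator[OF subG _ xS, of "d - i" "d - Suc i"] Suc by simp
    qed
    from this[of d] have "engel_commutator G a (Suc d) x = \<one>"
      using S0 by (intro engel_commutator_cyclic x) simp
    then show ?thesis using engel_commutator_eventually[of a "Suc d" x "Suc k"] d x by blast
  qed
  then show "a \<in> bounded_right_engel G"
    using ac unfolding bounded_right_engel_def by (auto intro!: exI[of _ "Suc k"])
qed

text \<open>The class \<open>c\<close> of \<open>a\<^sup>G\<close> and the Engel bound \<open>m\<close> do not depend on \<open>x\<close>. The subgroups \<open>T\<^sub>i \<langle>x\<rangle>\<close>, with \<open>T\<^sub>i\<close> the upper
central series of \<open>\<langle>x, a\<^sup>G\<rangle>\<close>, reach the whole group after \<open>(2\<^sup>c - 1) m\<close> steps.\<close>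

lemma fc_bounded_right_engel_subset_bounded_rho:
  assumes fc: "fc_mod G n {\<one>}"
  shows "bounded_right_engel G \<subseteq> bounded_rho G"
proof
  fix a assume a: "a \<in> bounded_right_engel G"
  then have ac: "a \<in> carrier G" by (simp add: bounded_right_engel_def)
  obtain m where m: "\<And>g. g \<in> carrier G \<Longrightarrow> engel_commutator G a m g = \<one>"
    using a unfolding bounded_right_engel_def by blast
  have "a \<in> right_engel G" using a unfolding bounded_right_engel_def right_engel_def by blast
  then have "nilpotent_subset G (generate G (conj_class G (inv a)))"
    by (intro fc_left_engel_nilpotent[OF fc] inv_right_engel_left_engel)
  then have "nilpotent_subset G (generate G (conj_class G a))"
    using generate_conj_class_inv_subset[OF ac] by (rule nilpotent_subset_mono)
  then obtain c where c: "normal_closure G a \<subseteq> centralizer_series G (normal_closure G a) {\<one>} c"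
    unfolding normal_closure_eq_generate[OF ac] nilpotent_subset_def by blast
  define f where "f = (2 ^ c - 1) * m"
  have N: "normal_closure G a \<lhd> G" using normal_closure_normal[OF ac] .
  have "subnormal_defect_le f (generate G {x}) (join_normal_closure G x a)" if x: "x \<in> carrier G" for x
  proof -
    define K where "K = generate G ({x} \<union> normal_closure G a)"
    note Kf = join_normal_closure_facts[OF x ac, folded K_def]
    let ?K = "G\<lparr>carrier := K\<rparr>"
    interpret K: group ?K using Kf(1) subgroup_imp_group by blast
    let ?T = "centralizer_series ?K (carrier ?K) {\<one>\<^bsub>?K\<^esub>}"
    have T: "?T i \<lhd> ?K" for i
      by (intro K.centralizer_series_normal K.carrier_conj_closed K.one_is_normal)
    have xK: "x \<in> carrier ?K" using Kf(2) by simp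
    have engel: "engel_commutator G b m x = \<one>" if b: "b \<in> conj_class G a" for b
    proof -
      obtain h where h: "h \<in> carrier G" "b = conj_by G a h" using b by (auto simp: conj_class_def)
      show ?thesis unfolding h(2) using m x h by (intro engel_commutator_conj_eq_one ac) auto
    qed
    have "x \<in> set_normalizer G (normal_closure G a)"
      using x normal_conj_by[OF N] by (auto simp: set_normalizer_def)
    from engel_action_hypercentral(2)[OF normal_imp_subgroup[OF N] c this normal_closure_eq_generate[OF ac] engel]
    have top: "normal_closure G a \<subseteq> ?T f" by (simp add: K_def f_def)
    define S where "S = (\<lambda>i. ?T i <#>\<^bsub>?K\<^esub> generate ?K {x})"
    have S: "subgroup (S i) ?K" for i unfolding S_def using K.cyclic_join_subgroup(1)[OF T xK] .
    moreover have "S 0 = generate G {x}"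
    proof -
      have "generate G {x} \<subseteq> carrier G" using x by (intro generate_incl) auto
      then show ?thesis unfolding S_def Kf(5) by (auto simp: set_mult_def subset_iff)
    qed
    moreover have "S f = carrier ?K"
    proof
      note Sf = K.cyclic_join_subgroup[OF T[of f] xK]
      have "insert x (normal_closure G a) \<subseteq> S f"
        using top Sf(2,3) generate.incl[of x "{x}" ?K] unfolding S_def by blast
      then have "generate ?K (insert x (normal_closure G a)) \<subseteq> S f"
        by (rule K.generate_subgroup_incl[OF _ S])
      then show "carrier ?K \<subseteq> S f" using Kf(6) by simp
      show "S f \<subseteq> carrier ?K" using subgroup.subset[OF S] .
    qed
    moreover have "S i \<lhd> ?K\<lparr>carrier := S (Suc i)\<rparr>" for i
      unfolding S_def
    proof (rule K.cyclic_join_normal[OF T T xK])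
      show "?T i \<subseteq> ?T (Suc i)"
        using K.centralizer_series_increasing[OF K.carrier_conj_closed K.one_is_normal, of i "Suc i"] by simp
      show "group_commutator ?K t g \<in> ?T i" if "t \<in> ?T (Suc i)" "g \<in> carrier ?K" for t g
        using that by (simp add: centralizer_mod_def)
    qed
    ultimately show ?thesis
      unfolding subnormal_defect_le_def join_normal_closure_def K_def[symmetric]
      by (intro exI[of _ f] exI[of _ S] conjI) auto
  qed
  then show "a \<in> bounded_rho G" using ac unfolding bounded_rho_def by blast
qed

end

theorem theorem2p4:
  fixes G :: "'a monoid" and n :: nat
  assumes "n \<ge> 1" and "fc_group n G"
  shows "(left_engel G = bounded_left_engel G \<and> bounded_left_engel G = fitting_subgroup G)
    \<and> (right_engel G = rho G \<and> rho G = hypercenter G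
        \<and> hypercenter G = upper_central_omega_plus G (n - 1))
    \<and> bounded_right_engel G = bounded_rho G"
proof -
  interpret group G using assms(2) by (rule fc_group_imp_group)
  have fc: "fc_mod G n {\<one>\<^bsub>G\<^esub>}" using assms(2) by (rule fc_group_imp_fc_mod)
  have "bounded_left_engel G \<subseteq> left_engel G"
    unfolding bounded_left_engel_def left_engel_def by blast
  moreover have "upper_central_omega_plus G (n - 1) \<subseteq> hypercenter G"
    unfolding upper_central_omega_plus_def
    by (rule upper_central_subset_hypercenter[OF lex_nat2_well_order])
  ultimately show ?thesis
    using fc_left_engel_subset_fitting[OF fc] fitting_subset_bounded_left_engel
      fc_right_engel_upper_central[OF assms(1) fc] hypercenter_subset_right_engel
      hypercenter_subset_rho rho_subset_right_engel
      bounded_rho_subset_bounded_right_engel fc_bounded_right_engel_subset_bounded_rho[OF fc]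
    by (intro conjI subset_antisym) (blast intro: subset_trans)+
qed

end
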